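(* Let ${\cal H}$ be a real separable Hilbert space, let $k$ be a positive integer with $k \leq \dim {\cal H}$, let $\alpha > 0$, and let $\mu$ be a $k$-admissible measure on ${\cal H}$. Then the following five conditions are equivalent: 1. There is a constant $C_\alpha < \infty$ such that $\mu(B) \leq C_\alpha |B|_k^\alpha$ for all ellipsoids $B \subset {\cal H}$. 2. For any $\gamma \in (0,\alpha)$ and any exponents $p_1,\ldots,p_{k+1} \in [1,\infty]$ satisfying $1 - \frac{1}{p_i} < \frac{\gamma}{k\alpha}$ for all $i$ and $\sum_{i=1}^{k+1} \left(1 - \frac{1}{p_i}\right) = \frac{\gamma}{\alpha}$, there is a finite constant $C$, independent of the functions $f_1,\ldots,f_{k+1}$, such that $$\left| T^{-\gamma}_{\mu,k}(f_1,\ldots,f_{k+1}) \right| \leq C \prod_{i=1}^{k+1} \|f_i\|_{L^{p_i}(\mu)}. \qquad ( * )$$ 3. For some $\gamma \in (0,\infty)$ and some exponents $p_1,\ldots,p_{k+1} \in [1,\infty]$ satisfying $\sum_{i=1}^{k+1}\left(1 - \frac{1}{p_i}\right) = \frac{\gamma}{\alpha}$, the inequality $( * )$ holds, with a finite constant $C$ independent of the functions, whenever each $f_i$ is a characteristic function of a measurable set. 4. For any $\gamma \in (0,\infty)$ and any exponents $p_1,\ldots,p_{k+1} \in [0,1]$ satisfying $\frac{1}{p_i} - 1 < \frac{\gamma}{k\alpha}$ for all $i$ and $\sum_{i=1}^{k+1}\left(\frac{1}{p_i} - 1\right) = \frac{\gamma}{\alpha}$, there is a constant $c > 0$, independent of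 the functions $f_1,\ldots,f_{k+1}$, such that $$T^{\gamma}_{\mu,k}(|f_1|,\ldots,|f_{k+1}|) \geq c \prod_{i=1}^{k+1} \|f_i\|_{L^{p_i}(\mu)}. \qquad ( ** )$$ 5. For some $\gamma \in (0,\infty)$ and some exponents $p_1,\ldots,p_{k+1} \in [0,1]$ satisfying $\sum_{i=1}^{k+1}\left(\frac{1}{p_i} - 1\right) = \frac{\gamma}{\alpha}$, the inequality $( ** )$ holds, with a constant $c>0$ independent of the functions, whenever each $f_i$ is a characteristic function of a measurable set.
   Context: Determinant function: for $y_1,\ldots,y_{k+1} \in {\cal H}$, $\det(y_1,\ldots,y_{k+1})$ denotes $k!$ times the Euclidean $k$-dimensional volume of the simplex with vertices $y_1,\ldots,y_{k+1}$, i.e. the (nonnegative) square root of the determinant of the $k\times k$ matrix whose $(i,j)$-entry is $\langle y_i - y_{k+1}, y_j - y_{k+1}\rangle_{\cal H}$. $k$-admissible: a measure $\mu$ on ${\cal H}$ is $k$-admissible if it is a nonnegative, $\sigma$-finite Borel measure such that every affine $(k-1)$-dimensional subspace of ${\cal H}$ has $\mu$-measure zero. Under this assumption the set where $\det(y_1,\ldots,y_{k+1}) = 0$ is null for the product measure $\mu^{k+1}$. Functional: for real $s$ and measurable functions $f_1,\ldots,f_{k+1}$ on ${\cal H}$, $$T^{s}_{\mu,k}(f_1,\ldots,f_{k+1}) := \int\cdots\int \prod_{j=1}^{k+1} f_j(y_j)\, (\det(y_1,\ldots,y_{k+1}))^{s}\, d\mu(y_1)\cdots d\mu(y_{k+1}).$$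 Ellipsoids: a subset $B\subset{\cal H}$ is an ellipsoid if $B = \left\{ x\in{\cal H} : \sum_i \frac{|\langle x - x_0,\omega_i\rangle|^2}{\ell_i^2} \leq 1\right\}$ for some $x_0\in{\cal H}$, some orthonormal basis $\{\omega_i\}$ of ${\cal H}$ and lengths $\ell_i\in[0,\infty]$ (a length $\ell_i=0$ forces $\langle x-x_0,\omega_i\rangle = 0$, a length $\ell_i=\infty$ imposes no restriction in direction $\omega_i$). The $k$-content $|B|_k$ is the supremum of $\ell_{i_1}\cdots\ell_{i_k}$ over all indices $i_1<\cdots<i_k$, with the convention that a product is zero if any individual length in it is zero, even if other lengths are infinite. For $0<p<1$, $\|f\|_{L^p(\mu)} = (\int |f|^p d\mu)^{1/p}$. The convention $1/0=\infty$ means the value $p_i=0$ is automatically excluded by the constraints on the exponents. Products of norms use the usual convention $0\cdot\infty = 0$. *)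

theory Defs
  imports "HOL-Probability.Essential_Supremum" "HOL-Library.Extended_Nat"
    "Jordan_Normal_Form.Determinant"
begin

text \<open>
  The type class sort \<open>{real_inner, polish_space}\<close> describes the real separable Hilbert
  spaces (of finite or infinite dimension). Points \<open>y\<^sub>1, \<dots>, y\<^bsub>k+1\<^esub>\<close>, functions and exponents
  are indexed by \<open>{..k}\<close>, i.e. from \<open>0\<close> to \<open>k\<close>, throughout.
\<close>

(* The library constant dim is 0 on infinite-dimensional spaces, and aff_dim exists for
   Euclidean spaces only. *)
definition vdim :: "'a::real_vector set \<Rightarrow> enat" where
  "vdim S = (SUP B\<in>{B. B \<subseteq> S \<and> finite B \<and> independent B}. enat (card B))"

definition affine_subspace :: "nat \<Rightarrow> 'a::real_vector set \<Rightarrow> bool" where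
  "affine_subspace d A \<longleftrightarrow> (\<exists>a V. subspace V \<and> vdim V = enat d \<and> A = (+) a ` V)"

definition k_admissible :: "nat \<Rightarrow> 'a::{real_inner, polish_space} measure \<Rightarrow> bool" where
  "k_admissible k \<mu> \<longleftrightarrow>
     sets \<mu> = sets borel \<and> sigma_finite_measure \<mu> \<and>
     (\<forall>A. affine_subspace (k - 1) A \<longrightarrow> A \<in> null_sets \<mu>)"

definition simplex_det :: "nat \<Rightarrow> (nat \<Rightarrow> 'a::real_inner) \<Rightarrow> real" where
  "simplex_det k y =
     sqrt (Determinant.det (Matrix.mat k k (\<lambda>(i, j). inner (y i - y k) (y j - y k))))"

text \<open>
  The functional for complex-valued functions and, as an integral with values in
  \<open>[0, \<infinity>]\<close>, for nonnegative functions. Since \<open>0 powr s = 0\<close>, the integrand is \<open>0\<close> where the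
  determinant vanishes, also for negative \<open>s\<close>; this is a null set for admissible measures.
\<close>

definition det_integrand ::
  "nat \<Rightarrow> real \<Rightarrow> (nat \<Rightarrow> 'a::real_inner \<Rightarrow> complex) \<Rightarrow> (nat \<Rightarrow> 'a) \<Rightarrow> complex" where
  "det_integrand k s f y = (\<Prod>j\<le>k. f j (y j)) * of_real (simplex_det k y powr s)"

definition det_functional ::
  "'a::{real_inner, polish_space} measure \<Rightarrow> nat \<Rightarrow> real \<Rightarrow> (nat \<Rightarrow> 'a \<Rightarrow> complex) \<Rightarrow> complex" where
  "det_functional \<mu> k s f = integral\<^sup>L (Pi\<^sub>M {..k} (\<lambda>_. \<mu>)) (det_integrand k s f)"

definition det_functional_nonneg ::
  "'a::{real_inner, polish_space} measure \<Rightarrow> nat \<Rightarrow> real \<Rightarrow> (nat \<Rightarrow> 'a \<Rightarrow> ennreal) \<Rightarrow> ennreal" where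
  "det_functional_nonneg \<mu> k s F =
     (\<integral>\<^sup>+ y. (\<Prod>j\<le>k. F j (y j)) * ennreal (simplex_det k y powr s) \<partial>(Pi\<^sub>M {..k} (\<lambda>_. \<mu>)))"

text \<open>Powers with base in \<open>[0, \<infinity>]\<close> and positive real exponent.\<close>

definition ennreal_powr :: "ennreal \<Rightarrow> real \<Rightarrow> ennreal" where
  "ennreal_powr x a = (if x = \<infinity> then \<infinity> else ennreal (enn2real x powr a))"

definition orthonormal_basis :: "'a::real_inner set \<Rightarrow> bool" where
  "orthonormal_basis W \<longleftrightarrow>
     (\<forall>v\<in>W. \<forall>w\<in>W. inner v w = (if v = w then 1 else 0)) \<and> closure (span W) = UNIV"

text \<open>
  The ellipsoid with centre \<open>x0\<close>, axes \<open>W\<close> and lengths \<open>l\<close>. The arithmetic of type \<open>ennreal\<close>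
  has \<open>t / 0 = \<infinity>\<close> for \<open>t > 0\<close>, \<open>0 / 0 = 0\<close> and \<open>t / \<infinity> = 0\<close> for \<open>t < \<infinity>\<close>, as well as
  \<open>0 * \<infinity> = 0\<close>, which are the conventions for degenerate and infinite lengths. The content takes the data
  \<open>W\<close>, \<open>l\<close> representing the ellipsoid as arguments.
\<close>

definition ellipsoid :: "'a::real_inner \<Rightarrow> 'a set \<Rightarrow> ('a \<Rightarrow> ennreal) \<Rightarrow> 'a set" where
  "ellipsoid x0 W l = {x. (\<Sum>\<^sub>\<infinity>w\<in>W. ennreal (\<bar>inner (x - x0) w\<bar>\<^sup>2) / (l w)\<^sup>2) \<le> 1}"

definition ellipsoid_content :: "nat \<Rightarrow> 'a::real_inner set \<Rightarrow> ('a \<Rightarrow> ennreal) \<Rightarrow> ennreal" where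
  "ellipsoid_content k W l = (SUP I\<in>{I. I \<subseteq> W \<and> finite I \<and> card I = k}. \<Prod>w\<in>I. l w)"

text \<open>The (quasi-)norm for exponents in \<open>(0, \<infinity>]\<close>.\<close>

definition Lp_norm :: "'a measure \<Rightarrow> ereal \<Rightarrow> ('a \<Rightarrow> complex) \<Rightarrow> ennreal" where
  "Lp_norm \<mu> p f =
     (if p = \<infinity> then esssup \<mu> (\<lambda>x. ennreal (norm (f x)))
      else ennreal_powr (\<integral>\<^sup>+ x. ennreal (norm (f x) powr real_of_ereal p) \<partial>\<mu>)
             (1 / real_of_ereal p))"

text \<open>
  The upper bound for the functional includes the absolute convergence of the integral
  whenever the right-hand side is finite: the Bochner integral of a non-integrable function
  is \<open>0\<close> by convention, so that the inequality alone would be vacuous for divergent integrals.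
\<close>

definition upper_ineq ::
  "'a::{real_inner, polish_space} measure \<Rightarrow> nat \<Rightarrow> real \<Rightarrow> (nat \<Rightarrow> ereal) \<Rightarrow> real \<Rightarrow>
     (nat \<Rightarrow> 'a \<Rightarrow> complex) \<Rightarrow> bool" where
  "upper_ineq \<mu> k \<gamma> p C f \<longleftrightarrow>
     ((\<Prod>i\<le>k. Lp_norm \<mu> (p i) (f i)) < \<infinity> \<longrightarrow>
        integrable (Pi\<^sub>M {..k} (\<lambda>_. \<mu>)) (det_integrand k (- \<gamma>) f) \<and>
        ennreal (norm (det_functional \<mu> k (- \<gamma>) f))
          \<le> ennreal C * (\<Prod>i\<le>k. Lp_norm \<mu> (p i) (f i)))"

definition lower_ineq ::
  "'a::{real_inner, polish_space} measure \<Rightarrow> nat \<Rightarrow> real \<Rightarrow> (nat \<Rightarrow> ereal) \<Rightarrow> real \<Rightarrow>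
     (nat \<Rightarrow> 'a \<Rightarrow> complex) \<Rightarrow> bool" where
  "lower_ineq \<mu> k \<gamma> p c f \<longleftrightarrow>
     det_functional_nonneg \<mu> k \<gamma> (\<lambda>i x. ennreal (norm (f i x)))
       \<ge> ennreal c * (\<Prod>i\<le>k. Lp_norm \<mu> (p i) (f i))"

definition ellipsoid_condition ::
  "'a::{real_inner, polish_space} measure \<Rightarrow> nat \<Rightarrow> real \<Rightarrow> bool" where
  "ellipsoid_condition \<mu> k \<alpha> \<longleftrightarrow>
     (\<exists>C\<ge>0. \<forall>x0 W l. orthonormal_basis W \<longrightarrow>
        emeasure \<mu> (ellipsoid x0 W l) \<le> ennreal C * ennreal_powr (ellipsoid_content k W l) \<alpha>)"

definition upper_strong ::
  "'a::{real_inner, polish_space} measure \<Rightarrow> nat \<Rightarrow> real \<Rightarrow> bool" where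
  "upper_strong \<mu> k \<alpha> \<longleftrightarrow>
     (\<forall>\<gamma> p. 0 < \<gamma> \<and> \<gamma> < \<alpha> \<and> (\<forall>i\<le>k. 1 \<le> p i) \<and>
        (\<forall>i\<le>k. 1 - 1 / p i < ereal (\<gamma> / (real k * \<alpha>))) \<and>
        (\<Sum>i\<le>k. 1 - 1 / p i) = ereal (\<gamma> / \<alpha>) \<longrightarrow>
        (\<exists>C\<ge>0. \<forall>f. (\<forall>i\<le>k. f i \<in> borel_measurable \<mu>) \<longrightarrow> upper_ineq \<mu> k \<gamma> p C f))"

definition upper_restricted ::
  "'a::{real_inner, polish_space} measure \<Rightarrow> nat \<Rightarrow> real \<Rightarrow> bool" where
  "upper_restricted \<mu> k \<alpha> \<longleftrightarrow>
     (\<exists>\<gamma> p. 0 < \<gamma> \<and> (\<forall>i\<le>k. 1 \<le> p i) \<and> (\<Sum>i\<le>k. 1 - 1 / p i) = ereal (\<gamma> / \<alpha>) \<and>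
        (\<exists>C\<ge>0. \<forall>A. (\<forall>i\<le>k. A i \<in> sets \<mu>) \<longrightarrow> upper_ineq \<mu> k \<gamma> p C (\<lambda>i. indicator (A i))))"

definition lower_strong ::
  "'a::{real_inner, polish_space} measure \<Rightarrow> nat \<Rightarrow> real \<Rightarrow> bool" where
  "lower_strong \<mu> k \<alpha> \<longleftrightarrow>
     (\<forall>\<gamma> p. 0 < \<gamma> \<and> (\<forall>i\<le>k. 0 \<le> p i \<and> p i \<le> 1) \<and>
        (\<forall>i\<le>k. 1 / p i - 1 < ereal (\<gamma> / (real k * \<alpha>))) \<and>
        (\<Sum>i\<le>k. 1 / p i - 1) = ereal (\<gamma> / \<alpha>) \<longrightarrow>
        (\<exists>c>0. \<forall>f. (\<forall>i\<le>k. f i \<in> borel_measurable \<mu>) \<longrightarrow> lower_ineq \<mu> k \<gamma> p c f))"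

definition lower_restricted ::
  "'a::{real_inner, polish_space} measure \<Rightarrow> nat \<Rightarrow> real \<Rightarrow> bool" where
  "lower_restricted \<mu> k \<alpha> \<longleftrightarrow>
     (\<exists>\<gamma> p. 0 < \<gamma> \<and> (\<forall>i\<le>k. 0 \<le> p i \<and> p i \<le> 1) \<and> (\<Sum>i\<le>k. 1 / p i - 1) = ereal (\<gamma> / \<alpha>) \<and>
        (\<exists>c>0. \<forall>A. (\<forall>i\<le>k. A i \<in> sets \<mu>) \<longrightarrow> lower_ineq \<mu> k \<gamma> p c (\<lambda>i. indicator (A i))))"

end

theory Submission
  imports Defs
begin

text \<open>
  Fix one vertex \<open>y\<^sub>r\<close> and order the remaining vertices greedily: each new vertex maximises its weighted
  distance \<open>a\<^sub>j dist(y\<^sub>j, span)\<close> to the affine hull of the vertices already chosen. If \<open>det \<le> \<delta>\<close>, then the last vertex \<open>y\<^sub>i\<close> lies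
  in an ellipsoid that is determined by the other vertices and has \<open>k\<close>-content \<open>O(\<delta> \<Prod> a\<^sub>j / a\<^sub>i)\<close>. So the ellipsoid condition bounds
  the distribution function of the determinant in one variable, and with the weights \<open>a\<^sub>j = \<mu>(E\<^sub>j)\<close> to the power \<open>-1/(k\<alpha>)\<close>
  it yields the upper inequality for characteristic functions, at every vertex of the polytope of admissible
  exponents. Away from these exponents there is a geometric gain when the sets have different measures, so the dyadic
  decompositions of the functions can be summed. The lower inequality for \<open>\<gamma>\<close> follows from the upper
  one for a small exponent by Hoelder's inequality. Conversely, \<open>det\<close> is at most a constant times the \<open>k\<close>-content on
  an ellipsoid, so testing either restricted inequality on subsets of the ellipsoid returns the ellipsoid condition.
\<close>

section \<open>Gram determinants and pivoting\<close>

text \<open>The Gram determinant is the product of successive heights in any order of the edges, so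
  the order may depend on the configuration; greediness makes every earlier height control the
  position of the last vertex. The weights solve one equation. Slicing in the last vertex
  \<open>y i\<close> interpolates between \<mu>(E i) and the ellipsoid bound and gives \<mu>(E i) to
  the power 1 - \<gamma>/\<alpha>, times the ratios \<open>a j / a i\<close> to the power \<gamma>
  for k - 1 other vertices. With the stated weights the factors from \<open>a i\<close> raise the
  exponent of \<mu>(E i) to 1 - \<gamma>/(k\<alpha>), which is also the exponent of every other
  nonbase vertex; the base vertex keeps exponent 1. Writing 1/p j = 1 - \<theta> j, these are the
  vertices of the simplex \<theta> j \<le> \<gamma>/(k\<alpha>) with the \<theta> j summing to
  \<gamma>/\<alpha>. The strict inequalities keep \<theta> away from the facets \<theta> j =
  \<gamma>/(k\<alpha>), and this distance is the source of the geometric gain. Choosing the base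
  vertex anew for each tuple of dyadic levels takes the place of an interpolation theorem.\<close>

definition proj_perp :: "'a::real_inner \<Rightarrow> 'a \<Rightarrow> 'a" where
  "proj_perp u w = w - (inner w u / inner u u) *\<^sub>R u"

text \<open>Gram-Schmidt heights: every vector is projected off its predecessors, one at a time,
  before its length is taken. Since \<open>proj_perp 0\<close> is the identity, the recursion makes
  sense on dependent families, where the product is 0.\<close>

fun vol :: "('i \<Rightarrow> 'a::real_inner) \<Rightarrow> 'i list \<Rightarrow> real" where
  "vol v [] = 1"
| "vol v (j # js) = norm (v j) * vol (\<lambda>l. proj_perp (v j) (v l)) js"

definition gram :: "('i \<Rightarrow> 'a::real_inner) \<Rightarrow> 'i list \<Rightarrow> real" where
  "gram v js = Determinant.det (Matrix.mat (length js) (length js)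
     (\<lambda>(a, b). inner (v (js ! a)) (v (js ! b))))"

lemma inner_proj_perp [simp]: "inner (proj_perp u w) u = 0"
  by (cases "u = 0") (simp_all add: proj_perp_def inner_diff_left)

lemma inner_proj_perp' [simp]: "inner u (proj_perp u w) = 0"
  by (metis inner_proj_perp inner_commute)

lemma proj_perp_self [simp]: "proj_perp u u = 0"
  by (cases "u = 0") (simp_all add: proj_perp_def)

lemma proj_perp_add: "proj_perp u (w + z) = proj_perp u w + proj_perp u z"
  by (simp add: proj_perp_def inner_add_left add_divide_distrib scaleR_add_left)

lemma proj_perp_scaleR: "proj_perp u (c *\<^sub>R w) = c *\<^sub>R proj_perp u w"
  by (simp add: proj_perp_def scaleR_diff_right)

lemma proj_perp_uminus_left: "proj_perp (- u) w = proj_perp u w"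
  by (simp add: proj_perp_def)

lemma norm_proj_perp_le: "norm (proj_perp u w) \<le> norm w"
proof -
  have "w = proj_perp u w + (inner w u / inner u u) *\<^sub>R u"
    by (simp add: proj_perp_def)
  then have "(norm w)\<^sup>2 = (norm (proj_perp u w + (inner w u / inner u u) *\<^sub>R u))\<^sup>2"
    by simp
  also have "\<dots> = (norm (proj_perp u w))\<^sup>2 + (norm ((inner w u / inner u u) *\<^sub>R u))\<^sup>2"
    by (rule norm_add_Pythagorean) (simp add: real_inner_class.orthogonal_def)
  finally show ?thesis
    by (metis le_add_same_cancel1 norm_ge_zero power2_le_imp_le zero_le_power2)
qed

lemma vol_nonneg [simp]: "0 \<le> vol v js"
  by (induction js arbitrary: v) auto

text \<open>One step of symmetric elimination. Removing from all later vectors their component along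
  \<open>v j\<close> is a congruence of the Gram matrix by a unipotent matrix, and it leaves only
  \<open>(norm (v j))\<^sup>2\<close> in the first row.\<close>

lemma gram_Cons_nz:
  fixes v :: "'i \<Rightarrow> 'a::real_inner"
  assumes "v j \<noteq> 0"
  shows "gram v (j # js) = (norm (v j))\<^sup>2 * gram (\<lambda>l. proj_perp (v j) (v l)) js"
proof -
  let ?n = "Suc (length js)"
  define u where "u a = v ((j # js) ! a)" for a
  have u0 [simp]: "u 0 = v j" and uSuc: "u (Suc a) = v (js ! a)" for a by (simp_all add: u_def)
  define c where "c a = inner (u a) (v j) / inner (v j) (v j)" for a
  define G where "G = Matrix.mat ?n ?n (\<lambda>(a, b). inner (u a) (u b))"
  \<comment> \<open>\<open>A\<close> is lower triangular with ones on the diagonal; its column 0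
    subtracts the multiple \<open>c a\<close> of \<open>v j\<close>.\<close>
  define A where "A = Matrix.mat ?n ?n (\<lambda>(a, b). (if a = b then 1 else 0) -
    (if a \<noteq> 0 \<and> b = 0 then c a else 0))"
  define w where "w a = (if a = 0 then v j else proj_perp (v j) (u a))" for a
  define M where "M = Matrix.mat ?n ?n (\<lambda>(a, b). inner (w a) (w b))"
  have carr: "G \<in> carrier_mat ?n ?n" "A \<in> carrier_mat ?n ?n" "M \<in> carrier_mat ?n ?n"
    "transpose_mat A \<in> carrier_mat ?n ?n"
    unfolding G_def A_def M_def by simp_all
  have w: "w a = (\<Sum>i = 0..<?n. (A $$ (a, i)) *\<^sub>R u i)" if "a < ?n" for a
  proof -
    have "(\<Sum>i = 0..<?n. (A $$ (a, i)) *\<^sub>R u i)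
        = (\<Sum>i = 0..<?n. (if i = a then u i else 0) - (if i = 0 then (if a \<noteq> 0 then c a *\<^sub>R u 0 else 0) else 0))"
      by (rule sum.cong) (use that in \<open>auto simp: A_def\<close>)
    also have "\<dots> = w a"
      using that by (subst sum_subtractf) (auto simp: w_def proj_perp_def c_def)
    finally show ?thesis ..
  qed
  have "M = A * G * transpose_mat A"
  proof (rule eq_matI)
    fix a b assume "a < dim_row (A * G * transpose_mat A)" "b < dim_col (A * G * transpose_mat A)"
    then have ab: "a < ?n" "b < ?n" using carr by auto
    have "(A * G * transpose_mat A) $$ (a, b)
        = (\<Sum>l = 0..<?n. A $$ (a, l) * (\<Sum>i = 0..<?n. G $$ (l, i) * A $$ (b, i)))"
      using ab carr by (simp add: scalar_prod_def del: sum.op_ivl_Suc)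
    also have "\<dots> = (\<Sum>i = 0..<?n. (\<Sum>l = 0..<?n. A $$ (a, l) * G $$ (l, i)) * A $$ (b, i))"
      unfolding sum_distrib_left sum_distrib_right by (subst sum.swap) (simp only: mult.assoc)
    also have "\<dots> = (\<Sum>i = 0..<?n. (\<Sum>l = 0..<?n. A $$ (a, l) * inner (u l) (u i)) * A $$ (b, i))"
      by (intro sum.cong arg_cong2[where f = "(*)"] refl) (auto simp: G_def)
    also have "\<dots> = inner (w a) (\<Sum>i = 0..<?n. (A $$ (b, i)) *\<^sub>R u i)"
      unfolding w[OF ab(1)] inner_sum_right inner_sum_left inner_scaleR_left inner_scaleR_right
      by (simp only: mult.commute)
    also have "\<dots> = inner (w a) (w b)"
      by (simp only: w[OF ab(2)])
    finally show "M $$ (a, b) = (A * G * transpose_mat A) $$ (a, b)"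
      using ab by (simp add: M_def)
  qed (use carr in auto)
  then have "Determinant.det M = Determinant.det A * Determinant.det G * Determinant.det A"
    using carr by (simp add: det_mult[where n = ?n] Determinant.det_transpose[where n = ?n])
  also have "Determinant.det A = prod_list (diag_mat A)"
    by (rule det_lower_triangular[OF _ carr(2)]) (auto simp: A_def)
  also have "\<dots> = 1"
    proof -
    have "prod_list (diag_mat A) = prod_list (map (\<lambda>_. 1) [0..<?n])"
      unfolding diag_mat_def by (rule arg_cong[where f = prod_list], rule map_cong) (auto simp: A_def)
    then show ?thesis by (simp only: map_replicate_const prod_list_replicate power_one)
  qed
  finally have 1: "Determinant.det M = gram v (j # js)"
    by (simp add: G_def gram_def u_def)
  have del: "mat_delete M 0 0 = Matrix.mat (length js) (length js)
     (\<lambda>(a, b). inner (proj_perp (v j) (v (js ! a))) (proj_perp (v j) (v (js ! b))))"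
    by (rule eq_matI) (auto simp: M_def mat_delete_def w_def uSuc)
  have "Determinant.det M = (\<Sum>b<?n. M $$ (0, b) * cofactor M 0 b)"
    by (rule laplace_expansion_row[OF carr(3)]) auto
  \<comment> \<open>\<open>w b\<close> is orthogonal to \<open>v j\<close> for b \<noteq> 0, so the
    expansion along row 0 has one surviving term.\<close>
  also have "\<dots> = (\<Sum>b<?n. if b = 0 then M $$ (0, 0) * cofactor M 0 0 else 0)"
    by (rule sum.cong) (auto simp: M_def w_def)
  also have "\<dots> = M $$ (0, 0) * cofactor M 0 0"
    by simp
  also have "\<dots> = (norm (v j))\<^sup>2 * gram (\<lambda>l. proj_perp (v j) (v l)) js"
    by (simp add: cofactor_def del gram_def) (simp add: M_def w_def power2_norm_eq_inner)
  finally show ?thesis using 1 by simp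
qed

lemma gram_Cons:
  fixes v :: "'i \<Rightarrow> 'a::real_inner"
  shows "gram v (j # js) = (norm (v j))\<^sup>2 * gram (\<lambda>l. proj_perp (v j) (v l)) js"
proof (cases "v j = 0")
  case True
  let ?n = "Suc (length js)"
  let ?G = "Matrix.mat ?n ?n (\<lambda>(a, b). inner (v ((j # js) ! a)) (v ((j # js) ! b)))"
  have "Determinant.det ?G = (\<Sum>b<?n. ?G $$ (0, b) * cofactor ?G 0 b)"
    by (rule laplace_expansion_row) auto
  also have "\<dots> = 0"
    by (rule sum.neutral) (use True in auto)
  finally show ?thesis using True by (simp add: gram_def)
qed (rule gram_Cons_nz)

lemma gram_eq_vol: "gram v js = (vol v js)\<^sup>2"
proof (induction js arbitrary: v)
  case Nil
  show ?case by (simp add: gram_def)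
next
  case (Cons j js)
  then show ?case by (simp add: gram_Cons power_mult_distrib)
qed

text \<open>Permuting the vectors permutes rows and columns simultaneously, so
  \<open>signof p\<close> occurs twice and cancels.\<close>

lemma gram_permute:
  fixes v :: "'i \<Rightarrow> 'a::real_inner"
  assumes "mset js = mset js'"
  shows "gram v js = gram v js'"
proof -
  let ?n = "length js'"
  obtain p where p: "p permutes {..<length js'}" "permute_list p js' = js"
    using mset_eq_permutation[OF assms] by blast
  have len: "length js = ?n" using assms by (rule mset_eq_length)
  have nth: "js ! a = js' ! p a" if "a < ?n" for a
    using p that by (auto simp: permute_list_nth)
  have p': "p permutes {0..<?n}" using p by (simp add: lessThan_atLeast0)
  have pl: "p a < ?n" if "a < ?n" for a
    using permutes_in_image[OF p(1)] that by auto
  let ?G = "Matrix.mat ?n ?n (\<lambda>(a, b). inner (v (js' ! a)) (v (js' ! b)))"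
  let ?H = "Matrix.mat ?n ?n (\<lambda>(a, b). ?G $$ (p a, b))"
  have "gram v js = Determinant.det (Matrix.mat ?n ?n (\<lambda>(a, b). ?H $$ (a, p b)))"
    unfolding gram_def len by (rule arg_cong[where f = Determinant.det], rule eq_matI) (auto simp: nth pl)
  also have "\<dots> = Determinant.det (transpose_mat (Matrix.mat ?n ?n (\<lambda>(a, b). ?H $$ (a, p b))))"
    by (simp add: Determinant.det_transpose[where n = ?n])
  also have "transpose_mat (Matrix.mat ?n ?n (\<lambda>(a, b). ?H $$ (a, p b)))
      = Matrix.mat ?n ?n (\<lambda>(a, b). (transpose_mat ?H) $$ (p a, b))"
    by (rule eq_matI) (auto simp: pl)
  also have "Determinant.det \<dots> = signof p * Determinant.det (transpose_mat ?H)"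
    by (rule det_permute_rows[OF _ p']) auto
  also have "Determinant.det (transpose_mat ?H) = Determinant.det ?H"
    by (rule Determinant.det_transpose[where n = ?n]) auto
  also have "Determinant.det ?H = signof p * Determinant.det ?G"
    by (rule det_permute_rows[OF _ p']) auto
  also have "signof p * (signof p * Determinant.det ?G) = gram v js'"
    by (cases "evenperm p") (auto simp: gram_def sign_def)
  finally show ?thesis .
qed

text \<open>The symmetry of the product of heights is hidden in its recursion but visible in the
  Gram determinant, of which both sides are nonnegative square roots.\<close>

lemma vol_permute:
  fixes v :: "'i \<Rightarrow> 'a::real_inner"
  assumes "mset js = mset js'"
  shows "vol v js = vol v js'"
  using gram_permute[OF assms, of v] by (simp add: gram_eq_vol)

lemma vol_cong: "(\<And>j. j \<in> set js \<Longrightarrow> v j = w j) \<Longrightarrow> vol v js = vol w js"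
proof (induction js arbitrary: v w)
  case (Cons j js)
  have "vol (\<lambda>l. proj_perp (w j) (v l)) js = vol (\<lambda>l. proj_perp (w j) (w l)) js"
    by (rule Cons.IH) (use Cons.prems in auto)
  then show ?case using Cons.prems by simp
qed auto

lemma simplex_det_eq_vol_last:
  "simplex_det k y = vol (\<lambda>i. y i - y k) [0..<k]"
proof -
  have "Matrix.mat k k (\<lambda>(i, j). inner (y i - y k) (y j - y k))
     = Matrix.mat (length [0..<k]) (length [0..<k]) (\<lambda>(a, b). inner (y ([0..<k] ! a) - y k) (y ([0..<k] ! b) - y k))"
    by (rule eq_matI) auto
  then have "simplex_det k y = sqrt (gram (\<lambda>i. y i - y k) [0..<k])"
    by (simp add: simplex_det_def gram_def)
  then show ?thesis by (simp add: gram_eq_vol)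
qed

text \<open>Changing the base vertex: the edge from the old to the new base vertex is projected out
  first, and modulo this edge the two families of edge vectors agree.\<close>

lemma simplex_det_eq_vol:
  assumes "r \<le> k" "distinct js" "set js = {..k} - {r}"
  shows "simplex_det k y = vol (\<lambda>i. y i - y r) js"
proof (cases "r = k")
  case True
  have "set js = set [0..<k]" unfolding assms(3) True by auto
  then have "mset js = mset [0..<k]"
    using assms(2) set_eq_iff_mset_eq_distinct by (metis distinct_upt)
  then show ?thesis unfolding simplex_det_eq_vol_last True by (rule vol_permute[symmetric])
next
  case False
  obtain ls where ls: "distinct ls" "set ls = {..k} - {r, k}"
    using finite_distinct_list[of "{..k} - {r, k}"] by auto
  have "set js = set (k # ls)" "distinct (k # ls)"
    using ls False unfolding assms(3) by auto
  then have m1: "mset js = mset (k # ls)"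
    using assms(2) set_eq_iff_mset_eq_distinct by blast
  have "r < k" using False assms(1) by simp
  then have "insert r ({..k} - {r, k}) = {0..<k}" by (auto simp: set_eq_iff)
  then have "set [0..<k] = set (r # ls)" unfolding set_upt list.set ls(2) by (rule sym)
  moreover have "distinct (r # ls)" using ls by simp
  ultimately have m2: "mset [0..<k] = mset (r # ls)"
    using set_eq_iff_mset_eq_distinct distinct_upt by blast
  have "proj_perp (y r - y k) (y l - y k) = proj_perp (y k - y r) (y l - y r)" for l
  proof -
    have "y l - y k = (y l - y r) + (y r - y k)" by simp
    then have "proj_perp (y r - y k) (y l - y k) = proj_perp (y r - y k) (y l - y r)"
      by (metis add.right_neutral proj_perp_add proj_perp_self)
    then show ?thesis
      by (metis minus_diff_eq proj_perp_uminus_left)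
  qed
  then show ?thesis
    unfolding simplex_det_eq_vol_last vol_permute[OF m1] vol_permute[OF m2]
    by (simp add: norm_minus_commute)
qed

lemma simplex_det_nonneg: "0 \<le> simplex_det k y"
  by (simp add: simplex_det_eq_vol_last)

section \<open>Orthonormal frames and ellipsoids\<close>

definition orthonormal :: "'a::real_inner set \<Rightarrow> bool" where
  "orthonormal E \<longleftrightarrow> (\<forall>v\<in>E. \<forall>w\<in>E. inner v w = (if v = w then 1 else 0))"

text \<open>The component of \<open>x\<close> orthogonal to \<open>span E\<close>, for finite
  orthonormal \<open>E\<close>. In infinite dimension it collects all remaining directions at
  once.\<close>

definition resid :: "'a::real_inner set \<Rightarrow> 'a \<Rightarrow> 'a" where
  "resid E x = x - (\<Sum>e\<in>E. inner x e *\<^sub>R e)"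

lemma orthonormal_inner: "orthonormal E \<Longrightarrow> v \<in> E \<Longrightarrow> w \<in> E \<Longrightarrow> inner v w = (if v = w then 1 else 0)"
  by (auto simp: orthonormal_def)

lemma orthonormal_subset: "orthonormal E \<Longrightarrow> F \<subseteq> E \<Longrightarrow> orthonormal F"
  by (auto simp: orthonormal_def subset_iff)

lemma orthonormal_norm: "orthonormal E \<Longrightarrow> v \<in> E \<Longrightarrow> norm v = 1"
  by (simp add: orthonormal_def norm_eq_sqrt_inner)

lemma inner_sum_orthonormal:
  assumes "orthonormal E" "finite E" "w \<in> E"
  shows "inner (\<Sum>e\<in>E. c e *\<^sub>R e) w = c w"
proof -
  have "inner (\<Sum>e\<in>E. c e *\<^sub>R e) w = (\<Sum>e\<in>E. if e = w then c e else 0)"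
    unfolding inner_sum_left inner_scaleR_left
    by (rule sum.cong) (use assms in \<open>auto simp: orthonormal_inner\<close>)
  then show ?thesis using assms by simp
qed

lemma inner_sum_orthonormal_notin:
  assumes "orthonormal W" "E \<subseteq> W" "w \<in> W - E"
  shows "inner (\<Sum>e\<in>E. c e *\<^sub>R e) w = 0"
  unfolding inner_sum_left inner_scaleR_left
proof (rule sum.neutral, rule ballI)
  fix e assume "e \<in> E"
  then have "inner e w = 0" using orthonormal_inner[OF assms(1), of e w] assms(2,3) by auto
  then show "c e * inner e w = 0" by simp
qed

lemma inner_resid_in [simp]:
  "orthonormal E \<Longrightarrow> finite E \<Longrightarrow> e \<in> E \<Longrightarrow> inner (resid E x) e = 0"
  by (simp add: resid_def inner_diff_left inner_sum_orthonormal)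

lemma inner_resid_notin:
  "orthonormal W \<Longrightarrow> E \<subseteq> W \<Longrightarrow> w \<in> W - E \<Longrightarrow> inner (resid E x) w = inner x w"
  by (simp add: resid_def inner_diff_left inner_sum_orthonormal_notin)

lemma resid_diff: "resid E (x - y) = resid E x - resid E y"
  by (simp add: resid_def inner_diff_left scaleR_diff_left sum_subtractf)

lemma inner_resid_span:
  assumes "orthonormal E" "finite E" "s \<in> span E"
  shows "inner (resid E x) s = 0"
proof -
  have "span E \<subseteq> {s. inner (resid E x) s = 0}"
    by (rule span_minimal) (use assms in \<open>auto simp: subspace_def inner_add_right\<close>)
  then show ?thesis using assms(3) by auto
qed

lemma norm_resid_Pythagoras:
  assumes "orthonormal E" "finite E"
  shows "(norm x)\<^sup>2 = (norm (resid E x))\<^sup>2 + (\<Sum>e\<in>E. (inner x e)\<^sup>2)"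
proof -
  let ?p = "\<Sum>e\<in>E. inner x e *\<^sub>R e"
  have p: "?p \<in> span E" by (intro span_sum span_scale span_base)
  have "(norm ?p)\<^sup>2 = (\<Sum>e\<in>E. (inner x e)\<^sup>2)"
    unfolding power2_norm_eq_inner inner_sum_right inner_scaleR_right
    by (rule sum.cong) (simp_all add: inner_sum_orthonormal[OF assms] power2_eq_square)
  moreover have "x = resid E x + ?p" by (simp add: resid_def)
  then have "(norm x)\<^sup>2 = (norm (resid E x + ?p))\<^sup>2" by simp
  moreover have "(norm (resid E x + ?p))\<^sup>2 = (norm (resid E x))\<^sup>2 + (norm ?p)\<^sup>2"
    by (rule norm_add_Pythagorean) (simp add: real_inner_class.orthogonal_def inner_resid_span[OF assms p])
  ultimately show ?thesis by simp
qed

lemma norm_resid_le: "orthonormal E \<Longrightarrow> finite E \<Longrightarrow> norm (resid E x) \<le> norm x"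
  using norm_resid_Pythagoras[of E x]
  by (metis le_add_same_cancel1 norm_ge_zero power2_le_imp_le sum_nonneg zero_le_power2)

lemma bessel: "orthonormal E \<Longrightarrow> finite E \<Longrightarrow> (\<Sum>e\<in>E. (inner x e)\<^sup>2) \<le> (norm x)\<^sup>2"
  using norm_resid_Pythagoras[of E x] by simp

text \<open>\<open>resid E\<close> kills \<open>s\<close>, so
  \<open>resid E x = resid E (x - s)\<close>. This best approximation property is how density of a
  span is exploited.\<close>

lemma norm_resid_le_dist:
  assumes "orthonormal E" "finite E" "s \<in> span E"
  shows "norm (resid E x) \<le> norm (x - s)"
proof -
  have "resid E s = 0"
  proof -
    have "resid E s \<in> span E"
      unfolding resid_def by (intro span_diff assms span_sum span_scale span_base)
    then have "inner (resid E s) (resid E s) = 0" by (rule inner_resid_span[OF assms(1,2)])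
    then show ?thesis by simp
  qed
  then have "resid E x = resid E (x - s)" by (simp add: resid_diff)
  then show ?thesis using norm_resid_le[OF assms(1,2)] by metis
qed

lemma resid_insert:
  assumes "finite E" "e \<notin> E"
  shows "resid (insert e E) x = resid E x - inner x e *\<^sub>R e"
  using assms by (simp add: resid_def)

section \<open>Gram-Schmidt completion of a finite frame\<close>

definition gs_step :: "'a::real_inner set \<Rightarrow> 'a \<Rightarrow> 'a set" where
  "gs_step F x = (if resid F x = 0 then F else insert (resid F x /\<^sub>R norm (resid F x)) F)"

lemma gs_step:
  assumes "orthonormal F" "finite F"
  shows "orthonormal (gs_step F x)" "finite (gs_step F x)" "F \<subseteq> gs_step F x" "x \<in> span (gs_step F x)"
proof -
  let ?r = "resid F x"
  show "finite (gs_step F x)" "F \<subseteq> gs_step F x" using assms by (auto simp: gs_step_def)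
  show "orthonormal (gs_step F x)"
  proof (cases "?r = 0")
    case False
    define e where "e = ?r /\<^sub>R norm ?r"
    have ee: "inner e e = 1" using False by (simp add: e_def dot_square_norm power2_eq_square)
    have "inner e w = 0" "inner w e = 0" if "w \<in> F" for w
      using inner_resid_in[OF assms that] by (auto simp: e_def inner_commute)
    moreover have "gs_step F x = insert e F" using False by (simp add: gs_step_def e_def)
    ultimately show ?thesis using assms ee by (auto simp: orthonormal_def)
  qed (use assms in \<open>simp add: gs_step_def\<close>)
  have "?r \<in> span (gs_step F x)"
  proof (cases "?r = 0")
    case False
    then have "?r = norm ?r *\<^sub>R (?r /\<^sub>R norm ?r)" by simp
    moreover have "?r /\<^sub>R norm ?r \<in> span (gs_step F x)"
      by (rule span_base) (use False in \<open>simp add: gs_step_def\<close>)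
    ultimately show ?thesis by (metis span_scale)
  qed (simp add: span_zero)
  moreover have "(\<Sum>e\<in>F. inner x e *\<^sub>R e) \<in> span (gs_step F x)"
    using \<open>F \<subseteq> gs_step F x\<close> by (intro span_sum span_scale span_base) auto
  moreover have "x = ?r + (\<Sum>e\<in>F. inner x e *\<^sub>R e)" by (simp add: resid_def)
  ultimately show "x \<in> span (gs_step F x)" by (metis span_add)
qed

text \<open>Gram-Schmidt along a dense sequence, started at \<open>E\<close>. All stages are finite,
  and the span of their union contains the dense sequence. This turns a finite frame into axes of an
  ellipsoid.\<close>

lemma ex_orthonormal_basis_extension:
  fixes E :: "'a::{real_inner, second_countable_topology} set"
  assumes "orthonormal E" "finite E"
  obtains W where "E \<subseteq> W" "orthonormal_basis W"
proof -
  obtain D :: "'a set" where D: "countable D" "\<And>X. open X \<Longrightarrow> X \<noteq> {} \<Longrightarrow> \<exists>d\<in>D. d \<in> X"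
    using countable_dense_setE by blast
  have Dne: "D \<noteq> {}" using D(2)[of UNIV] by auto
  define G where "G = rec_nat E (\<lambda>n F. gs_step F (from_nat_into D n))"
  have G0: "G 0 = E" and GS: "G (Suc n) = gs_step (G n) (from_nat_into D n)" for n
    by (simp_all add: G_def)
  have G: "orthonormal (G n) \<and> finite (G n)" for n
    by (induction n) (use assms gs_step in \<open>auto simp: G0 GS\<close>)
  have mono: "incseq G"
    by (rule incseq_SucI) (use G gs_step(3) in \<open>auto simp: GS\<close>)
  have on: "orthonormal (\<Union>n. G n)"
    unfolding orthonormal_def
  proof (intro ballI)
    fix v w assume "v \<in> (\<Union>n. G n)" "w \<in> (\<Union>n. G n)"
    then obtain a b where "v \<in> G a" "w \<in> G b" by auto
    moreover have "G a \<subseteq> G (max a b)" "G b \<subseteq> G (max a b)" using mono by (auto simp: incseq_def)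
    ultimately show "inner v w = (if v = w then 1 else 0)" using G orthonormal_inner by blast
  qed
  have D_sub: "D \<subseteq> span (\<Union>n. G n)"
  proof
    fix d assume "d \<in> D"
    then obtain n where "d = from_nat_into D n" using D(1) by (metis from_nat_into_to_nat_on)
    then have "d \<in> span (G (Suc n))" using gs_step(4) G GS by metis
    then show "d \<in> span (\<Union>n. G n)" using span_mono[of "G (Suc n)" "\<Union>n. G n"] by auto
  qed
  have "closure (span (\<Union>n. G n)) = UNIV"
  proof (rule ccontr)
    assume "closure (span (\<Union>n. G n)) \<noteq> UNIV"
    then obtain d where "d \<in> D" "d \<in> - closure (span (\<Union>n. G n))"
      using D(2)[of "- closure (span (\<Union>n. G n))"] by auto
    then show False using D_sub closure_subset by fastforce
  qed
  then have "orthonormal_basis (\<Union>n. G n)" using on by (simp add: orthonormal_basis_def orthonormal_def)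
  moreover have "E \<subseteq> (\<Union>n. G n)" using G0 by auto
  ultimately show ?thesis using that by blast
qed

lemma orthonormal_basis_imp: "orthonormal_basis W \<Longrightarrow> orthonormal W"
  by (simp add: orthonormal_basis_def orthonormal_def)

text \<open>The defining sum splits into \<open>n = card E + 1\<close> parts of size at most
  \<open>1 / n\<close>: one for each axis in \<open>E\<close>, and one for all other axes together,
  bounded by Bessel's inequality for the residual. The factor \<open>sqrt n\<close> in the lengths
  pays for this.\<close>

lemma mem_ellipsoidI:
  assumes W: "orthonormal_basis W" "E \<subseteq> W" "finite E"
    and L: "\<And>e. e \<in> E \<Longrightarrow> 0 < L e" and "0 < \<rho>"
    and bd: "\<And>e. e \<in> E \<Longrightarrow> \<bar>inner (y - x) e\<bar> \<le> L e" and res: "norm (resid E (y - x)) \<le> \<rho>"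
    and n: "n = real (card E + 1)"
  shows "y \<in> ellipsoid x W (\<lambda>w. ennreal (sqrt n * (if w \<in> E then L w else \<rho>)))"
proof -
  define c where "c w = sqrt n * (if w \<in> E then L w else \<rho>)" for w
  define z where "z = y - x"
  have on: "orthonormal W" by (rule orthonormal_basis_imp[OF W(1)])
  have npos: "n > 0" using n by simp
  have cpos: "c w > 0" for w using L \<open>0 < \<rho>\<close> npos by (auto simp: c_def)
  have "(\<Sum>\<^sub>\<infinity>w\<in>W. ennreal (\<bar>inner z w\<bar>\<^sup>2) / (ennreal (c w))\<^sup>2) \<le> 1"
  proof (rule infsum_le_finite_sums)
    show "(\<lambda>w. ennreal (\<bar>inner z w\<bar>\<^sup>2) / (ennreal (c w))\<^sup>2) summable_on W"
      by (rule nonneg_summable_on_complete) simp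
    fix G assume G: "finite G" "G \<subseteq> W"
    have "(\<Sum>w\<in>G. ennreal (\<bar>inner z w\<bar>\<^sup>2) / (ennreal (c w))\<^sup>2) = (\<Sum>w\<in>G. ennreal ((inner z w)\<^sup>2 / (c w)\<^sup>2))"
    proof (rule sum.cong)
      fix w assume "w \<in> G"
      show "ennreal (\<bar>inner z w\<bar>\<^sup>2) / (ennreal (c w))\<^sup>2 = ennreal ((inner z w)\<^sup>2 / (c w)\<^sup>2)"
        using cpos[of w] by (simp add: ennreal_power divide_ennreal less_imp_le)
    qed simp
    also have "\<dots> = ennreal (\<Sum>w\<in>G. (inner z w)\<^sup>2 / (c w)\<^sup>2)"
      by (rule sum_ennreal) simp
    also have "(\<Sum>w\<in>G. (inner z w)\<^sup>2 / (c w)\<^sup>2) \<le> 1"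
    proof -
      have "(\<Sum>w\<in>G \<inter> E. (inner z w)\<^sup>2 / (c w)\<^sup>2) \<le> (\<Sum>w\<in>G \<inter> E. 1 / n)"
      proof (rule sum_mono)
        fix w assume w: "w \<in> G \<inter> E"
        have "(inner z w)\<^sup>2 \<le> (L w)\<^sup>2"
          using bd[of w] w power_mono[of "\<bar>inner z w\<bar>" "L w" 2] by (simp add: z_def)
        moreover have "(c w)\<^sup>2 = n * (L w)\<^sup>2" using w npos by (simp add: c_def power_mult_distrib)
        ultimately show "(inner z w)\<^sup>2 / (c w)\<^sup>2 \<le> 1 / n"
          using L[of w] w npos by (simp add: field_simps)
      qed
      also have "\<dots> \<le> (\<Sum>w\<in>E. 1 / n)"
        by (rule sum_mono2) (use W(3) npos in auto)
      finally have 1: "(\<Sum>w\<in>G \<inter> E. (inner z w)\<^sup>2 / (c w)\<^sup>2) \<le> card E / n" by simp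
      have "(\<Sum>w\<in>G - E. (inner z w)\<^sup>2 / (c w)\<^sup>2) = (\<Sum>w\<in>G - E. (inner (resid E z) w)\<^sup>2) / (n * \<rho>\<^sup>2)"
        unfolding sum_divide_distrib
      proof (rule sum.cong)
        fix w assume "w \<in> G - E"
        then show "(inner z w)\<^sup>2 / (c w)\<^sup>2 = (inner (resid E z) w)\<^sup>2 / (n * \<rho>\<^sup>2)"
          using inner_resid_notin[OF on W(2), of w z] G npos by (auto simp: c_def power_mult_distrib)
      qed simp
      also have "\<dots> \<le> \<rho>\<^sup>2 / (n * \<rho>\<^sup>2)"
      proof (rule divide_right_mono)
        have "(\<Sum>w\<in>G - E. (inner (resid E z) w)\<^sup>2) \<le> (norm (resid E z))\<^sup>2"
          by (rule bessel) (use on G in \<open>auto intro: orthonormal_subset\<close>)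
        also have "\<dots> \<le> \<rho>\<^sup>2" using res by (simp add: z_def power_mono)
        finally show "(\<Sum>w\<in>G - E. (inner (resid E z) w)\<^sup>2) \<le> \<rho>\<^sup>2" .
      qed (use npos in simp)
      also have "\<dots> = 1 / n" using \<open>0 < \<rho>\<close> by simp
      finally have 2: "(\<Sum>w\<in>G - E. (inner z w)\<^sup>2 / (c w)\<^sup>2) \<le> 1 / n" .
      have "(\<Sum>w\<in>G. (inner z w)\<^sup>2 / (c w)\<^sup>2)
          = (\<Sum>w\<in>G \<inter> E. (inner z w)\<^sup>2 / (c w)\<^sup>2) + (\<Sum>w\<in>G - E. (inner z w)\<^sup>2 / (c w)\<^sup>2)"
        by (rule sum.Int_Diff[OF G(1)])
      also have "\<dots> \<le> card E / n + 1 / n" using 1 2 by simp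
      also have "\<dots> = 1" using n npos by (simp add: field_simps)
      finally show ?thesis .
    qed
    then have "ennreal (\<Sum>w\<in>G. (inner z w)\<^sup>2 / (c w)\<^sup>2) \<le> 1" by (simp add: ennreal_le_1)
    finally show "(\<Sum>w\<in>G. ennreal (\<bar>inner z w\<bar>\<^sup>2) / (ennreal (c w))\<^sup>2) \<le> 1" .
  qed
  then show ?thesis by (simp add: ellipsoid_def c_def z_def)
qed

text \<open>Since \<open>card I = card E + 1\<close>, the set \<open>I - E\<close> has one element
  more than \<open>E - I\<close>. Trading the short axes of \<open>I - E\<close> for the longer ones
  of \<open>E - I\<close> leaves exactly one factor \<open>\<rho>\<close>.\<close>

lemma ellipsoid_content_le:
  assumes "finite E" "card E + 1 = k"
    and L: "\<And>e. e \<in> E \<Longrightarrow> \<rho> \<le> L e" and "0 < \<rho>" and "0 \<le> s"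
  shows "ellipsoid_content k W (\<lambda>w. ennreal (s * (if w \<in> E then L w else \<rho>)))
    \<le> ennreal (s ^ k * ((\<Prod>e\<in>E. L e) * \<rho>))"
  unfolding ellipsoid_content_def
proof (rule SUP_least)
  fix I assume "I \<in> {I. I \<subseteq> W \<and> finite I \<and> card I = k}"
  then have I: "I \<subseteq> W" "finite I" "card I = k" by auto
  define lv where "lv w = (if w \<in> E then L w else \<rho>)" for w
  have lv: "\<rho> \<le> lv w" for w using L by (auto simp: lv_def)
  have lv0: "0 \<le> lv w" for w using lv[of w] \<open>0 < \<rho>\<close> by simp
  have "(\<Prod>w\<in>I. ennreal (s * lv w)) = ennreal (\<Prod>w\<in>I. s * lv w)"
    by (rule prod_ennreal) (use lv0 assms in auto)
  also have "(\<Prod>w\<in>I. s * lv w) = s ^ k * (\<Prod>w\<in>I. lv w)"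
    using I by (simp add: prod.distrib)
  finally have eq: "(\<Prod>w\<in>I. ennreal (s * lv w)) = ennreal (s ^ k * (\<Prod>w\<in>I. lv w))" .
  have card: "card (I - E) = Suc (card (E - I))"
  proof -
    have "card (I \<inter> E) + card (I - E) = card I" "card (I \<inter> E) + card (E - I) = card E"
      using card_Int_Diff[OF I(2), of E] card_Int_Diff[OF assms(1), of I] by (simp_all add: Int_commute)
    then show ?thesis using I assms(2) by simp
  qed
  have "\<rho> ^ card (E - I) = (\<Prod>w\<in>E - I. \<rho>)" by simp
  also have "\<dots> \<le> (\<Prod>w\<in>E - I. lv w)" by (rule prod_mono) (use lv \<open>0 < \<rho>\<close> in auto)
  finally have le: "\<rho> ^ card (E - I) * \<rho> \<le> (\<Prod>w\<in>E - I. lv w) * \<rho>" using \<open>0 < \<rho>\<close> by simp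
  have "(\<Prod>w\<in>I. lv w) = (\<Prod>w\<in>I \<inter> E. lv w) * (\<Prod>w\<in>I - E. lv w)"
    by (rule prod.Int_Diff[OF I(2)])
  also have "(\<Prod>w\<in>I - E. lv w) = \<rho> ^ card (E - I) * \<rho>"
    by (simp add: lv_def card)
  also have "(\<Prod>w\<in>I \<inter> E. lv w) * \<dots> \<le> (\<Prod>w\<in>I \<inter> E. lv w) * ((\<Prod>w\<in>E - I. lv w) * \<rho>)"
    by (intro mult_left_mono le prod_nonneg ballI lv0)
  also have "\<dots> = (\<Prod>e\<in>E. L e) * \<rho>"
    using prod.Int_Diff[OF assms(1), of lv I] by (simp add: lv_def Int_commute mult.assoc)
  finally have "ennreal (s ^ k * (\<Prod>w\<in>I. lv w)) \<le> ennreal (s ^ k * ((\<Prod>e\<in>E. L e) * \<rho>))"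
    using assms(5) by (intro ennreal_leI mult_left_mono) auto
  then show "(\<Prod>w\<in>I. ennreal (s * (if w \<in> E then L w else \<rho>))) \<le> ennreal (s ^ k * ((\<Prod>e\<in>E. L e) * \<rho>))"
    unfolding eq[symmetric] by (simp only: lv_def)
qed

section \<open>Greedy orderings and the slices they determine\<close>

fun greedy :: "('i \<Rightarrow> real) \<Rightarrow> ('i \<Rightarrow> 'a::real_inner) \<Rightarrow> 'i list \<Rightarrow> bool" where
  "greedy a v [] = True"
| "greedy a v (j # js) = ((\<forall>l\<in>set js. a l * norm (v l) \<le> a j * norm (v j)) \<and>
     greedy a (\<lambda>l. proj_perp (v j) (v l)) js)"

lemma ex_greedy: "finite J \<Longrightarrow> \<exists>js. distinct js \<and> set js = J \<and> greedy a v js"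
proof (induction "card J" arbitrary: J v)
  case (Suc n)
  then have "J \<noteq> {}" by auto
  then obtain j where j: "j \<in> J" "\<And>l. l \<in> J \<Longrightarrow> a l * norm (v l) \<le> a j * norm (v j)"
    using Max_in[of "(\<lambda>l. a l * norm (v l)) ` J"] Max_ge[of "(\<lambda>l. a l * norm (v l)) ` J"] Suc.prems
    by fastforce
  obtain js where "distinct js" "set js = J - {j}" "greedy a (\<lambda>l. proj_perp (v j) (v l)) js"
    using Suc.hyps(1)[of "J - {j}"] Suc.hyps(2) Suc.prems j(1) by (metis card_Diff_singleton diff_Suc_1 finite_Diff)
  then have "distinct (j # js) \<and> set (j # js) = J \<and> greedy a v (j # js)"
    using j by auto
  then show ?case by blast
qed auto

lemma fun_upd_proj:
  "i \<noteq> j \<Longrightarrow> (\<lambda>l. proj_perp ((v(i := u)) j) ((v(i := u)) l)) = (\<lambda>l. proj_perp (v j) (v l))(i := proj_perp (v j) u)"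
  by (auto simp: fun_eq_iff)

text \<open>\<open>E\<close> is the Gram-Schmidt frame of the vectors in \<open>js\<close>, and the
  axis created by \<open>v j\<close> gets \<open>a j / a i\<close> times the height of
  \<open>v j\<close> as its length. That \<open>i\<close> was passed over when \<open>j\<close> was
  chosen says precisely that the projection of \<open>u\<close> at this stage has at most this norm,
  which bounds the component along the axis and the whole later residual. \<open>E\<close> and
  \<open>L\<close> are fixed before \<open>u\<close>, so one frame serves the entire slice.\<close>

lemma greedy_frame:
  fixes v :: "'i \<Rightarrow> 'a::real_inner"
  assumes "i \<notin> set js" "distinct js" "vol v js \<noteq> 0" "0 < a i" "\<And>j. j \<in> set js \<Longrightarrow> 0 < a j"
  shows "\<exists>E L. finite E \<and> card E = length js \<and> orthonormal E \<and> E \<subseteq> span (v ` set js) \<and>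
    (\<forall>e\<in>E. 0 < L e) \<and> (\<Prod>e\<in>E. L e) = vol v js * (\<Prod>j\<in>set js. a j / a i) \<and>
    (\<forall>u. greedy a (v(i := u)) (js @ [i]) \<longrightarrow>
       (\<forall>e\<in>E. \<bar>inner u e\<bar> \<le> L e \<and> norm (resid E u) \<le> L e) \<and>
       norm (resid E u) * vol v js = vol (v(i := u)) (js @ [i]))"
  using assms
proof (induction js arbitrary: v)
  case Nil
  show ?case by (rule exI[of _ "{}"]) (auto simp: orthonormal_def resid_def)
next
  case (Cons j js)
  define v' where "v' l = proj_perp (v j) (v l)" for l
  have vj: "v j \<noteq> 0" and vol': "vol v' js \<noteq> 0" and ij: "i \<noteq> j"
    using Cons.prems by (auto simp: v'_def[abs_def])
  have "i \<notin> set js" "distinct js" "\<And>j. j \<in> set js \<Longrightarrow> 0 < a j" using Cons.prems by auto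
  note IH = Cons.IH[OF this(1,2) vol' Cons.prems(4) this(3)]
  obtain E L where E: "finite E" "card E = length js" "orthonormal E" "E \<subseteq> span (v' ` set js)"
    "\<And>e. e \<in> E \<Longrightarrow> 0 < L e" "(\<Prod>e\<in>E. L e) = vol v' js * (\<Prod>j\<in>set js. a j / a i)"
    and EE: "\<forall>u. greedy a (v'(i := u)) (js @ [i]) \<longrightarrow>
       (\<forall>e\<in>E. \<bar>inner u e\<bar> \<le> L e \<and> norm (resid E u) \<le> L e) \<and>
       norm (resid E u) * vol v' js = vol (v'(i := u)) (js @ [i])"
    using IH by blast
  have EL: "\<And>u e. greedy a (v'(i := u)) (js @ [i]) \<Longrightarrow> e \<in> E \<Longrightarrow> \<bar>inner u e\<bar> \<le> L e \<and> norm (resid E u) \<le> L e"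
    and Evol: "\<And>u. greedy a (v'(i := u)) (js @ [i]) \<Longrightarrow> norm (resid E u) * vol v' js = vol (v'(i := u)) (js @ [i])"
    using EE by blast+
  define e where "e = v j /\<^sub>R norm (v j)"
  have ne: "norm e = 1" and ee: "inner e e = 1" using vj by (simp_all add: e_def dot_square_norm power2_eq_square)
  have "span (v' ` set js) \<subseteq> {w. inner w e = 0}"
    by (rule span_minimal) (auto simp: subspace_def inner_add_left v'_def e_def)
  then have orth: "inner w e = 0" "inner e w = 0" if "w \<in> E" for w
    using E(4) that by (auto simp: inner_commute)
  have eE: "e \<notin> E" using orth ee by force
  define E' where "E' = insert e E"
  \<comment> \<open>The greedy inequality \<open>a i * norm u \<le> a j * norm (v j)\<close>, solved
    for \<open>norm u\<close>.\<close>
  define L' where "L' = L(e := a j / a i * norm (v j))"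
  have e_span: "e \<in> span (v ` set (j # js))"
    unfolding e_def by (intro span_scale span_base) simp
  have v'_span: "v' ` set js \<subseteq> span (v ` set (j # js))"
    unfolding v'_def proj_perp_def by (auto intro!: span_diff span_scale intro: span_base)
  have "E \<subseteq> span (v ` set (j # js))"
    using E(4) span_mono[OF v'_span] span_span by blast
  then have 1: "E' \<subseteq> span (v ` set (j # js))" using e_span by (simp add: E'_def)
  have 2: "orthonormal E'"
    using E(3) orth ee by (auto simp: E'_def orthonormal_def)
  have 3: "\<forall>e\<in>E'. 0 < L' e" using E(5) vj Cons.prems(4) Cons.prems(5)[of j] by (auto simp: E'_def L'_def)
  have 4: "(\<Prod>e\<in>E'. L' e) = vol v (j # js) * (\<Prod>j\<in>set (j # js). a j / a i)"
  proof -
    have "(\<Prod>w\<in>E. L' w) = (\<Prod>w\<in>E. L w)" by (rule prod.cong) (use eE in \<open>auto simp: L'_def\<close>)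
    then have "(\<Prod>e\<in>E'. L' e) = (a j / a i * norm (v j)) * (vol v' js * (\<Prod>j\<in>set js. a j / a i))"
      using E(1,6) eE by (simp add: E'_def) (simp add: L'_def)
    then show ?thesis using Cons.prems(2) by (simp add: v'_def[abs_def] mult_ac)
  qed
  have 5: "(\<forall>w\<in>E'. \<bar>inner u w\<bar> \<le> L' w \<and> norm (resid E' u) \<le> L' w) \<and>
       norm (resid E' u) * vol v (j # js) = vol (v(i := u)) ((j # js) @ [i])"
    if g: "greedy a (v(i := u)) ((j # js) @ [i])" for u
  proof -
    define u' where "u' = proj_perp (v j) u"
    have u': "u' = u - inner u e *\<^sub>R e"
      unfolding u'_def proj_perp_def e_def using vj by (simp add: dot_square_norm power2_eq_square divide_simps)
    have upd: "(\<lambda>l. proj_perp ((v(i := u)) j) ((v(i := u)) l)) = v'(i := u')"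
      using fun_upd_proj[OF ij, of v u] by (simp add: v'_def[abs_def] u'_def)
    have g': "greedy a (v'(i := u')) (js @ [i])" and le: "a i * norm u \<le> a j * norm (v j)"
      using g ij upd by auto
    have nu: "norm u \<le> L' e"
      using le Cons.prems(4) by (simp add: L'_def field_simps)
    have in_eq: "inner u' w = inner u w" if "w \<in> E" for w
      using orth[OF that] by (simp add: u' inner_diff_left)
    \<comment> \<open>\<open>u - u'\<close> is a multiple of \<open>e\<close>, hence orthogonal to
      \<open>E\<close>: the residual in the larger frame is the one that the induction hypothesis
      controls.\<close>
    have r: "resid E' u = resid E u'"
    proof -
      have "resid E' u = resid E u - inner u e *\<^sub>R e"
        unfolding E'_def using E(1) eE by (rule resid_insert)
      also have "\<dots> = resid E u'"
        unfolding resid_def using in_eq by (simp add: u')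
      finally show ?thesis .
    qed
    have "\<bar>inner u w\<bar> \<le> L' w \<and> norm (resid E' u) \<le> L' w" if "w \<in> E'" for w
    proof (cases "w = e")
      case True
      have "\<bar>inner u e\<bar> \<le> norm u" using Cauchy_Schwarz_ineq2[of u e] ne by simp
      moreover have "norm (resid E' u) \<le> norm u"
        by (rule norm_resid_le[OF 2]) (simp add: E'_def E)
      ultimately show ?thesis using nu True by simp
    next
      case False
      then have "w \<in> E" using that by (simp add: E'_def)
      then show ?thesis using EL[OF g'] in_eq r False by (simp add: L'_def)
    qed
    moreover have "norm (resid E' u) * vol v (j # js) = vol (v(i := u)) ((j # js) @ [i])"
    proof -
      have "vol (v(i := u)) ((j # js) @ [i]) = norm (v j) * vol (v'(i := u')) (js @ [i])"
        using ij upd by simp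
      also have "\<dots> = norm (v j) * (norm (resid E u') * vol v' js)"
        using Evol[OF g'] by simp
      finally show ?thesis using r by (simp add: v'_def[abs_def])
    qed
    ultimately show ?thesis by blast
  qed
  show ?case
    by (rule exI[of _ E'], rule exI[of _ L'])
      (intro conjI allI impI 1 2 3 4 5, use E(1,2) eE in \<open>simp_all add: E'_def\<close>)
qed

text \<open>The last height is the volume divided by \<open>vol v js\<close>, so at most
  \<open>\<delta> / vol v js\<close>. The lengths from \<open>greedy_frame\<close> multiply to
  \<open>vol v js\<close> times the weight ratios, and \<open>vol v js\<close> cancels in the
  content: its bound is uniform in the positions of the other vertices.\<close>

lemma greedy_slice_in_ellipsoid:
  fixes v :: "'i \<Rightarrow> 'a::{real_inner, second_countable_topology}"
  assumes "i \<notin> set js" "distinct js" "vol v js \<noteq> 0" "0 < a i" "\<And>j. j \<in> set js \<Longrightarrow> 0 < a j"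
    and "0 < \<delta>" and k: "k = length js + 1"
  shows "\<exists>W l. orthonormal_basis W \<and>
    ellipsoid_content k W l \<le> ennreal (sqrt k ^ k * (\<delta> * (\<Prod>j\<in>set js. a j / a i))) \<and>
    (\<forall>u. greedy a (v(i := u)) (js @ [i]) \<longrightarrow> vol (v(i := u)) (js @ [i]) \<le> \<delta> \<longrightarrow> x + u \<in> ellipsoid x W l)"
proof -
  obtain E L where E: "finite E" "card E = length js" "orthonormal E" "E \<subseteq> span (v ` set js)"
    "\<And>e. e \<in> E \<Longrightarrow> 0 < L e" "(\<Prod>e\<in>E. L e) = vol v js * (\<Prod>j\<in>set js. a j / a i)"
    and EE: "\<forall>u. greedy a (v(i := u)) (js @ [i]) \<longrightarrow>
       (\<forall>e\<in>E. \<bar>inner u e\<bar> \<le> L e \<and> norm (resid E u) \<le> L e) \<and>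
       norm (resid E u) * vol v js = vol (v(i := u)) (js @ [i])"
    using greedy_frame[where a = a, OF assms(1-3) assms(4) assms(5)] by blast
  have EL: "\<And>u e. greedy a (v(i := u)) (js @ [i]) \<Longrightarrow> e \<in> E \<Longrightarrow> \<bar>inner u e\<bar> \<le> L e \<and> norm (resid E u) \<le> L e"
    and Evol: "\<And>u. greedy a (v(i := u)) (js @ [i]) \<Longrightarrow> norm (resid E u) * vol v js = vol (v(i := u)) (js @ [i])"
    using EE by blast+
  obtain W where W: "E \<subseteq> W" "orthonormal_basis W"
    using ex_orthonormal_basis_extension[OF E(3,1)] .
  have vpos: "vol v js > 0" using assms(3) vol_nonneg[of v js] by (metis less_eq_real_def)
  \<comment> \<open>The cap by \<open>L\<close> is harmless by greediness. Without it a product with two factors \<open>\<rho>\<close> could exceed \<open>\<delta>\<close>.\<close>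
  define \<rho> where "\<rho> = Min (insert (\<delta> / vol v js) (L ` E))"
  have \<rho>pos: "0 < \<rho>" unfolding \<rho>_def using E(1,5) vpos assms(6) by (subst Min_gr_iff) auto
  have \<rho>le: "\<rho> \<le> L e" if "e \<in> E" for e unfolding \<rho>_def using E(1) that by (intro Min_le) auto
  have \<rho>\<delta>: "\<rho> \<le> \<delta> / vol v js" unfolding \<rho>_def using E(1) by (intro Min_le) auto
  define l where "l w = ennreal (sqrt k * (if w \<in> E then L w else \<rho>))" for w
  have "ellipsoid_content k W l \<le> ennreal (sqrt k ^ k * ((\<Prod>e\<in>E. L e) * \<rho>))"
    unfolding l_def by (rule ellipsoid_content_le) (use E k \<rho>le \<rho>pos in auto)
  also have "\<dots> \<le> ennreal (sqrt k ^ k * (\<delta> * (\<Prod>j\<in>set js. a j / a i)))"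
  proof (intro ennreal_leI mult_left_mono)
    have "(\<Prod>e\<in>E. L e) * \<rho> \<le> (\<Prod>e\<in>E. L e) * (\<delta> / vol v js)"
      by (intro mult_left_mono \<rho>\<delta> prod_nonneg) (use E(5) less_imp_le in auto)
    also have "\<dots> = \<delta> * (\<Prod>j\<in>set js. a j / a i)" using vpos E(6) by simp
    finally show "(\<Prod>e\<in>E. L e) * \<rho> \<le> \<delta> * (\<Prod>j\<in>set js. a j / a i)" .
  qed simp
  finally have content: "ellipsoid_content k W l \<le> ennreal (sqrt k ^ k * (\<delta> * (\<Prod>j\<in>set js. a j / a i)))" .
  have mem: "x + u \<in> ellipsoid x W l"
    if g: "greedy a (v(i := u)) (js @ [i])" "vol (v(i := u)) (js @ [i]) \<le> \<delta>" for u
    unfolding l_def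
  proof (rule mem_ellipsoidI[OF W(2,1) E(1,5) \<rho>pos])
    have "norm (resid E u) \<le> \<delta> / vol v js"
      using Evol[OF g(1)] g(2) vpos by (simp add: field_simps)
    then show "norm (resid E (x + u - x)) \<le> \<rho>"
      unfolding \<rho>_def using E(1) EL[OF g(1)] by (auto intro!: Min.boundedI)
  qed (use EL[OF g(1)] E k in auto)
  show ?thesis using W(2) content mem by blast
qed

text \<open>If some height vanishes, the greedy choice forces all later vectors to vanish at that
  stage, so the last vector is among the dependent ones. In an arbitrary order only some vector
  would depend on its predecessors.\<close>

lemma greedy_degenerate:
  fixes v :: "'i \<Rightarrow> 'a::real_inner"
  assumes "greedy a v (js @ [i])" "vol v (js @ [i]) = 0" "\<And>j. 0 < a j"
  shows "v i \<in> span (v ` set js)"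
  using assms(1,2)
proof (induction js arbitrary: v)
  case (Cons j js)
  show ?case
  proof (cases "v j = 0")
    case True
    then have "a i * norm (v i) \<le> 0" using Cons.prems(1) by auto
    then have "norm (v i) \<le> 0" using assms(3)[of i] by (simp add: mult_le_0_iff)
    then have "v i = 0" by simp
    then show ?thesis by (simp add: span_zero)
  next
    case False
    let ?v = "\<lambda>l. proj_perp (v j) (v l)"
    have "?v i \<in> span (?v ` set js)"
      using Cons.IH[of ?v] Cons.prems False by auto
    moreover have "?v ` set js \<subseteq> span (v ` set (j # js))"
      unfolding proj_perp_def by (auto intro!: span_diff span_scale intro: span_base)
    ultimately have "?v i \<in> span (v ` set (j # js))"
      using span_mono span_span by blast
    moreover have "v i = ?v i + (inner (v i) (v j) / inner (v j) (v j)) *\<^sub>R v j"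
      by (simp add: proj_perp_def)
    moreover have "v j \<in> span (v ` set (j # js))" by (intro span_base) simp
    ultimately show ?thesis by (metis span_add span_scale)
  qed
qed auto

section \<open>The determinant on an ellipsoid\<close>

text \<open>Image of \<open>w\<close> after the vectors of \<open>js\<close> have been projected out
  in turn. In contrast to \<open>vol\<close> it is linear in \<open>w\<close>, which allows one edge
  to be expanded in a frame.\<close>

fun presid :: "('i \<Rightarrow> 'a::real_inner) \<Rightarrow> 'i list \<Rightarrow> 'a \<Rightarrow> 'a" where
  "presid v [] w = w"
| "presid v (j # js) w = presid (\<lambda>l. proj_perp (v j) (v l)) js (proj_perp (v j) w)"

lemma vol_snoc: "vol v (js @ [i]) = vol v js * norm (presid v js (v i))"
  by (induction js arbitrary: v) auto

lemma presid_add: "presid v js (w + z) = presid v js w + presid v js z"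
  by (induction js arbitrary: v w z) (auto simp: proj_perp_add)

lemma presid_scaleR: "presid v js (c *\<^sub>R w) = c *\<^sub>R presid v js w"
  by (induction js arbitrary: v w) (auto simp: proj_perp_scaleR)

lemma presid_0: "presid v js 0 = 0"
  using presid_scaleR[of v js 0 0] by simp

lemma norm_presid_le: "norm (presid v js w) \<le> norm w"
proof (induction js arbitrary: v w)
  case (Cons j js)
  show ?case using Cons.IH[of "\<lambda>l. proj_perp (v j) (v l)" "proj_perp (v j) w"] norm_proj_perp_le[of "v j" w]
    by simp
qed simp

lemma presid_sum: "finite F \<Longrightarrow> presid v js (\<Sum>w\<in>F. g w) = (\<Sum>w\<in>F. presid v js (g w))"
  by (induction F rule: finite_induct) (auto simp: presid_add presid_0)

lemma presid_cong: "(\<And>j. j \<in> set js \<Longrightarrow> v j = v' j) \<Longrightarrow> presid v js w = presid v' js w"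
proof (induction js arbitrary: v v' w)
  case (Cons j js)
  have "presid (\<lambda>l. proj_perp (v' j) (v l)) js (proj_perp (v' j) w)
      = presid (\<lambda>l. proj_perp (v' j) (v' l)) js (proj_perp (v' j) w)"
    by (rule Cons.IH) (use Cons.prems in auto)
  then show ?case using Cons.prems by simp
qed auto

lemma vol_Cons_update:
  assumes "j \<notin> set js"
  shows "vol (v(j := u)) (j # js) = vol v js * norm (presid v js u)"
proof -
  have "vol (v(j := u)) (j # js) = vol (v(j := u)) (js @ [j])"
    by (rule vol_permute) simp
  also have "\<dots> = vol v js * norm (presid v js u)"
    unfolding vol_snoc
    using vol_cong[of js "v(j := u)" v] presid_cong[of js "v(j := u)" v u] assms by fastforce
  finally show ?thesis .
qed

text \<open>The hypothesis on \<open>K\<close> bounds the monomials in which each frame length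
  occurs at most once, as in the Leibniz formula, and \<open>t\<close> fills up the degree. The
  first vector is expanded into \<open>card F + 1\<close> pieces: a piece along \<open>w\<close>
  leaves the other vectors with the frame \<open>F - {w}\<close> and the budget
  \<open>K / l w\<close>, the residual piece leaves them with \<open>F\<close> and the budget
  \<open>K / t\<close>.\<close>

lemma vol_le_frame:
  fixes v :: "'i \<Rightarrow> 'a::real_inner"
  assumes "distinct js" "finite F" "orthonormal F" "0 < t" "\<And>w. w \<in> F \<Longrightarrow> 0 < l w"
    and "\<And>j w. j \<in> set js \<Longrightarrow> w \<in> F \<Longrightarrow> \<bar>inner (v j) w\<bar> \<le> l w"
    and "\<And>j. j \<in> set js \<Longrightarrow> norm (resid F (v j)) \<le> t"
    and "\<And>I. I \<subseteq> F \<Longrightarrow> card I \<le> length js \<Longrightarrow> (\<Prod>w\<in>I. l w) * t ^ (length js - card I) \<le> K"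
  shows "vol v js \<le> real (card F + 1) ^ length js * K"
  using assms
proof (induction js arbitrary: v F K)
  case Nil
  show ?case using Nil.prems(8)[of "{}"] by simp
next
  case (Cons j js)
  let ?n = "length js" and ?N = "real (card F + 1)"
  note F = \<open>finite F\<close> and on = \<open>orthonormal F\<close>
  have K: "0 \<le> K"
    using Cons.prems(8)[of "{}"] zero_le_power[OF less_imp_le[OF \<open>0 < t\<close>], of "Suc ?n"]
    by (simp del: power_Suc zero_le_power)
  have vj: "v j = (\<Sum>w\<in>F. inner (v j) w *\<^sub>R w) + resid F (v j)" by (simp add: resid_def)
  have j: "j \<notin> set js" using Cons.prems(1) by simp
  have A: "l w * (vol v js * norm (presid v js w)) \<le> ?N ^ ?n * K" if w: "w \<in> F" for w
  proof -
    have nw: "norm w = 1" and ww: "inner w w = 1"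
      using orthonormal_norm[OF on w] orthonormal_inner[OF on w w] by auto
    have lw: "l w > 0" using Cons.prems(5) w by simp
    have "vol (\<lambda>i. proj_perp w (v i)) js \<le> real (card (F - {w}) + 1) ^ ?n * (K / l w)"
    proof (rule Cons.IH)
      show "distinct js" "finite (F - {w})" "0 < t" "\<And>u. u \<in> F - {w} \<Longrightarrow> 0 < l u"
        using Cons.prems by auto
      show "orthonormal (F - {w})" using on by (rule orthonormal_subset) auto
      have p: "proj_perp w x = x - inner x w *\<^sub>R w" for x by (simp add: proj_perp_def ww)
      have pin: "inner (proj_perp w x) u = inner x u" if "u \<in> F - {w}" for x u
        using orthonormal_inner[OF on w, of u] that by (auto simp: p inner_diff_left)
      show "\<bar>inner (proj_perp w (v i)) u\<bar> \<le> l u" if "i \<in> set js" "u \<in> F - {w}" for i u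
        using Cons.prems(6)[of i u] that by (simp add: pin)
      show "norm (resid (F - {w}) (proj_perp w (v i))) \<le> t" if "i \<in> set js" for i
      proof -
        have "resid (F - {w}) (proj_perp w (v i)) = resid F (v i)"
          unfolding resid_def sum.remove[OF F w] using pin by (simp add: p)
        then show ?thesis using Cons.prems(7)[of i] that by simp
      qed
      \<comment> \<open>Only sets avoiding \<open>w\<close> occur here; adding \<open>w\<close>
        returns to a monomial bounded by \<open>K\<close>.\<close>
      show "(\<Prod>u\<in>I. l u) * t ^ (?n - card I) \<le> K / l w" if I: "I \<subseteq> F - {w}" "card I \<le> ?n" for I
      proof -
        have fI: "finite I" "w \<notin> I" using I F finite_subset by auto
        have "(\<Prod>u\<in>insert w I. l u) * t ^ (length (j # js) - card (insert w I)) \<le> K"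
          by (rule Cons.prems(8)) (use I w fI in auto)
        then show ?thesis using fI lw by (simp add: field_simps)
      qed
    qed
    also have "\<dots> \<le> ?N ^ ?n * (K / l w)"
      by (intro mult_right_mono power_mono) (use K lw F in \<open>auto intro: card_mono\<close>)
    finally have "vol (\<lambda>i. proj_perp w (v i)) js \<le> ?N ^ ?n * (K / l w)" .
    moreover have "vol (v(j := w)) (j # js) = vol (\<lambda>i. proj_perp w (v i)) js"
    proof -
      have "vol (\<lambda>i. proj_perp w ((v(j := w)) i)) js = vol (\<lambda>i. proj_perp w (v i)) js"
        by (rule vol_cong) (use j in auto)
      then show ?thesis using nw by simp
    qed
    ultimately show ?thesis using vol_Cons_update[OF j, of v w] lw by (simp add: field_simps)
  qed
  have B: "t * vol v js \<le> ?N ^ ?n * K"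
  proof -
    have "vol v js \<le> ?N ^ ?n * (K / t)"
    proof (rule Cons.IH)
      show "(\<Prod>u\<in>I. l u) * t ^ (?n - card I) \<le> K / t" if I: "I \<subseteq> F" "card I \<le> ?n" for I
      proof -
        have "(\<Prod>u\<in>I. l u) * t ^ (length (j # js) - card I) \<le> K"
          by (rule Cons.prems(8)) (use I in auto)
        then show ?thesis using I \<open>0 < t\<close> by (simp add: Suc_diff_le field_simps)
      qed
    qed (use Cons.prems in auto)
    then show ?thesis using \<open>0 < t\<close> by (simp add: field_simps)
  qed
  have "vol v (j # js) = vol v js * norm (presid v js (v j))"
    using vol_Cons_update[OF j, of v "v j"] by simp
  also have "presid v js (v j) = (\<Sum>w\<in>F. inner (v j) w *\<^sub>R presid v js w) + presid v js (resid F (v j))"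
    by (subst vj) (simp add: presid_add presid_sum[OF F] presid_scaleR)
  also have "norm \<dots> \<le> (\<Sum>w\<in>F. l w * norm (presid v js w)) + t"
  proof (rule order_trans[OF norm_triangle_ineq], rule add_mono)
    show "norm (\<Sum>w\<in>F. inner (v j) w *\<^sub>R presid v js w) \<le> (\<Sum>w\<in>F. l w * norm (presid v js w))"
      by (rule sum_norm_le) (use Cons.prems(6)[of j] in \<open>auto intro: mult_right_mono\<close>)
    show "norm (presid v js (resid F (v j))) \<le> t"
      using norm_presid_le[of v js "resid F (v j)"] Cons.prems(7)[of j] by simp
  qed
  also have "vol v js * ((\<Sum>w\<in>F. l w * norm (presid v js w)) + t)
      = (\<Sum>w\<in>F. l w * (vol v js * norm (presid v js w))) + t * vol v js"
    by (simp add: distrib_left sum_distrib_left mult_ac)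
  also have "\<dots> \<le> (\<Sum>w\<in>F. ?N ^ ?n * K) + ?N ^ ?n * K"
    by (intro add_mono sum_mono A B)
  also have "\<dots> = ?N ^ length (j # js) * K" by (simp add: algebra_simps)
  finally show ?case by (simp add: mult_left_mono)
qed

lemma finite_sum_le_infsum_ennreal:
  fixes f :: "'b \<Rightarrow> ennreal"
  shows "finite G \<Longrightarrow> G \<subseteq> W \<Longrightarrow> sum f G \<le> infsum f W"
  by (subst nonneg_infsum_complete) (auto intro: SUP_upper)

text \<open>By completeness of \<open>W\<close> the residual lies within \<open>sqrt e\<close> of
  the span of a finite \<open>G\<close>. Pythagoras on \<open>G\<close> bounds its squared norm by
  the coordinates outside \<open>F\<close>, which the ellipsoid controls, plus \<open>e\<close>.
  Letting \<open>e\<close> tend to 0 stands in for Parseval's identity.\<close>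

lemma norm_resid_ellipsoid:
  assumes W: "orthonormal_basis W" "F \<subseteq> W" "finite F" and "0 \<le> t"
    and l: "\<And>w. w \<in> W - F \<Longrightarrow> l w \<le> ennreal t"
    and y: "y \<in> ellipsoid x W l"
  shows "norm (resid F (y - x)) \<le> t"
proof -
  define z where "z = y - x"
  define r where "r = resid F z"
  have on: "orthonormal W" by (rule orthonormal_basis_imp[OF W(1)])
  have inf: "(\<Sum>\<^sub>\<infinity>w\<in>W. ennreal (\<bar>inner z w\<bar>\<^sup>2) / (l w)\<^sup>2) \<le> 1"
    using y by (simp add: ellipsoid_def z_def)
  have fin: "(\<Sum>w\<in>G. (inner z w)\<^sup>2) \<le> t\<^sup>2" if G: "finite G" "G \<subseteq> W - F" for G
  proof -
    have "(\<Sum>w\<in>G. ennreal (\<bar>inner z w\<bar>\<^sup>2) / (l w)\<^sup>2) \<le> (\<Sum>\<^sub>\<infinity>w\<in>W. ennreal (\<bar>inner z w\<bar>\<^sup>2) / (l w)\<^sup>2)"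
      by (rule finite_sum_le_infsum_ennreal) (use G in auto)
    then have le1: "(\<Sum>w\<in>G. ennreal (\<bar>inner z w\<bar>\<^sup>2) / (l w)\<^sup>2) \<le> 1" using inf by (rule order_trans)
    have "ennreal (\<Sum>w\<in>G. (inner z w)\<^sup>2) = (\<Sum>w\<in>G. ennreal ((inner z w)\<^sup>2))"
      by (rule sum_ennreal[symmetric]) simp
    also have "\<dots> \<le> (\<Sum>w\<in>G. ennreal (t\<^sup>2) * (ennreal (\<bar>inner z w\<bar>\<^sup>2) / (l w)\<^sup>2))"
    proof (rule sum_mono)
      fix w assume "w \<in> G"
      then have lw: "l w \<le> ennreal t" using l G by auto
      show "ennreal ((inner z w)\<^sup>2) \<le> ennreal (t\<^sup>2) * (ennreal (\<bar>inner z w\<bar>\<^sup>2) / (l w)\<^sup>2)"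
      proof (cases "inner z w = 0")
        case nz: False
        obtain b where b: "l w = ennreal b" "0 \<le> b" "b \<le> t"
          using lw \<open>0 \<le> t\<close> by (cases "l w") (auto simp: ennreal_le_iff top_unique)
        show ?thesis
        proof (cases "b = 0")
          case True
          \<comment> \<open>A nonzero coordinate along an axis of length 0 would make the whole sum
            infinite.\<close>
          have "ennreal ((inner z w)\<^sup>2) / (l w)\<^sup>2 = \<infinity>"
            using nz True b by (simp add: divide_ennreal_def ennreal_mult_top ennreal_mult_eq_top_iff)
          then have "(\<Sum>w\<in>G. ennreal (\<bar>inner z w\<bar>\<^sup>2) / (l w)\<^sup>2) = \<infinity>"
            using member_le_sum[OF \<open>w \<in> G\<close>, of "\<lambda>w. ennreal (\<bar>inner z w\<bar>\<^sup>2) / (l w)\<^sup>2"] G(1)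
            by (simp add: top_unique)
          then show ?thesis using le1 by (simp add: top_unique)
        next
          case False
          have "(inner z w)\<^sup>2 * b\<^sup>2 \<le> (inner z w)\<^sup>2 * t\<^sup>2"
            using b by (intro mult_left_mono power_mono) auto
          then have "(inner z w)\<^sup>2 \<le> t\<^sup>2 * ((inner z w)\<^sup>2 / b\<^sup>2)"
            using False b by (simp add: field_simps)
          then show ?thesis
            using b False by (simp add: ennreal_power divide_ennreal ennreal_mult[symmetric])
        qed
      qed simp
    qed
    also have "\<dots> = ennreal (t\<^sup>2) * (\<Sum>w\<in>G. ennreal (\<bar>inner z w\<bar>\<^sup>2) / (l w)\<^sup>2)"
      by (simp add: sum_distrib_left)
    also have "\<dots> \<le> ennreal (t\<^sup>2) * 1" by (intro mult_left_mono le1) simp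
    finally show ?thesis by simp
  qed
  have "(norm r)\<^sup>2 \<le> t\<^sup>2 + e" if "e > 0" for e
  proof -
    have "r \<in> closure (span W)" using W(1) by (simp add: orthonormal_basis_def)
    then obtain s where s: "s \<in> span W" "dist s r < sqrt e"
      using \<open>e > 0\<close> unfolding closure_approachable by (meson real_sqrt_gt_zero)
    obtain G where G: "finite G" "G \<subseteq> W" "s \<in> span G"
      using s(1) unfolding span_explicit by (auto intro!: span_sum span_scale intro: span_base)
    have onG: "orthonormal G" by (rule orthonormal_subset[OF on G(2)])
    have "norm (resid G r) \<le> norm (r - s)" by (rule norm_resid_le_dist[OF onG G(1,3)])
    also have "\<dots> < sqrt e" using s(2) by (simp add: dist_norm norm_minus_commute)
    finally have "(norm (resid G r))\<^sup>2 \<le> (sqrt e)\<^sup>2" by (intro power_mono) auto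
    then have e: "(norm (resid G r))\<^sup>2 \<le> e" using \<open>e > 0\<close> by simp
    have onF: "orthonormal F" by (rule orthonormal_subset[OF on W(2)])
    have "(\<Sum>w\<in>G. (inner r w)\<^sup>2) = (\<Sum>w\<in>G - F. (inner r w)\<^sup>2)"
      by (rule sum.mono_neutral_right) (use G(1) W(3) onF in \<open>auto simp: r_def\<close>)
    also have "\<dots> = (\<Sum>w\<in>G - F. (inner z w)\<^sup>2)"
      by (rule sum.cong) (use G inner_resid_notin[OF on W(2)] in \<open>auto simp: r_def\<close>)
    also have "\<dots> \<le> t\<^sup>2" by (rule fin) (use G in auto)
    finally show ?thesis using norm_resid_Pythagoras[OF onG G(1), of r] e by simp
  qed
  then have "(norm r)\<^sup>2 \<le> t\<^sup>2" by (rule field_le_epsilon)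
  then show ?thesis using \<open>0 \<le> t\<close> by (metis power2_le_imp_le r_def z_def)
qed

lemma inner_ellipsoid_le:
  assumes W: "orthonormal_basis W" "w \<in> W" and "0 \<le> t" "l w = ennreal t"
    and y: "y \<in> ellipsoid x W l"
  shows "\<bar>inner (y - x) w\<bar> \<le> t"
proof -
  define z where "z = y - x"
  have "(\<Sum>w\<in>{w}. ennreal (\<bar>inner z w\<bar>\<^sup>2) / (l w)\<^sup>2) \<le> (\<Sum>\<^sub>\<infinity>w\<in>W. ennreal (\<bar>inner z w\<bar>\<^sup>2) / (l w)\<^sup>2)"
    by (rule finite_sum_le_infsum_ennreal) (use W in auto)
  also have "\<dots> \<le> 1" using y by (simp add: ellipsoid_def z_def)
  finally have *: "ennreal ((inner z w)\<^sup>2) / (ennreal t)\<^sup>2 \<le> 1" using assms(4) by simp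
  have "\<bar>inner z w\<bar> \<le> t"
  proof (cases "t = 0")
    case True
    then show ?thesis
      using * by (cases "inner z w = 0")
        (auto simp: divide_ennreal_def ennreal_mult_top ennreal_mult_eq_top_iff top_unique)
  next
    case False
    then have "(inner z w)\<^sup>2 / t\<^sup>2 \<le> 1"
      using * \<open>0 \<le> t\<close> by (simp add: ennreal_power divide_ennreal ennreal_le_1)
    then have "(inner z w)\<^sup>2 \<le> t\<^sup>2" using False by (simp add: field_simps)
    then show ?thesis using \<open>0 \<le> t\<close> by (metis abs_le_square_iff abs_of_nonneg)
  qed
  then show ?thesis by (simp add: z_def)
qed

text \<open>A set \<open>F\<close> of axes within a factor 2 of the supremum is used because the
  supremum need not be attained. Edges are differences of two points, so with \<open>m\<close> the
  least length in \<open>F\<close> their components are at most \<open>2 * L w\<close> and their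
  residuals at most \<open>4 * m\<close>; each monomial of \<open>vol_le_frame\<close> is then at
  most \<open>4 ^ k * c\<close>.\<close>

lemma simplex_det_ellipsoid_le:
  fixes W :: "'a::real_inner set"
  assumes W: "orthonormal_basis W" and "1 \<le> k" and c: "ellipsoid_content k W l = ennreal c" "0 < c"
    and y: "\<And>i. i \<le> k \<Longrightarrow> y i \<in> ellipsoid x W l"
  shows "simplex_det k y \<le> real (k + 1) ^ k * (4 ^ k * c)"
proof -
  have on: "orthonormal W" by (rule orthonormal_basis_imp[OF W])
  have "ennreal (c / 2) < ennreal c" using c(2) by (simp add: ennreal_less_iff)
  then have "ennreal (c / 2) < (SUP I\<in>{I. I \<subseteq> W \<and> finite I \<and> card I = k}. \<Prod>w\<in>I. l w)"
    using c(1) unfolding ellipsoid_content_def by simp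
  \<comment> \<open>Exchanging one axis of a nearly optimal \<open>F\<close> shows that all lengths outside \<open>F\<close> are at most twice those in \<open>F\<close>.\<close>
  then obtain F where F: "F \<subseteq> W" "finite F" "card F = k" and Fc: "ennreal (c / 2) < (\<Prod>w\<in>F. l w)"
    unfolding less_SUP_iff by auto
  have upper: "(\<Prod>w\<in>I. l w) \<le> ennreal c" if "I \<subseteq> W" "finite I" "card I = k" for I
    unfolding c(1)[symmetric] ellipsoid_content_def by (rule SUP_upper) (use that in auto)
  have Fnz: "(\<Prod>w\<in>F. l w) \<noteq> 0" using Fc by (metis not_less_zero)
  have lnz: "l w \<noteq> 0" if "w \<in> F" for w using Fnz F(2) that by (auto simp: prod_zero_iff)
  have split: "(\<Prod>w\<in>F. l w) = l w * (\<Prod>w\<in>F - {w}. l w)" if "w \<in> F" for w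
    by (rule prod.remove[OF F(2) that])
  have rest_nz: "(\<Prod>w\<in>F - {w}. l w) \<noteq> 0" for w using lnz F(2) by (auto simp: prod_zero_iff)
  have lfin: "l w \<noteq> \<infinity>" if "w \<in> F" for w
  proof
    assume "l w = \<infinity>"
    then have "(\<Prod>w\<in>F. l w) = \<infinity>"
      using split[OF that] rest_nz[of w] by (simp add: ennreal_top_mult)
    then show False using upper[OF F] by (simp add: top_unique)
  qed
  define L where "L w = enn2real (l w)" for w
  have lL: "l w = ennreal (L w)" if "w \<in> F" for w using lfin[OF that] by (simp add: L_def less_top)
  have Lpos: "0 < L w" if "w \<in> F" for w
    using lL[OF that] lnz[OF that] by (metis L_def enn2real_nonneg ennreal_0 less_eq_real_def)
  have prodL: "(\<Prod>w\<in>I. l w) = ennreal (\<Prod>w\<in>I. L w)" if "I \<subseteq> F" for I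
  proof -
    have "(\<Prod>w\<in>I. l w) = (\<Prod>w\<in>I. ennreal (L w))" by (rule prod.cong) (use that lL in auto)
    also have "\<dots> = ennreal (\<Prod>w\<in>I. L w)" by (rule prod_ennreal) (simp add: L_def)
    finally show ?thesis .
  qed
  have cL: "c / 2 < (\<Prod>w\<in>F. L w)" "(\<Prod>w\<in>F. L w) \<le> c"
    using Fc upper[OF F] c(2) by (simp_all add: prodL ennreal_less_iff ennreal_le_iff)
  have off: "l w \<le> ennreal (2 * L w')" if w: "w \<in> W - F" "w' \<in> F" for w w'
  proof -
    define P where "P = (\<Prod>w\<in>F - {w'}. L w)"
    have P: "P > 0" unfolding P_def by (rule prod_pos) (use Lpos in auto)
    have "l w * ennreal P = (\<Prod>u\<in>insert w (F - {w'}). l u)"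
      using w F(2) prodL[of "F - {w'}"] by (simp add: P_def)
    also have "\<dots> \<le> ennreal c"
    proof (rule upper)
      show "card (insert w (F - {w'})) = k"
        using w F card_Suc_Diff1[OF F(2) w(2)] by simp
    qed (use w F in auto)
    also have "c \<le> 2 * L w' * P"
      using cL(1) prod.remove[OF F(2) w(2), of L] by (simp add: P_def)
    finally have "l w * ennreal P \<le> ennreal (2 * L w') * ennreal P"
      using Lpos[OF w(2)] P by (simp add: ennreal_mult[symmetric] ennreal_leI)
    then show ?thesis
      using P by (metis ennreal_mult_le_mult_iff mult.commute ennreal_neq_top ennreal_eq_0_iff not_le)
  qed
  have Fne: "F \<noteq> {}" using F(3) \<open>1 \<le> k\<close> by auto
  define m where "m = Min (L ` F)"
  have mle: "m \<le> L w" if "w \<in> F" for w unfolding m_def using F(2) that by (intro Min_le) auto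
  have mpos: "0 < m" unfolding m_def using F(2) Fne Lpos by (subst Min_gr_iff) auto
  have off': "l w \<le> ennreal (2 * m)" if "w \<in> W - F" for w
  proof -
    have "m \<in> L ` F" unfolding m_def using F(2) Fne by (intro Min_in) auto
    then show ?thesis using off[OF that] by auto
  qed
  have inn: "\<bar>inner (y i - x) w\<bar> \<le> L w" if "i \<le> k" "w \<in> F" for i w
    by (rule inner_ellipsoid_le[OF W _ _ lL[OF that(2)] y[OF that(1)]])
      (use that F Lpos[OF that(2)] in auto)
  have res: "norm (resid F (y i - x)) \<le> 2 * m" if "i \<le> k" for i
    by (rule norm_resid_ellipsoid[OF W F(1,2) _ off' y[OF that]]) (use mpos in auto)
  have "simplex_det k y = vol (\<lambda>i. y i - y k) [0..<k]" by (rule simplex_det_eq_vol_last)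
  also have "\<dots> \<le> real (card F + 1) ^ length [0..<k] * (4 ^ k * c)"
  proof (rule vol_le_frame[where t = "4 * m" and l = "\<lambda>w. 2 * L w"])
    show "orthonormal F" by (rule orthonormal_subset[OF on F(1)])
    show "\<bar>inner (y i - y k) w\<bar> \<le> 2 * L w" if "i \<in> set [0..<k]" "w \<in> F" for i w
      using inn[of i w] inn[of k w] that by (simp add: inner_diff_left abs_le_iff)
    show "norm (resid F (y i - y k)) \<le> 4 * m" if "i \<in> set [0..<k]" for i
    proof -
      have "resid F (y i - y k) = resid F (y i - x) - resid F (y k - x)"
        by (simp flip: resid_diff)
      then show ?thesis
        using norm_triangle_ineq4[of "resid F (y i - x)" "resid F (y k - x)"] res[of i] res[of k] that by simp
    qed
    fix I assume I: "I \<subseteq> F" "card I \<le> length [0..<k]"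
    have fI: "finite I" using I F finite_subset by auto
    have cI: "card (F - I) = k - card I" using card_Diff_subset[OF fI I(1)] F(3) by simp
    \<comment> \<open>The residual directions fill the \<open>k - card I\<close> free places, and
      \<open>m\<close> is at most each of the lengths of \<open>F - I\<close>.\<close>
    have "(4 * m) ^ (length [0..<k] - card I) = (\<Prod>w\<in>F - I. 4 * m)" using cI by simp
    also have "\<dots> \<le> (\<Prod>w\<in>F - I. 4 * L w)" by (rule prod_mono) (use mle mpos in auto)
    finally have 1: "(4 * m) ^ (length [0..<k] - card I) \<le> (\<Prod>w\<in>F - I. 4 * L w)" .
    have 2: "(\<Prod>w\<in>I. 2 * L w) \<le> (\<Prod>w\<in>I. 4 * L w)" by (rule prod_mono) (use Lpos I in \<open>auto simp: less_imp_le subset_iff\<close>)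
    have "(\<Prod>w\<in>I. 2 * L w) * (4 * m) ^ (length [0..<k] - card I) \<le> (\<Prod>w\<in>I. 4 * L w) * (\<Prod>w\<in>F - I. 4 * L w)"
      by (rule mult_mono[OF 2 1]) (use Lpos I mpos in \<open>auto intro!: prod_nonneg simp: less_imp_le subset_iff\<close>)
    also have "\<dots> = (\<Prod>w\<in>F. 4 * L w)"
      using prod.subset_diff[OF I(1) F(2), of "\<lambda>w. 4 * L w"] by (simp add: mult.commute)
    also have "\<dots> = 4 ^ k * (\<Prod>w\<in>F. L w)" using F(3) by (simp add: prod.distrib)
    also have "\<dots> \<le> 4 ^ k * c" using cL(2) by simp
    finally show "(\<Prod>w\<in>I. 2 * L w) * (4 * m) ^ (length [0..<k] - card I) \<le> 4 ^ k * c" .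
  qed (use F Lpos mpos in auto)
  finally show ?thesis using F(3) by simp
qed

section \<open>Measurability, layers and affine subspaces\<close>

lemma borel_measurable_proj_perp [measurable (raw)]:
  fixes f g :: "'b \<Rightarrow> 'a::{real_inner, second_countable_topology}"
  assumes [measurable]: "f \<in> borel_measurable M" "g \<in> borel_measurable M"
  shows "(\<lambda>y. proj_perp (f y) (g y)) \<in> borel_measurable M"
  unfolding proj_perp_def by measurable

lemma borel_measurable_vol:
  fixes V :: "'b \<Rightarrow> 'i \<Rightarrow> 'a::{real_inner, second_countable_topology}"
  assumes "\<And>l. l \<in> set js \<Longrightarrow> (\<lambda>y. V y l) \<in> borel_measurable M"
  shows "(\<lambda>y. vol (V y) js) \<in> borel_measurable M"
  using assms
proof (induction js arbitrary: V)
  case (Cons j js)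
  have [measurable]: "(\<lambda>y. V y j) \<in> borel_measurable M" using Cons.prems by simp
  have "(\<lambda>y. vol (\<lambda>l. proj_perp (V y j) (V y l)) js) \<in> borel_measurable M"
    by (rule Cons.IH) (use Cons.prems in \<open>auto intro!: borel_measurable_proj_perp\<close>)
  then show ?case by simp
qed simp

lemma pred_greedy:
  fixes V :: "'b \<Rightarrow> 'i \<Rightarrow> 'a::{real_inner, second_countable_topology}"
  assumes "\<And>l. l \<in> set js \<Longrightarrow> (\<lambda>y. V y l) \<in> borel_measurable M"
  shows "Measurable.pred M (\<lambda>y. greedy a (V y) js)"
  using assms
proof (induction js arbitrary: V)
  case (Cons j js)
  have [measurable]: "(\<lambda>y. V y j) \<in> borel_measurable M" using Cons.prems by simp
  have [measurable]: "Measurable.pred M (\<lambda>y. greedy a (\<lambda>l. proj_perp (V y j) (V y l)) js)"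
    by (rule Cons.IH) (use Cons.prems in \<open>auto intro!: borel_measurable_proj_perp\<close>)
  have [measurable]: "(\<lambda>y. V y l) \<in> borel_measurable M" if "l \<in> set js" for l
    using Cons.prems that by simp
  have "Measurable.pred M (\<lambda>y. \<forall>l\<in>set js. a l * norm (V y l) \<le> a j * norm (V y j))"
    by (intro pred_intros_finite) measurable
  then show ?case by simp
qed simp

text \<open>Where \<open>g\<close> is at least \<open>d\<close> the integrand is at most
  \<open>d powr - \<gamma>\<close>, and the dyadic layers below \<open>d\<close> form a geometric
  series of ratio \<open>2 powr - (\<alpha> - \<gamma>)\<close>, convergent because \<gamma> <
  \<alpha>. The zero set of \<open>g\<close> contributes nothing since
  \<open>0 powr - \<gamma> = 0\<close>.\<close>

lemma nn_integral_powr_neg_le: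
  fixes g :: "'b \<Rightarrow> real"
  assumes [measurable]: "g \<in> borel_measurable M" "E \<in> sets M"
    and g: "\<And>x. 0 \<le> g x" and "0 < \<gamma>" "\<gamma> < \<alpha>" "0 < A" "0 < m"
    and m: "emeasure M E \<le> ennreal m"
    and A: "\<And>\<delta>. 0 < \<delta> \<Longrightarrow> emeasure M {x \<in> E. 0 < g x \<and> g x \<le> \<delta>} \<le> ennreal (A * \<delta> powr \<alpha>)"
  shows "(\<integral>\<^sup>+x. indicator E x * ennreal (g x powr - \<gamma>) \<partial>M)
    \<le> ennreal ((1 + 2 powr \<gamma> / (1 - 2 powr - (\<alpha> - \<gamma>))) * (m powr (1 - \<gamma> / \<alpha>) * A powr (\<gamma> / \<alpha>)))"
proof -
  \<comment> \<open>The scale at which \<open>A * d powr \<alpha> = m\<close>, so that both parts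
    have the same order.\<close>
  define d where "d = (m / A) powr (1 / \<alpha>)"
  have d: "0 < d" using \<open>0 < A\<close> \<open>0 < m\<close> by (simp add: d_def)
  define q where "q = (2::real) powr - (\<alpha> - \<gamma>)"
  have q: "0 < q" "q < 1" using \<open>\<gamma> < \<alpha>\<close> by (simp_all add: q_def powr_less_one)
  define S where "S n = {x \<in> E. 0 < g x \<and> g x \<le> d * 2 powr - real n}" for n
  have [measurable]: "S n \<in> sets M" for n
  proof -
    have "S n = {x \<in> space M. x \<in> E \<and> 0 < g x \<and> g x \<le> d * 2 powr - real n}"
      using sets.sets_into_space[OF assms(2)] by (auto simp: S_def)
    then show ?thesis by simp
  qed
  define c where "c n = (d * 2 powr - real (Suc n)) powr - \<gamma>" for n
  have c0: "0 \<le> c n" for n by (simp add: c_def)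
  have pw: "indicator E x * ennreal (g x powr - \<gamma>)
      \<le> ennreal (d powr - \<gamma>) * indicator E x + (\<Sum>n. ennreal (c n) * indicator (S n) x)" for x
  proof (cases "x \<in> E \<and> 0 < g x")
    case False
    then show ?thesis using g[of x] by (auto simp: indicator_def)
  next
    case True
    show ?thesis
    proof (cases "d \<le> g x")
      case True
      then have "g x powr - \<gamma> \<le> d powr - \<gamma>" using d \<open>0 < \<gamma>\<close> by (intro powr_mono2') auto
      then show ?thesis by (auto simp: indicator_def ennreal_leI intro: add_increasing2)
    next
      case False
      \<comment> \<open>The layer with \<open>g x\<close> between
        \<open>d * 2 powr - (n + 1)\<close> and \<open>d * 2 powr - n\<close>. Its bound
        \<open>c n\<close> is taken at the lower end, which costs the factor
        \<open>2 powr \<gamma>\<close>.\<close>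
      define n where "n = nat \<lfloor>log 2 (d / g x)\<rfloor>"
      have "log 2 (d / g x) \<ge> 0" using False True by (simp add: zero_le_log_cancel_iff)
      then have n: "real n \<le> log 2 (d / g x)" "log 2 (d / g x) < real (Suc n)"
        unfolding n_def by linarith+
      have n1: "2 powr real n \<le> d / g x" "d / g x < 2 powr real (Suc n)"
        using n True d by (simp_all add: le_log_iff log_less_iff del: of_nat_Suc)
      have xS: "x \<in> S n" using n1(1) True by (simp add: S_def powr_minus field_simps)
      have "d * 2 powr - real (Suc n) \<le> g x" using n1(2) True by (simp add: powr_minus field_simps del: of_nat_Suc)
      then have "g x powr - \<gamma> \<le> c n" unfolding c_def using d \<open>0 < \<gamma>\<close> by (intro powr_mono2') auto
      then have "ennreal (g x powr - \<gamma>) \<le> ennreal (c n) * indicator (S n) x"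
        using xS by (simp add: ennreal_leI)
      also have "\<dots> \<le> (\<Sum>n. ennreal (c n) * indicator (S n) x)"
      proof -
        have "h n \<le> suminf h" for h :: "nat \<Rightarrow> ennreal"
          using sum_le_suminf[of h "{n}"] by simp
        from this[of "\<lambda>n. ennreal (c n) * indicator (S n) x"] show ?thesis .
      qed
      finally show ?thesis using True by (simp add: add_increasing)
    qed
  qed
  define T where "T n = A * (2 powr \<gamma> * d powr (\<alpha> - \<gamma>)) * q ^ n" for n
  have T: "c n * (A * (d * 2 powr - real n) powr \<alpha>) = T n" for n
  proof -
    have "c n = d powr - \<gamma> * (2 powr (real n * \<gamma>) * 2 powr \<gamma>)"
      using d by (simp add: c_def powr_mult powr_powr algebra_simps flip: powr_add)
    moreover have "(d * 2 powr - real n) powr \<alpha> = d powr \<alpha> * 2 powr (- real n * \<alpha>)"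
      using d by (simp add: powr_mult powr_powr)
    moreover have "q ^ n = 2 powr (real n * \<gamma>) * 2 powr (- real n * \<alpha>)"
      by (simp add: q_def powr_power algebra_simps flip: powr_add)
    moreover have "d powr (\<alpha> - \<gamma>) = d powr - \<gamma> * d powr \<alpha>" by (simp flip: powr_add)
    ultimately show ?thesis by (simp add: T_def)
  qed
  have "(\<integral>\<^sup>+x. indicator E x * ennreal (g x powr - \<gamma>) \<partial>M)
     \<le> (\<integral>\<^sup>+x. ennreal (d powr - \<gamma>) * indicator E x + (\<Sum>n. ennreal (c n) * indicator (S n) x) \<partial>M)"
    by (intro nn_integral_mono pw)
  also have "\<dots> = ennreal (d powr - \<gamma>) * emeasure M E + (\<Sum>n. ennreal (c n) * emeasure M (S n))"
    by (simp add: nn_integral_add nn_integral_suminf nn_integral_cmult)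
  also have "\<dots> \<le> ennreal (d powr - \<gamma>) * ennreal m + (\<Sum>n. ennreal (T n))"
  proof (intro add_mono mult_left_mono m suminf_le)
    fix n
    have "ennreal (c n) * emeasure M (S n) \<le> ennreal (c n) * ennreal (A * (d * 2 powr - real n) powr \<alpha>)"
      unfolding S_def by (intro mult_left_mono A) (use d in auto)
    also have "\<dots> = ennreal (T n)"
      using c0 \<open>0 < A\<close> by (simp add: ennreal_mult[symmetric] T)
    finally show "ennreal (c n) * emeasure M (S n) \<le> ennreal (T n)" .
  qed auto
  also have "(\<Sum>n. ennreal (T n)) = ennreal (\<Sum>n. T n)"
    by (rule suminf_ennreal2) (use q \<open>0 < A\<close> in \<open>auto simp: T_def intro!: summable_mult summable_geometric\<close>)
  also have "(\<Sum>n. T n) = A * (2 powr \<gamma> * d powr (\<alpha> - \<gamma>)) * (1 / (1 - q))"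
    unfolding T_def using q by (simp add: suminf_mult summable_geometric suminf_geometric)
  also have "ennreal (d powr - \<gamma>) * ennreal m + ennreal (A * (2 powr \<gamma> * d powr (\<alpha> - \<gamma>)) * (1 / (1 - q)))
     = ennreal (d powr - \<gamma> * m + A * d powr (\<alpha> - \<gamma>) * (2 powr \<gamma> / (1 - q)))"
    using q \<open>0 < A\<close> \<open>0 < m\<close> by (simp add: ennreal_mult[symmetric] ennreal_plus[symmetric] mult_ac del: ennreal_plus)
  also have "d powr - \<gamma> * m = m powr (1 - \<gamma> / \<alpha>) * A powr (\<gamma> / \<alpha>)"
  proof -
    have "d powr - \<gamma> = (A / m) powr (\<gamma> / \<alpha>)"
      using \<open>0 < A\<close> \<open>0 < m\<close> by (simp add: d_def powr_powr powr_minus powr_divide field_simps)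
    also have "\<dots> * m = m powr 1 * m powr (- (\<gamma> / \<alpha>)) * A powr (\<gamma> / \<alpha>)"
      using \<open>0 < A\<close> \<open>0 < m\<close> by (simp add: powr_divide powr_minus field_simps)
    also have "m powr 1 * m powr (- (\<gamma> / \<alpha>)) = m powr (1 - \<gamma> / \<alpha>)" by (simp only: powr_add[symmetric]) simp
    finally show ?thesis .
  qed
  also have "A * d powr (\<alpha> - \<gamma>) = m powr (1 - \<gamma> / \<alpha>) * A powr (\<gamma> / \<alpha>)"
  proof -
    have "1 / \<alpha> * (\<alpha> - \<gamma>) = 1 - \<gamma> / \<alpha>" using \<open>0 < \<gamma>\<close> \<open>\<gamma> < \<alpha>\<close> by (simp add: field_simps)
    then have "d powr (\<alpha> - \<gamma>) = (m / A) powr (1 - \<gamma> / \<alpha>)" unfolding d_def powr_powr by simp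
    also have "A * (m / A) powr b = m powr b * (A powr 1 * A powr (- b))" for b
      using \<open>0 < A\<close> \<open>0 < m\<close> by (simp add: powr_divide powr_minus field_simps)
    also have "A powr 1 * A powr (- (1 - \<gamma> / \<alpha>)) = A powr (\<gamma> / \<alpha>)" by (simp only: powr_add[symmetric]) simp
    finally show ?thesis .
  qed
  finally show ?thesis by (simp add: q_def distrib_left distrib_right mult_ac)
qed

text \<open>The sum is the supremum of its finite partial sums, so the ellipsoid is an intersection
  of closed conditions, one for each finite set of axes. Closedness is what makes it
  measurable.\<close>

lemma closed_ellipsoid:
  fixes W :: "'a::real_inner set"
  shows "closed (ellipsoid x0 W l)"
proof -
  \<comment> \<open>\<open>1 / 0 = 0\<close> makes the coefficient vanish for zero lengths too;
    those enter \<open>P\<close> only through the equation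
    \<open>inner (x - x0) w = 0\<close>.\<close>
  define c where "c w = (if l w = \<infinity> then 0 else 1 / (enn2real (l w))\<^sup>2)" for w
  have term_eq: "ennreal (\<bar>t\<bar>\<^sup>2) / (l w)\<^sup>2 = (if l w = 0 \<and> t \<noteq> 0 then \<infinity> else ennreal (c w * t\<^sup>2))" for w t
  proof (cases "l w")
    case (real b)
    then show ?thesis
      by (cases "b = 0"; cases "t = 0")
        (auto simp: c_def divide_ennreal_def ennreal_mult_top ennreal_mult_eq_top_iff
          ennreal_power inverse_ennreal ennreal_mult[symmetric] divide_inverse mult.commute)
  next
    case top
    then show ?thesis by (simp add: c_def divide_ennreal_def)
  qed
  define P where "P G = {x. \<forall>w\<in>G. l w = 0 \<longrightarrow> inner (x - x0) w = 0} \<inter>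
     {x. (\<Sum>w\<in>G. c w * (inner (x - x0) w)\<^sup>2) \<le> 1}" for G
  have "closed (P G)" if "finite G" for G
  proof -
    have "{x. \<forall>w\<in>G. l w = 0 \<longrightarrow> inner (x - x0) w = 0}
        = (\<Inter>w\<in>{w\<in>G. l w = 0}. {x. inner (x - x0) w = 0})" by auto
    then show ?thesis
      unfolding P_def by (auto intro!: closed_Int closed_INT closed_Collect_eq closed_Collect_le continuous_intros)
  qed
  moreover have "ellipsoid x0 W l = (\<Inter>G\<in>{G. finite G \<and> G \<subseteq> W}. P G)"
  proof -
    have "(\<Sum>w\<in>G. ennreal (\<bar>inner (x - x0) w\<bar>\<^sup>2) / (l w)\<^sup>2) \<le> 1 \<longleftrightarrow> x \<in> P G" if "finite G" for G x
    proof (cases "\<forall>w\<in>G. l w = 0 \<longrightarrow> inner (x - x0) w = 0")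
      case True
      have "(\<Sum>w\<in>G. ennreal (\<bar>inner (x - x0) w\<bar>\<^sup>2) / (l w)\<^sup>2) = (\<Sum>w\<in>G. ennreal (c w * (inner (x - x0) w)\<^sup>2))"
        unfolding term_eq by (rule sum.cong) (use True in auto)
      also have "\<dots> = ennreal (\<Sum>w\<in>G. c w * (inner (x - x0) w)\<^sup>2)"
        by (rule sum_ennreal) (simp add: c_def)
      finally show ?thesis using True by (simp add: P_def ennreal_le_1)
    next
      case False
      then obtain w where w: "w \<in> G" "l w = 0" "inner (x - x0) w \<noteq> 0" by auto
      then have "(\<Sum>w\<in>G. ennreal (\<bar>inner (x - x0) w\<bar>\<^sup>2) / (l w)\<^sup>2) = \<infinity>"
        using member_le_sum[OF w(1), of "\<lambda>w. ennreal (\<bar>inner (x - x0) w\<bar>\<^sup>2) / (l w)\<^sup>2"] that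
        unfolding term_eq by (simp add: top_unique)
      then show ?thesis using False by (simp add: P_def top_unique)
    qed
    then show ?thesis
      unfolding ellipsoid_def by (subst nonneg_infsum_complete) (auto simp: SUP_le_iff)
  qed
  ultimately show ?thesis by (auto intro: closed_INT)
qed

section \<open>Finite-dimensional affine subspaces\<close>

lemma ex_independent_superset:
  fixes B :: "'a::real_vector set"
  assumes "independent B" "finite B" "card B \<le> m" "enat m \<le> vdim (UNIV :: 'a set)"
  shows "\<exists>B'. B \<subseteq> B' \<and> independent B' \<and> finite B' \<and> card B' = m"
  using assms
proof (induction "m - card B" arbitrary: B)
  case (Suc d)
  then have lt: "card B < m" by simp
  then have "enat (card B) < vdim (UNIV :: 'a set)" using Suc.prems(4) by (meson enat_ord_simps(2) less_le_trans)
  then obtain D :: "'a set" where D: "finite D" "independent D" "card B < card D"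
    unfolding vdim_def less_SUP_iff by auto
  have "\<not> D \<subseteq> span B"
    using independent_span_bound[OF Suc.prems(2) D(2)] D(3) by auto
  then obtain b where b: "b \<in> D" "b \<notin> span B" by auto
  then have "b \<notin> B" using span_base by blast
  have "\<exists>B'. insert b B \<subseteq> B' \<and> independent B' \<and> finite B' \<and> card B' = m"
  proof (rule Suc.hyps(1))
    show "d = m - card (insert b B)" using Suc.hyps(2) Suc.prems(2) \<open>b \<notin> B\<close> by simp
    show "independent (insert b B)" using b Suc.prems(1) by (simp add: independent_insert)
    show "card (insert b B) \<le> m" using lt Suc.prems(2) \<open>b \<notin> B\<close> by simp
  qed (use Suc.prems in auto)
  then show ?case by auto
qed auto

lemma vdim_span: "independent B \<Longrightarrow> finite B \<Longrightarrow> vdim (span B) = enat (card B)"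
  unfolding vdim_def
proof (rule antisym)
  assume B: "independent B" "finite B"
  show "(SUP D\<in>{D. D \<subseteq> span B \<and> finite D \<and> independent D}. enat (card D)) \<le> enat (card B)"
    by (rule SUP_least) (use independent_span_bound[OF B(2)] in auto)
  show "enat (card B) \<le> (SUP D\<in>{D. D \<subseteq> span B \<and> finite D \<and> independent D}. enat (card D))"
    by (rule SUP_upper2[of B]) (use B span_superset in auto)
qed

text \<open>Admissibility speaks about affine subspaces of dimension exactly \<open>k - 1\<close>,
  while degenerate configurations may span less. The span is padded with independent vectors, which
  the bound on \<open>vdim\<close> provides.\<close>

lemma translate_span_subset_affine_subspace:
  fixes S :: "'a::real_vector set"
  assumes "finite S" "card S \<le> m" "enat m \<le> vdim (UNIV :: 'a set)"
  obtains A where "affine_subspace m A" "(+) a ` span S \<subseteq> A"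
proof -
  obtain B where B: "B \<subseteq> S" "independent B" "S \<subseteq> span B"
    using maximal_independent_subset[of S] by blast
  have fB: "finite B" "card B \<le> m"
    using B(1) assms card_mono[OF assms(1) B(1)] finite_subset by auto
  obtain B' where B': "B \<subseteq> B'" "independent B'" "finite B'" "card B' = m"
    using ex_independent_superset[OF B(2) fB assms(3)] by blast
  have "span S \<subseteq> span B'"
    using B(3) span_mono[OF B'(1)] by (metis order_trans span_minimal subspace_span)
  moreover have "affine_subspace m ((+) a ` span B')"
    unfolding affine_subspace_def using vdim_span[OF B'(2,3)] B'(4) by (metis subspace_span)
  ultimately show ?thesis using that by blast
qed

section \<open>The restricted upper bound\<close>

lemma ennreal_powr_ennreal: "0 \<le> c \<Longrightarrow> ennreal_powr (ennreal c) a = ennreal (c powr a)"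
  by (simp add: ennreal_powr_def)

lemma ennreal_powr_le:
  assumes "x \<le> ennreal t" "0 < a" "0 \<le> t"
  shows "ennreal_powr x a \<le> ennreal (t powr a)"
proof -
  obtain b where "x = ennreal b" "0 \<le> b" "b \<le> t"
    using assms by (cases x) (auto simp: top_unique)
  then show ?thesis using assms by (simp add: ennreal_powr_ennreal ennreal_leI powr_mono2)
qed

locale det_setting =
  fixes \<mu> :: "'a::{real_inner, polish_space} measure" and k :: nat
  assumes k: "1 \<le> k" and dim: "enat k \<le> vdim (UNIV :: 'a set)" and adm: "k_admissible k \<mu>"
begin

lemma sets_mu [measurable_cong]: "sets \<mu> = sets borel"
  using adm by (simp add: k_admissible_def)

lemma space_mu [simp]: "space \<mu> = UNIV"
  using sets_eq_imp_space_eq[OF sets_mu] by simp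

sublocale sigma_finite_measure \<mu>
  using adm by (simp add: k_admissible_def)

sublocale product_sigma_finite "\<lambda>_::nat. \<mu>"
  by standard

abbreviation "N \<equiv> Pi\<^sub>M {..k} (\<lambda>_::nat. \<mu>)"

lemma measurable_component [measurable]: "i \<in> I \<Longrightarrow> (\<lambda>y. y i) \<in> borel_measurable (Pi\<^sub>M I (\<lambda>_::nat. \<mu>))"
  using measurable_component_singleton[of i I "\<lambda>_. \<mu>"] by (simp cong: measurable_cong_sets add: sets_mu)

lemma measurable_simplex_det [measurable]: "simplex_det k \<in> borel_measurable N"
proof -
  have "(\<lambda>y::nat \<Rightarrow> 'a. vol (\<lambda>i. y i - y k) [0..<k]) \<in> borel_measurable N"
    by (rule borel_measurable_vol) (auto intro!: borel_measurable_diff measurable_component)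
  then show ?thesis by (simp add: simplex_det_eq_vol_last[abs_def])
qed

definition orders :: "nat \<Rightarrow> nat list set" where
  "orders r = {js. distinct js \<and> set js = {..k} - {r}}"

definition greedy_at :: "(nat \<Rightarrow> real) \<Rightarrow> nat \<Rightarrow> nat list \<Rightarrow> (nat \<Rightarrow> 'a) \<Rightarrow> bool" where
  "greedy_at a r js y = greedy a (\<lambda>l. y l - y r) js"

lemma finite_orders: "finite (orders r)"
  by (rule finite_subset[OF _ finite_subset_distinct[of "{..k}"]]) (auto simp: orders_def)

lemma ex_greedy_order: "\<exists>js\<in>orders r. greedy_at a r js y"
  using ex_greedy[of "{..k} - {r}" a "\<lambda>l. y l - y r"] by (auto simp: orders_def greedy_at_def)

lemma pred_greedy_at [measurable]:
  assumes "r \<le> k" "js \<in> orders r"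
  shows "Measurable.pred N (greedy_at a r js)"
  unfolding greedy_at_def[abs_def]
  by (rule pred_greedy) (use assms in \<open>auto simp: orders_def intro!: borel_measurable_diff measurable_component\<close>)

lemma orders_snocE:
  assumes "js \<in> orders r" "r \<le> k"
  obtains js' i where "js = js' @ [i]" "distinct js'" "i \<notin> set js'" "i \<le> k" "i \<noteq> r"
    "length js' + 1 = k" "set js' = {..k} - {i} - {r}"
proof -
  have len: "length js = k" using assms distinct_card[of js] by (simp add: orders_def)
  then have "js \<noteq> []" using k by auto
  then obtain js' i where js: "js = js' @ [i]" by (metis rev_exhaust)
  show ?thesis
  proof (rule that[OF js])
    have "set js = insert i (set js')" "i \<notin> set js'" using js assms by (auto simp: orders_def)
    then show "set js' = {..k} - {i} - {r}" using assms by (auto simp: orders_def)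
  qed (use js assms len in \<open>auto simp: orders_def\<close>)
qed

lemma edges_update: "i \<noteq> r \<Longrightarrow> (\<lambda>l. (x(i := u)) l - (x(i := u)) r) = (\<lambda>l. x l - x r)(i := u - x r :: 'a)"
  by (auto simp: fun_eq_iff)

text \<open>The exceptional set is split over the finitely many orderings of the edges at vertex
  \<open>k\<close>. Where \<open>js\<close> is greedy and the determinant vanishes, the last vertex
  lies in the affine span of the other \<open>k\<close> vertices, of dimension at most
  \<open>k - 1\<close>. The slices are null by admissibility, and Tonelli's theorem
  concludes.\<close>

lemma AE_simplex_det_nz: "AE y in N. simplex_det k y \<noteq> 0"
proof -
  have "AE y in N. \<not> (greedy_at (\<lambda>_. 1) k js y \<and> simplex_det k y = 0)" if js: "js \<in> orders k" for js
  proof -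
    obtain js' i where js': "js = js' @ [i]" "distinct js'" "i \<notin> set js'" "i \<le> k" "i \<noteq> k"
      "length js' + 1 = k" "set js' = {..k} - {i} - {k}" using orders_snocE[OF js] by auto
    let ?I = "{..k} - {i}"
    have I: "insert i ?I = {..k}" using js' by auto
    define h where "h y = (indicator {y. greedy_at (\<lambda>_. 1) k js y \<and> simplex_det k y = 0} y :: ennreal)" for y
    have gm [measurable]: "Measurable.pred N (greedy_at (\<lambda>_. 1) k js)" by (rule pred_greedy_at) (use js in auto)
    have h_alt: "h = (\<lambda>y. if greedy_at (\<lambda>_. 1) k js y \<and> simplex_det k y = 0 then 1 else 0)"
      by (auto simp: h_def indicator_def)
    have h [measurable]: "h \<in> borel_measurable N" unfolding h_alt by measurable
    have "integral\<^sup>N N h = (\<integral>\<^sup>+ x. (\<integral>\<^sup>+ u. h (x(i := u)) \<partial>\<mu>) \<partial>(Pi\<^sub>M ?I (\<lambda>_. \<mu>)))"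
      using product_nn_integral_insert[of ?I i h] h I by simp
    also have "\<dots> = (\<integral>\<^sup>+ x. 0 \<partial>(Pi\<^sub>M ?I (\<lambda>_. \<mu>)))"
    proof (rule nn_integral_cong)
      fix x :: "nat \<Rightarrow> 'a"
      define v where "v l = x l - x k" for l
      have "card (v ` set js') \<le> k - 1"
        using card_image_le[of "set js'" v] js'(6) distinct_card[OF js'(2)] by simp
      moreover have "enat (k - 1) \<le> vdim (UNIV :: 'a set)"
        using dim by (meson diff_le_self enat_ord_simps(1) order_trans)
      ultimately obtain A where A: "affine_subspace (k - 1) A" "(+) (x k) ` span (v ` set js') \<subseteq> A"
        by (metis translate_span_subset_affine_subspace finite_imageI List.finite_set)
      have nullA: "A \<in> null_sets \<mu>" using adm A(1) by (simp add: k_admissible_def)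
      have "h (x(i := u)) \<le> indicator A u" for u
      proof (cases "h (x(i := u)) = 0")
        case False
        then have "greedy_at (\<lambda>_. 1) k js (x(i := u))" "simplex_det k (x(i := u)) = 0"
          by (auto simp: h_def indicator_def split: if_splits)
        then have "greedy (\<lambda>_. 1) (v(i := u - x k)) (js' @ [i])" "vol (v(i := u - x k)) (js' @ [i]) = 0"
          using edges_update[OF js'(5), of x u] simplex_det_eq_vol[of k k js "x(i := u)"] js js'(1)
          by (simp_all add: greedy_at_def orders_def v_def[abs_def])
        then have "(v(i := u - x k)) i \<in> span ((v(i := u - x k)) ` set js')"
          by (rule greedy_degenerate) simp
        moreover have "(v(i := u - x k)) ` set js' = v ` set js'" using js'(3) by (intro image_cong) auto
        ultimately have "u - x k \<in> span (v ` set js')" by simp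
        then have "x k + (u - x k) \<in> A" using A(2) by blast
        then show ?thesis by (simp add: h_def indicator_def)
      qed simp
      then have "(\<integral>\<^sup>+ u. h (x(i := u)) \<partial>\<mu>) \<le> (\<integral>\<^sup>+ u. indicator A u \<partial>\<mu>)" by (intro nn_integral_mono)
      also have "\<dots> = 0" using nullA by (simp add: null_setsD1 null_setsD2)
      finally show "(\<integral>\<^sup>+ u. h (x(i := u)) \<partial>\<mu>) = 0" by simp
    qed
    finally have "integral\<^sup>N N h = 0" by simp
    then have "AE y in N. h y = 0" by (simp add: nn_integral_0_iff_AE)
    then show ?thesis by eventually_elim (auto simp: h_def indicator_def split: if_splits)
  qed
  then have "AE y in N. \<forall>js\<in>orders k. \<not> (greedy_at (\<lambda>_. 1) k js y \<and> simplex_det k y = 0)"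
    by (intro AE_finite_allI finite_orders)
  then show ?thesis by eventually_elim (use ex_greedy_order in blast)
qed

text \<open>The weights are chosen so that the bound does not depend on which vertex comes last.\<close>

lemma greedy_piece_bound:
  fixes \<gamma> \<alpha> :: real and U :: "nat \<Rightarrow> real" and E :: "nat \<Rightarrow> 'a set"
  assumes \<gamma>: "0 < \<gamma>" "\<gamma> < \<alpha>" and C0: "0 < C0"
    and ell: "\<And>x0 W l. orthonormal_basis W \<Longrightarrow>
        emeasure \<mu> (ellipsoid x0 W l) \<le> ennreal C0 * ennreal_powr (ellipsoid_content k W l) \<alpha>"
    and r: "r \<le> k" and js: "js \<in> orders r"
    and E: "\<And>j. j \<le> k \<Longrightarrow> E j \<in> sets \<mu>" and U: "\<And>j. j \<le> k \<Longrightarrow> 0 < U j"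
    and EU: "\<And>j. j \<le> k \<Longrightarrow> emeasure \<mu> (E j) \<le> ennreal (U j)"
  shows "(\<integral>\<^sup>+y. (\<Prod>j\<le>k. indicator (E j) (y j)) *
      (indicator {y. greedy_at (\<lambda>j. U j powr - (1 / (real k * \<alpha>))) r js y} y * ennreal (simplex_det k y powr - \<gamma>)) \<partial>N)
    \<le> ennreal (((1 + 2 powr \<gamma> / (1 - 2 powr - (\<alpha> - \<gamma>))) * C0 powr (\<gamma> / \<alpha>) * (sqrt k ^ k) powr \<gamma>) *
        (\<Prod>j\<le>k. U j) * (\<Prod>j\<in>{..k} - {r}. U j powr - (\<gamma> / (real k * \<alpha>))))"
proof -
  obtain js' i where js': "js = js' @ [i]" "distinct js'" "i \<notin> set js'" "i \<le> k" "i \<noteq> r"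
    "length js' + 1 = k" "set js' = {..k} - {i} - {r}" using orders_snocE[OF js r] by auto
  let ?I = "{..k} - {i}"
  have I: "insert i ?I = {..k}" using js' by auto
  define Cg where "Cg = 1 + 2 powr \<gamma> / (1 - 2 powr - (\<alpha> - \<gamma>))"
  have Cg: "Cg \<ge> 0"
  proof -
    have "2 powr - (\<alpha> - \<gamma>) \<le> (1::real)" using \<gamma> powr_less_one[of 2 "- (\<alpha> - \<gamma>)"] by simp
    then show ?thesis by (simp add: Cg_def)
  qed
  define a where "a j = U j powr - (1 / (real k * \<alpha>))" for j
  define \<kappa> where "\<kappa> = sqrt k ^ k"
  define \<theta> where "\<theta> = \<gamma> / (real k * \<alpha>)"
  define P where "P = (\<Prod>j\<in>set js'. a j / a i)"
  \<comment> \<open>The value that \<open>nn_integral_powr_neg_le\<close> gives for one slice, with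
    \<open>U i\<close> as total mass and \<open>C0 * (\<kappa> * P) powr \<alpha>\<close> as
    constant of the distribution function.\<close>
  define B where "B = Cg * (U i powr (1 - \<gamma> / \<alpha>) * (C0 * (\<kappa> * P) powr \<alpha>) powr (\<gamma> / \<alpha>))"
  have apos: "0 < a j" if "j \<le> k" for j using U[OF that] by (simp add: a_def)
  have \<kappa>: "0 < \<kappa>" using k by (simp add: \<kappa>_def)
  have P: "0 < P" unfolding P_def by (rule prod_pos) (use apos js' in auto)
  define G where "G y = indicator {y. greedy_at a r js y} y * ennreal (simplex_det k y powr - \<gamma>)" for y
  have gm [measurable]: "Measurable.pred N (greedy_at a r js)" by (rule pred_greedy_at[OF r js])
  have Gm [measurable]: "G \<in> borel_measurable N"
  proof -
    have "G = (\<lambda>y. (if greedy_at a r js y then 1 else 0) * ennreal (simplex_det k y powr - \<gamma>))"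
      by (auto simp: G_def indicator_def)
    then show ?thesis by simp
  qed
  have Em [measurable]: "E j \<in> sets borel" if "j \<le> k" for j using E[OF that] sets_mu by simp
  have slice: "(\<integral>\<^sup>+u. indicator (E i) u * G (x(i := u)) \<partial>\<mu>) \<le> ennreal B" for x
  proof -
    define v where "v l = x l - x r" for l
    define g where "g u = vol (v(i := u - x r)) js" for u
    have det: "simplex_det k (x(i := u)) = g u" for u
      using edges_update[OF js'(5), of x u] simplex_det_eq_vol[OF r, of js "x(i := u)"] js
      by (simp add: orders_def g_def v_def[abs_def])
    have gr: "greedy_at a r js (x(i := u)) \<longleftrightarrow> greedy a (v(i := u - x r)) js" for u
      using edges_update[OF js'(5), of x u] by (simp add: greedy_at_def v_def[abs_def])
    have comp: "(\<lambda>u. (v(i := u - x r)) l) \<in> borel_measurable \<mu>" for l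
      using borel_measurable_diff[OF measurable_ident_sets[OF sets_mu] borel_measurable_const[of "x r"]]
      by (cases "l = i") auto
    have g_meas: "g \<in> borel_measurable \<mu>"
      unfolding g_def by (rule borel_measurable_vol) (rule comp)
    have grm: "Measurable.pred \<mu> (\<lambda>u. greedy a (v(i := u - x r)) js)"
      by (rule pred_greedy) (rule comp)
    \<comment> \<open>Greediness is kept as part of the set, since only greedy positions of the last
      vertex are known to lie in the ellipsoid.\<close>
    define E' where "E' = {u \<in> space \<mu>. u \<in> E i \<and> greedy a (v(i := u - x r)) js}"
    have E'm [measurable]: "E' \<in> sets \<mu>"
    proof -
      have "E' = E i \<inter> {u \<in> space \<mu>. greedy a (v(i := u - x r)) js}" by (auto simp: E'_def)
      then show ?thesis using grm E[OF js'(4)] by (simp add: pred_def sets.Int)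
    qed
    have "(\<integral>\<^sup>+u. indicator (E i) u * G (x(i := u)) \<partial>\<mu>) = (\<integral>\<^sup>+u. indicator E' u * ennreal (g u powr - \<gamma>) \<partial>\<mu>)"
      by (rule nn_integral_cong) (auto simp: G_def E'_def det gr indicator_def)
    also have "\<dots> \<le> ennreal (Cg * (U i powr (1 - \<gamma> / \<alpha>) * (C0 * (\<kappa> * P) powr \<alpha>) powr (\<gamma> / \<alpha>)))"
      unfolding Cg_def
    proof (rule nn_integral_powr_neg_le)
      show "0 < C0 * (\<kappa> * P) powr \<alpha>" using C0 \<kappa> P by simp
      show "0 \<le> g u" for u by (simp add: g_def)
      show "emeasure \<mu> E' \<le> ennreal (U i)"
        by (rule order_trans[OF emeasure_mono EU]) (use E js' in \<open>auto simp: E'_def\<close>)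
      fix \<delta> :: real assume \<delta>: "0 < \<delta>"
      show "emeasure \<mu> {u \<in> E'. 0 < g u \<and> g u \<le> \<delta>} \<le> ennreal (C0 * (\<kappa> * P) powr \<alpha> * \<delta> powr \<alpha>)"
      \<comment> \<open>If the other vertices are degenerate, the determinant vanishes on the whole
        slice and the layer is empty.\<close>
      proof (cases "vol v js' = 0")
        case True
        have "g u = 0" for u
        proof -
          have "vol (v(i := u - x r)) js' = vol v js'" by (rule vol_cong) (use js'(3) in auto)
          then show ?thesis using True by (simp add: g_def js'(1) vol_snoc)
        qed
        then show ?thesis by simp
      next
        case False
        obtain W l where W: "orthonormal_basis W"
          and con: "ellipsoid_content k W l \<le> ennreal (sqrt k ^ k * (\<delta> * (\<Prod>j\<in>set js'. a j / a i)))"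
          and mem: "\<And>u. greedy a (v(i := u)) (js' @ [i]) \<Longrightarrow> vol (v(i := u)) (js' @ [i]) \<le> \<delta> \<Longrightarrow> x r + u \<in> ellipsoid (x r) W l"
          using greedy_slice_in_ellipsoid[where a = a and x = "x r", OF js'(3,2) False apos[OF js'(4)] _ \<delta> js'(6)[symmetric]]
            apos js'(7) by auto
        have "{u \<in> E'. 0 < g u \<and> g u \<le> \<delta>} \<subseteq> ellipsoid (x r) W l"
          using mem[of "_ - x r"] by (auto simp: E'_def g_def js'(1))
        then have "emeasure \<mu> {u \<in> E'. 0 < g u \<and> g u \<le> \<delta>} \<le> emeasure \<mu> (ellipsoid (x r) W l)"
          by (rule emeasure_mono) (simp add: sets_mu borel_closed closed_ellipsoid)
        also have "\<dots> \<le> ennreal C0 * ennreal_powr (ellipsoid_content k W l) \<alpha>" by (rule ell[OF W])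
        also have "\<dots> \<le> ennreal C0 * ennreal ((\<kappa> * (\<delta> * P)) powr \<alpha>)"
          by (intro mult_left_mono ennreal_powr_le) (use con \<gamma> \<kappa> P \<delta> in \<open>auto simp: \<kappa>_def P_def\<close>)
        also have "\<dots> = ennreal (C0 * (\<kappa> * P) powr \<alpha> * \<delta> powr \<alpha>)"
          using C0 \<kappa> P \<delta> by (simp add: ennreal_mult[symmetric] powr_mult mult_ac)
        finally show ?thesis .
      qed
    qed (use \<gamma> U js'(4) g_meas E'm in simp_all)
    finally show ?thesis by (simp add: B_def)
  qed
  have "(\<integral>\<^sup>+y. (\<Prod>j\<le>k. indicator (E j) (y j)) * G y \<partial>N)
     = (\<integral>\<^sup>+x. (\<integral>\<^sup>+u. (\<Prod>j\<le>k. indicator (E j) ((x(i := u)) j)) * G (x(i := u)) \<partial>\<mu>) \<partial>(Pi\<^sub>M ?I (\<lambda>_. \<mu>)))"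
  proof -
    have m: "(\<lambda>y. (\<Prod>j\<le>k. indicator (E j) (y j)) * G y) \<in> borel_measurable (Pi\<^sub>M (insert i ?I) (\<lambda>_. \<mu>))"
      unfolding I by measurable
    show ?thesis
      using product_nn_integral_insert[OF _ _ m] I by simp
  qed
  also have "\<dots> = (\<integral>\<^sup>+x. (\<Prod>j\<in>?I. indicator (E j) (x j)) * (\<integral>\<^sup>+u. indicator (E i) u * G (x(i := u)) \<partial>\<mu>) \<partial>(Pi\<^sub>M ?I (\<lambda>_. \<mu>)))"
  proof (rule nn_integral_cong)
    fix x assume x: "x \<in> space (Pi\<^sub>M ?I (\<lambda>_. \<mu>))"
    have upd: "(\<lambda>u. x(i := u)) \<in> measurable \<mu> N"
      using measurable_fun_upd[of "{..k}" ?I i "\<lambda>_. x" \<mu> "\<lambda>_. \<mu>" "\<lambda>u. u"] x I by auto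
    have "(\<Prod>j\<le>k. indicator (E j) ((x(i := u)) j)) = (\<Prod>j\<in>?I. indicator (E j) (x j)) * (indicator (E i) u :: ennreal)" for u
    proof -
      have "(\<Prod>j\<in>?I. indicator (E j) ((x(i := u)) j)) = (\<Prod>j\<in>?I. indicator (E j) (x j) :: ennreal)"
        by (rule prod.cong) auto
      then show ?thesis using prod.remove[of "{..k}" i "\<lambda>j. indicator (E j) ((x(i := u)) j) :: ennreal"] js'(4)
        by (simp add: mult.commute)
    qed
    moreover have "(\<lambda>u. indicator (E i) u * G (x(i := u))) \<in> borel_measurable \<mu>"
      using E[OF js'(4)] by (intro borel_measurable_times_ennreal borel_measurable_indicator measurable_compose[OF upd Gm])
    ultimately show "(\<integral>\<^sup>+u. (\<Prod>j\<le>k. indicator (E j) ((x(i := u)) j)) * G (x(i := u)) \<partial>\<mu>)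
        = (\<Prod>j\<in>?I. indicator (E j) (x j)) * (\<integral>\<^sup>+u. indicator (E i) u * G (x(i := u)) \<partial>\<mu>)"
      by (simp add: mult.assoc nn_integral_cmult)
  qed
  also have "\<dots> \<le> (\<integral>\<^sup>+x. (\<Prod>j\<in>?I. indicator (E j) (x j)) * ennreal B \<partial>(Pi\<^sub>M ?I (\<lambda>_. \<mu>)))"
    by (intro nn_integral_mono mult_left_mono slice) simp
  also have "\<dots> = (\<integral>\<^sup>+x. (\<Prod>j\<in>?I. indicator (E j) (x j)) \<partial>(Pi\<^sub>M ?I (\<lambda>_. \<mu>))) * ennreal B"
    by (rule nn_integral_multc) measurable
  also have "(\<integral>\<^sup>+x. (\<Prod>j\<in>?I. indicator (E j) (x j)) \<partial>(Pi\<^sub>M ?I (\<lambda>_. \<mu>))) = (\<Prod>j\<in>?I. emeasure \<mu> (E j))"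
    using E by (subst product_nn_integral_prod) (auto intro!: prod.cong borel_measurable_indicator)
  also have "\<dots> \<le> (\<Prod>j\<in>?I. ennreal (U j))"
    by (rule prod_mono_ennreal) (use EU in auto)
  also have "\<dots> = ennreal (\<Prod>j\<in>?I. U j)"
    by (rule prod_ennreal) (use U in \<open>auto simp: less_imp_le\<close>)
  also have "ennreal (\<Prod>j\<in>?I. U j) * ennreal B = ennreal ((\<Prod>j\<in>?I. U j) * B)"
    by (rule ennreal_mult[symmetric]) (use U Cg in \<open>auto simp: B_def less_imp_le intro!: prod_nonneg mult_nonneg_nonneg\<close>)
  also have "(\<Prod>j\<in>?I. U j) * B = (Cg * C0 powr (\<gamma> / \<alpha>) * \<kappa> powr \<gamma>) *
        (\<Prod>j\<le>k. U j) * (\<Prod>j\<in>{..k} - {r}. U j powr - \<theta>)"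
  proof -
    have Ui: "0 < U i" using U js' by simp
    have a\<gamma>: "a j powr \<gamma> = U j powr - \<theta>" for j
      by (simp add: a_def powr_powr \<theta>_def)
    have "(\<Prod>j\<in>set js'. a j / a i) powr \<gamma> = (\<Prod>j\<in>set js'. (a j / a i) powr \<gamma>)"
      by (rule prod_powr_distrib)
    also have "\<dots> = (\<Prod>j\<in>set js'. U j powr - \<theta> * U i powr \<theta>)"
    proof (rule prod.cong)
      fix j assume "j \<in> set js'"
      then have "(a j / a i) powr \<gamma> = a j powr \<gamma> / a i powr \<gamma>"
        by (intro powr_divide)
      then show "(a j / a i) powr \<gamma> = U j powr - \<theta> * U i powr \<theta>"
        unfolding a\<gamma> by (simp add: powr_minus divide_inverse)
    qed simp
    also have "\<dots> = (\<Prod>j\<in>set js'. U j powr - \<theta>) * U i powr (\<theta> * (k - 1))"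
    proof -
      have len: "real (length js') = real (k - 1)" using js'(6) by simp
      show ?thesis
        using distinct_card[OF js'(2)] Ui by (simp add: prod.distrib powr_power len mult.commute)
    qed
    finally have P\<gamma>: "P powr \<gamma> = (\<Prod>j\<in>set js'. U j powr - \<theta>) * U i powr (\<theta> * (k - 1))"
      by (simp add: P_def)
    have "(C0 * (\<kappa> * P) powr \<alpha>) powr (\<gamma> / \<alpha>) = C0 powr (\<gamma> / \<alpha>) * (\<kappa> powr \<gamma> * P powr \<gamma>)"
      using C0 \<kappa> P \<gamma> by (simp add: powr_mult powr_powr)
    moreover have "U i powr (1 - \<gamma> / \<alpha>) * U i powr (\<theta> * (k - 1)) = U i * U i powr - \<theta>"
    proof -
      have "k * \<theta> = \<gamma> / \<alpha>" using k by (simp add: \<theta>_def)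
      \<comment> \<open>The exponent count for \<open>U i\<close>: 1 - \<gamma>/\<alpha> from the
        slice and (k - 1) \<theta> from dividing by \<open>a i\<close> add up to 1 -
        \<theta>.\<close>
      then have e: "(1 - \<gamma> / \<alpha>) + \<theta> * (k - 1) = 1 + - \<theta>" using k by (simp add: of_nat_diff algebra_simps)
      have "U i powr (1 - \<gamma> / \<alpha>) * U i powr (\<theta> * (k - 1)) = U i powr (1 + - \<theta>)"
        by (simp only: powr_add[symmetric] e)
      also have "\<dots> = U i * U i powr - \<theta>" using Ui by (subst powr_add) simp
      finally show ?thesis .
    qed
    ultimately have "B = (Cg * C0 powr (\<gamma> / \<alpha>) * \<kappa> powr \<gamma>) * (U i * U i powr - \<theta>) * (\<Prod>j\<in>set js'. U j powr - \<theta>)"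
      unfolding B_def P\<gamma> by (simp add: mult_ac)
    moreover have "(\<Prod>j\<le>k. U j) = U i * (\<Prod>j\<in>?I. U j)"
      using js'(4) by (intro prod.remove) auto
    moreover have "(\<Prod>j\<in>{..k} - {r}. U j powr - \<theta>) = U i powr - \<theta> * (\<Prod>j\<in>set js'. U j powr - \<theta>)"
      unfolding js'(7) using js'(4,5) prod.remove[of "{..k} - {r}" i "\<lambda>j. U j powr - \<theta>"]
      by (simp add: Diff_insert2[symmetric] insert_commute)
    ultimately show ?thesis by (simp add: mult_ac)
  qed
  finally show ?thesis
    by (simp only: G_def a_def[abs_def] Cg_def \<theta>_def \<kappa>_def) (simp add: mult_right_mono)
qed

text \<open>The pieces belonging to the greedy orderings at \<open>r\<close> cover everything.
  \<open>C\<close> serves all \<open>r\<close> at once, so the base vertex may later depend on the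
  sizes \<open>U j\<close>. These are majorants rather than the measures themselves, because they
  have to be positive and will be regularised.\<close>

lemma restricted_bound:
  fixes \<gamma> \<alpha> :: real
  assumes \<gamma>: "0 < \<gamma>" "\<gamma> < \<alpha>" and cond: "ellipsoid_condition \<mu> k \<alpha>"
  obtains C where "0 < C" "\<And>E U r. r \<le> k \<Longrightarrow> (\<And>j. j \<le> k \<Longrightarrow> E j \<in> sets \<mu>) \<Longrightarrow> (\<And>j. j \<le> k \<Longrightarrow> 0 < U j) \<Longrightarrow>
    (\<And>j. j \<le> k \<Longrightarrow> emeasure \<mu> (E j) \<le> ennreal (U j)) \<Longrightarrow>
    (\<integral>\<^sup>+y. (\<Prod>j\<le>k. indicator (E j) (y j)) * ennreal (simplex_det k y powr - \<gamma>) \<partial>N)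
    \<le> ennreal (C * (\<Prod>j\<le>k. U j) * (\<Prod>j\<in>{..k} - {r}. U j powr - (\<gamma> / (real k * \<alpha>))))"
proof -
  obtain C' where "C' \<ge> 0" and C': "\<And>x0 W l. orthonormal_basis W \<Longrightarrow>
        emeasure \<mu> (ellipsoid x0 W l) \<le> ennreal C' * ennreal_powr (ellipsoid_content k W l) \<alpha>"
    using cond unfolding ellipsoid_condition_def by blast
  define C0 where "C0 = C' + 1"
  have C0: "0 < C0" using \<open>C' \<ge> 0\<close> by (simp add: C0_def)
  have ell: "emeasure \<mu> (ellipsoid x0 W l) \<le> ennreal C0 * ennreal_powr (ellipsoid_content k W l) \<alpha>"
    if "orthonormal_basis W" for x0 W l
    by (rule order_trans[OF C'[OF that]]) (auto intro!: mult_right_mono ennreal_leI simp: C0_def)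
  define C1 where "C1 = (1 + 2 powr \<gamma> / (1 - 2 powr - (\<alpha> - \<gamma>))) * C0 powr (\<gamma> / \<alpha>) * (sqrt k ^ k) powr \<gamma>"
  have "2 powr - (\<alpha> - \<gamma>) < (1::real)" using \<gamma> by (simp add: powr_less_one)
  then have C1: "0 < C1" using C0 k by (simp add: C1_def add_pos_nonneg)
  \<comment> \<open>The maximum over all base vertices makes the constant uniform; the added 1 makes
    it positive.\<close>
  define M where "M = Max ((\<lambda>r. card (orders r)) ` {..k}) + 1"
  show ?thesis
  proof (rule that[of "real M * C1"])
    show "0 < real M * C1" using C1 by (simp add: M_def)
    fix E :: "nat \<Rightarrow> 'a set" and U :: "nat \<Rightarrow> real" and r
    assume r: "r \<le> k" and E: "\<And>j. j \<le> k \<Longrightarrow> E j \<in> sets \<mu>" and U: "\<And>j. j \<le> k \<Longrightarrow> 0 < U j"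
      and EU: "\<And>j. j \<le> k \<Longrightarrow> emeasure \<mu> (E j) \<le> ennreal (U j)"
    define a where "a j = U j powr - (1 / (real k * \<alpha>))" for j
    define Q where "Q = (\<Prod>j\<le>k. U j) * (\<Prod>j\<in>{..k} - {r}. U j powr - (\<gamma> / (real k * \<alpha>)))"
    have Q: "0 \<le> Q" unfolding Q_def using U by (intro mult_nonneg_nonneg prod_nonneg) (auto simp: less_imp_le)
    have Em [measurable]: "E j \<in> sets borel" if "j \<le> k" for j using E[OF that] sets_mu by simp
    define H where "H js y = (\<Prod>j\<le>k. indicator (E j) (y j)) *
      (indicator {y. greedy_at a r js y} y * ennreal (simplex_det k y powr - \<gamma>))" for js y
    have Hm: "H js \<in> borel_measurable N" if "js \<in> orders r" for js
    proof -
      have [measurable]: "Measurable.pred N (greedy_at a r js)" by (rule pred_greedy_at[OF r that])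
      have "H js = (\<lambda>y. (\<Prod>j\<le>k. indicator (E j) (y j)) * ((if greedy_at a r js y then 1 else 0) * ennreal (simplex_det k y powr - \<gamma>)))"
        by (auto simp: H_def indicator_def)
      then show ?thesis by simp
    qed
    have "(\<integral>\<^sup>+y. (\<Prod>j\<le>k. indicator (E j) (y j)) * ennreal (simplex_det k y powr - \<gamma>) \<partial>N)
       \<le> (\<integral>\<^sup>+y. (\<Sum>js\<in>orders r. H js y) \<partial>N)"
    proof (rule nn_integral_mono)
      fix y
      obtain js where js: "js \<in> orders r" "greedy_at a r js y" using ex_greedy_order by blast
      then have "(\<Prod>j\<le>k. indicator (E j) (y j)) * ennreal (simplex_det k y powr - \<gamma>) = H js y"
        by (simp add: H_def)
      also have "\<dots> \<le> (\<Sum>js\<in>orders r. H js y)"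
        by (rule member_le_sum[OF js(1)]) (auto simp: finite_orders)
      finally show "(\<Prod>j\<le>k. indicator (E j) (y j)) * ennreal (simplex_det k y powr - \<gamma>) \<le> (\<Sum>js\<in>orders r. H js y)" .
    qed
    also have "\<dots> = (\<Sum>js\<in>orders r. integral\<^sup>N N (H js))"
      by (rule nn_integral_sum) (rule Hm)
    also have "\<dots> \<le> (\<Sum>js\<in>orders r. ennreal (C1 * Q))"
    proof (rule sum_mono)
      fix js assume js: "js \<in> orders r"
      show "integral\<^sup>N N (H js) \<le> ennreal (C1 * Q)"
        using greedy_piece_bound[OF \<gamma> C0 ell r js, of E U] E U EU
        by (simp add: H_def[abs_def] a_def[abs_def] C1_def Q_def mult_ac)
    qed
    also have "\<dots> = ennreal (card (orders r) * (C1 * Q))"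
      using C1 Q by (simp add: ennreal_of_nat_eq_real_of_nat ennreal_mult)
    also have "\<dots> \<le> ennreal (real M * (C1 * Q))"
    proof (intro ennreal_leI mult_right_mono)
      have "card (orders r) \<le> Max ((\<lambda>r. card (orders r)) ` {..k})"
        by (rule Max_ge) (use r in auto)
      then show "real (card (orders r)) \<le> real M" by (simp add: M_def)
    qed (use C1 Q in auto)
    finally show "(\<integral>\<^sup>+y. (\<Prod>j\<le>k. indicator (E j) (y j)) * ennreal (simplex_det k y powr - \<gamma>) \<partial>N)
      \<le> ennreal (real M * C1 * (\<Prod>j\<le>k. U j) * (\<Prod>j\<in>{..k} - {r}. U j powr - (\<gamma> / (real k * \<alpha>))))"
      by (simp add: Q_def mult_ac)
  qed
qed

end

section \<open>Summation over dyadic levels\<close>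

text \<open>Two geometric tails, one on each side of the gap between \<open>a\<close> and
  \<open>a + 1\<close>; the shift by 1 in the right tail lets both start with exponent 0.\<close>

lemma nn_integral_count_space_int_le:
  fixes g :: "int \<Rightarrow> real"
  assumes "0 \<le> p" "p < 1"
    and "\<And>m. m \<le> a \<Longrightarrow> g m \<le> p ^ nat (a - m)" "\<And>m. a < m \<Longrightarrow> g m \<le> p ^ nat (m - a - 1)"
  shows "(\<integral>\<^sup>+m. ennreal (g m) \<partial>count_space UNIV) \<le> ennreal (2 / (1 - p))"
proof -
  have geo: "(\<integral>\<^sup>+n. ennreal (p ^ n) \<partial>count_space UNIV) = ennreal (1 / (1 - p))"
  proof -
    have "(\<integral>\<^sup>+n. ennreal (p ^ n) \<partial>count_space UNIV) = (\<Sum>n. ennreal (p ^ n))" by (rule nn_integral_count_space_nat)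
    also have "\<dots> = ennreal (\<Sum>n. p ^ n)" by (rule suminf_ennreal2) (use assms in \<open>auto intro: summable_geometric\<close>)
    finally show ?thesis using assms by (simp add: suminf_geometric)
  qed
  have bij1: "bij_betw (\<lambda>n. a - int n) UNIV {..a}"
    by (rule bij_betwI[where g = "\<lambda>m. nat (a - m)"]) auto
  have bij2: "bij_betw (\<lambda>n. a + 1 + int n) UNIV {a<..}"
    by (rule bij_betwI[where g = "\<lambda>m. nat (m - a - 1)"]) auto
  have "(\<integral>\<^sup>+m. ennreal (g m) \<partial>count_space UNIV)
     \<le> (\<integral>\<^sup>+m. ennreal (p ^ nat (a - m)) * indicator {..a} m + ennreal (p ^ nat (m - a - 1)) * indicator {a<..} m \<partial>count_space UNIV)"
  proof (rule nn_integral_mono)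
    fix m show "ennreal (g m) \<le> ennreal (p ^ nat (a - m)) * indicator {..a} m + ennreal (p ^ nat (m - a - 1)) * indicator {a<..} m"
      using assms(3)[of m] assms(4)[of m] by (cases "m \<le> a") (auto simp: ennreal_leI)
  qed
  also have "\<dots> = (\<integral>\<^sup>+m. ennreal (p ^ nat (a - m)) * indicator {..a} m \<partial>count_space UNIV)
     + (\<integral>\<^sup>+m. ennreal (p ^ nat (m - a - 1)) * indicator {a<..} m \<partial>count_space UNIV)"
    by (rule nn_integral_add) auto
  also have "(\<integral>\<^sup>+m. ennreal (p ^ nat (a - m)) * indicator {..a} m \<partial>count_space UNIV) = ennreal (1 / (1 - p))"
    using nn_integral_bij_count_space[OF bij1, of "\<lambda>m. ennreal (p ^ nat (a - m))"] geo
    by (simp add: nn_integral_count_space_indicator[of "{..a}"])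
  also have "(\<integral>\<^sup>+m. ennreal (p ^ nat (m - a - 1)) * indicator {a<..} m \<partial>count_space UNIV) = ennreal (1 / (1 - p))"
    using nn_integral_bij_count_space[OF bij2, of "\<lambda>m. ennreal (p ^ nat (m - a - 1))"] geo
    by (simp add: nn_integral_count_space_indicator[of "{a<..}"])
  also have "ennreal (1 / (1 - p)) + ennreal (1 / (1 - p)) = ennreal (2 / (1 - p))"
    using assms by (subst ennreal_plus[symmetric]) auto
  finally show ?thesis .
qed

lemma geometric_decay:
  fixes U :: "int \<Rightarrow> real"
  assumes "\<And>n. U (n + 1) \<le> q * U n" "0 < q"
  shows "U (m + int d) \<le> q ^ d * U m"
proof (induction d)
  case (Suc d)
  have "U (m + int (Suc d)) \<le> q * U (m + int d)" using assms(1)[of "m + int d"] by (simp add: add_ac)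
  also have "\<dots> \<le> q * (q ^ d * U m)" using Suc assms(2) by (intro mult_left_mono) auto
  finally show ?case by (simp add: mult_ac)
qed simp

text \<open>For positive arguments this is exp(-|ln a - ln b|), a kernel that decays with the
  logarithmic distance of the two sizes.\<close>

definition min_ratio :: "real \<Rightarrow> real \<Rightarrow> real" where
  "min_ratio a b = min (a / b) (b / a)"

lemma min_ratio_nonneg: "0 < a \<Longrightarrow> 0 < b \<Longrightarrow> 0 \<le> min_ratio a b"
  by (simp add: min_ratio_def)

text \<open>\<open>U\<close> decreases at a geometric rate and therefore passes \<open>b\<close>
  between two consecutive indices; away from there the ratio gains a factor \<open>q\<close> per
  step. The bound is uniform in \<open>b\<close> and \<open>U\<close>.\<close>

lemma sum_min_ratio_le:
  fixes U :: "int \<Rightarrow> real"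
  assumes U: "\<And>n. 0 < U n" "\<And>n. U (n + 1) \<le> q * U n" and q: "0 < q" "q < 1" and "0 < c" "0 < b"
  shows "(\<integral>\<^sup>+m. ennreal (min_ratio (U m) b powr c) \<partial>count_space UNIV) \<le> ennreal (2 / (1 - q powr c))"
proof -
  have decay: "U (m + int d) \<le> q ^ d * U m" for m d using geometric_decay[of U q] U(2) q by blast
  obtain d1 where d1: "q ^ d1 < b / U 0" using real_arch_pow_inv[of "b / U 0" q] q U \<open>0 < b\<close> by auto
  obtain d2 where d2: "q ^ d2 < U 0 / b" using real_arch_pow_inv[of "U 0 / b" q] q U \<open>0 < b\<close> by auto
  have lo: "U (int d1) < b"
    using decay[of 0 d1] d1 U(1)[of 0] by (simp add: field_simps)
  have hi: "b \<le> U (- int d2)"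
  proof -
    have "b * q ^ d2 \<le> U 0" using d2 \<open>0 < b\<close> by (simp add: field_simps)
    also have "U 0 \<le> q ^ d2 * U (- int d2)" using decay[of "- int d2" d2] by simp
    finally show ?thesis using q by (simp add: mult.commute)
  qed
  \<comment> \<open>\<open>U\<close> is at least \<open>b\<close> at \<open>- int d2\<close> and
    below \<open>b\<close> at \<open>int d1\<close>, so a crossing occurs in between.\<close>
  obtain a where a: "b \<le> U a" "U (a + 1) < b"
  proof (rule ccontr)
    assume "\<not> thesis"
    then have step: "\<And>a. b \<le> U a \<Longrightarrow> b \<le> U (a + 1)" using that by (meson not_le)
    have "b \<le> U (- int d2 + int n)" for n
    proof (induction n)
      case (Suc n)
      then show ?case using step[of "- int d2 + int n"] by (simp add: add_ac)
    qed (use hi in simp)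
    from this[of "d2 + d1"] show False using lo by simp
  qed
  show ?thesis
  proof (rule nn_integral_count_space_int_le)
    show "0 \<le> q powr c" "q powr c < 1" using q \<open>0 < c\<close> powr_less_mono2[of c q 1] by auto
    have pp: "x powr c \<le> (q powr c) ^ d" if "0 \<le> x" "x \<le> q ^ d" for x d
    proof -
      have "x powr c \<le> (q ^ d) powr c" using that \<open>0 < c\<close> by (intro powr_mono2) auto
      then show ?thesis using q by (simp add: powr_power powr_realpow[symmetric] powr_powr mult.commute)
    qed
    fix m
    have U0: "0 < U m" by (rule U)
    show "min_ratio (U m) b powr c \<le> (q powr c) ^ nat (a - m)" if "m \<le> a"
    proof (rule pp)
      have "U a \<le> q ^ nat (a - m) * U m" using decay[of m "nat (a - m)"] that by simp
      then have "b / U m \<le> q ^ nat (a - m)" using a(1) U0 by (simp add: field_simps)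
      then show "min_ratio (U m) b \<le> q ^ nat (a - m)" by (simp add: min_ratio_def)
    qed (use U0 \<open>0 < b\<close> in \<open>simp add: min_ratio_nonneg\<close>)
    show "min_ratio (U m) b powr c \<le> (q powr c) ^ nat (m - a - 1)" if "a < m"
    proof (rule pp)
      have "U m \<le> q ^ nat (m - a - 1) * U (a + 1)" using decay[of "a + 1" "nat (m - a - 1)"] that by simp
      also have "\<dots> \<le> q ^ nat (m - a - 1) * b" using a(2) q by (intro mult_left_mono) auto
      finally have "U m / b \<le> q ^ nat (m - a - 1)" using \<open>0 < b\<close> by (simp add: field_simps)
      then show "min_ratio (U m) b \<le> q ^ nat (m - a - 1)" by (simp add: min_ratio_def)
    qed (use U0 \<open>0 < b\<close> in \<open>simp add: min_ratio_nonneg\<close>)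
  qed
qed

text \<open>The measures of the level sets are replaced by majorants with geometric decay. Otherwise many levels
  of equal measure would make the sum of the ratio kernel over the levels diverge.\<close>

lemma ex_regularization:
  fixes \<xi> :: "int \<Rightarrow> real" and p :: real
  assumes \<xi>: "\<And>n. 0 \<le> \<xi> n" "(\<integral>\<^sup>+n. ennreal (\<xi> n) \<partial>count_space UNIV) \<le> 1" and p: "1 \<le> p"
  shows "\<exists>U :: int \<Rightarrow> real. (\<forall>n. 0 < U n \<and> U (n + 1) \<le> 2 powr - (1/2) * U n \<and> 2 powr (- n * p) * \<xi> n \<le> U n) \<and>
    (\<integral>\<^sup>+n. ennreal (2 powr (n * p) * U n) \<partial>count_space UNIV) \<le> ennreal (5 / (1 - 2 powr - (1/2)))"
proof -
  define q where "q = (2::real) powr - (1/2)"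
  have q: "0 < q" "q < 1" by (auto simp: q_def powr_less_one)
  \<comment> \<open>The added term makes every entry positive; its sum is at most 4, whence the
    total 5.\<close>
  define \<zeta> where "\<zeta> n = \<xi> n + (1/2) ^ nat \<bar>n\<bar>" for n
  have \<zeta>pos: "0 < \<zeta> n" for n using \<xi>(1)[of n] by (simp add: \<zeta>_def add_nonneg_pos)
  have sum\<zeta>: "(\<integral>\<^sup>+n. ennreal (\<zeta> n) \<partial>count_space UNIV) \<le> 5"
  proof -
    have "(\<integral>\<^sup>+n. ennreal ((1/2) ^ nat \<bar>n\<bar>) \<partial>count_space (UNIV::int set)) \<le> ennreal (2 / (1 - 1/2))"
      by (rule nn_integral_count_space_int_le[where a = 0]) (auto intro: power_decreasing)
    then have "(\<integral>\<^sup>+n. ennreal (\<xi> n) \<partial>count_space UNIV) + (\<integral>\<^sup>+n. ennreal ((1/2) ^ nat \<bar>n\<bar>) \<partial>count_space (UNIV::int set)) \<le> 1 + 4"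
      by (intro add_mono \<xi>(2)) simp
    moreover have "(\<integral>\<^sup>+n. ennreal (\<zeta> n) \<partial>count_space UNIV)
       = (\<integral>\<^sup>+n. ennreal (\<xi> n) \<partial>count_space UNIV) + (\<integral>\<^sup>+n. ennreal ((1/2) ^ nat \<bar>n\<bar>) \<partial>count_space (UNIV::int set))"
      unfolding \<zeta>_def using \<xi>(1) by (subst nn_integral_add[symmetric]) (auto simp: ennreal_plus)
    ultimately show ?thesis by simp
  qed
  have \<zeta>le: "\<zeta> n \<le> 5" for n
  proof -
    have "ennreal (\<zeta> n) \<le> (\<integral>\<^sup>+n. ennreal (\<zeta> n) \<partial>count_space UNIV)" by (rule nn_integral_ge_point) simp
    then have "ennreal (\<zeta> n) \<le> ennreal 5" using sum\<zeta> by simp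
    then show ?thesis by (subst (asm) ennreal_le_iff) auto
  qed
  \<comment> \<open>With \<open>h m = 2 powr (- m * p) * \<zeta> m\<close>, the enlarged measure of
    level m, \<open>s n l\<close> is \<open>2 powr (l / 2) * h (n + l)\<close>. So
    \<open>U n\<close> is the sum of \<open>2 powr ((m - n) / 2) * h m\<close> over m \<ge> n, and
    passing to n + 1 drops one term and multiplies the others by
    \<open>2 powr - (1/2)\<close>.\<close>
  define s where "s n l = 2 powr (- n * p) * (2 powr (1/2 - p)) ^ l * \<zeta> (n + int l)" for n :: int and l
  \<comment> \<open>Here p \<ge> 1 enters: the weighted sums are dominated by geometric series of
    ratio \<open>q\<close>.\<close>
  have r: "0 < 2 powr (1/2 - p)" "2 powr (1/2 - p) \<le> q" using p by (auto simp: q_def intro!: powr_mono)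
  have spos: "0 < s n l" for n l using \<zeta>pos r by (simp add: s_def)
  have sle: "s n l \<le> 2 powr (- n * p) * 5 * q ^ l" for n l
  proof -
    have "(2 powr (1/2 - p)) ^ l * \<zeta> (n + int l) \<le> q ^ l * 5"
    proof (rule mult_mono[OF power_mono \<zeta>le])
      show "0 \<le> q ^ l" using q(1) by simp
    qed (use r \<zeta>pos[of "n + int l"] in auto)
    then show ?thesis by (simp add: s_def mult_ac)
  qed
  have summ: "summable (s n)" for n
    by (rule summable_comparison_test_ev[OF _ summable_mult[OF summable_geometric[of q], of "2 powr (- n * p) * 5"]])
      (use q sle spos in \<open>auto simp: abs_of_pos\<close>)
  define U where "U n = (\<Sum>l. s n l)" for n
  have U1: "s n 0 \<le> U n" for n
    unfolding U_def using sum_le_suminf[OF summ, of "{0}" n] spos less_imp_le by auto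
  have Upos: "0 < U n" for n using U1[of n] spos[of n 0] by linarith
  have U2: "U (n + 1) \<le> q * U n" for n
  proof -
    have eq: "s (n + 1) l = q * s n (Suc l)" for l
    proof -
      have "2 powr (- (real_of_int (n + 1)) * p) = q * (2 powr (- real_of_int n * p) * 2 powr (1/2 - p))"
        unfolding q_def by (simp add: algebra_simps flip: powr_add)
      then show ?thesis by (simp add: s_def add_ac mult_ac)
    qed
    have "U (n + 1) = q * (\<Sum>l. s n (Suc l))"
      unfolding U_def eq by (rule suminf_mult) (use summ[of n] in \<open>simp add: summable_Suc_iff\<close>)
    also have "(\<Sum>l. s n (Suc l)) = U n - s n 0"
      unfolding U_def by (rule suminf_split_head[OF summ])
    also have "q * (U n - s n 0) \<le> q * U n" using spos[of n 0] q by simp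
    finally show ?thesis .
  qed
  have U3: "2 powr (- n * p) * \<xi> n \<le> U n" for n
  proof -
    have "2 powr (- n * p) * \<xi> n \<le> s n 0" by (simp add: s_def \<zeta>_def)
    then show ?thesis using U1[of n] by simp
  qed
  have "(\<integral>\<^sup>+n. ennreal (2 powr (n * p) * U n) \<partial>count_space UNIV)
      = (\<integral>\<^sup>+n. (\<Sum>l. ennreal ((2 powr (1/2 - p)) ^ l) * ennreal (\<zeta> (n + int l))) \<partial>count_space UNIV)"
  proof (rule nn_integral_cong)
    fix n
    have "2 powr (n * p) * s n l = (2 powr (1/2 - p)) ^ l * \<zeta> (n + int l)" for l
      by (simp add: s_def mult.assoc[symmetric] flip: powr_add)
    then have eqU: "2 powr (n * p) * U n = (\<Sum>l. (2 powr (1/2 - p)) ^ l * \<zeta> (n + int l))"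
      unfolding U_def using suminf_mult[OF summ[of n], of "2 powr (n * p)"] by simp
    have sm: "summable (\<lambda>l. (2 powr (1/2 - p)) ^ l * \<zeta> (n + int l))"
      using summable_mult[OF summ[of n], of "2 powr (n * p)"]
      by (simp add: \<open>\<And>l. 2 powr (n * p) * s n l = (2 powr (1/2 - p)) ^ l * \<zeta> (n + int l)\<close>)
    show "ennreal (2 powr (n * p) * U n) = (\<Sum>l. ennreal ((2 powr (1/2 - p)) ^ l) * ennreal (\<zeta> (n + int l)))"
    proof (subst ennreal_mult[symmetric])
      show "0 \<le> \<zeta> (n + int l)" for l using \<zeta>pos by (rule less_imp_le)
      then show "ennreal (2 powr (n * p) * U n) = (\<Sum>l. ennreal ((2 powr (1/2 - p)) ^ l * \<zeta> (n + int l)))"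
        using eqU sm by (subst suminf_ennreal2) auto
    qed simp
  qed
  also have "\<dots> = (\<Sum>l. ennreal ((2 powr (1/2 - p)) ^ l) * (\<integral>\<^sup>+n. ennreal (\<zeta> (n + int l)) \<partial>count_space UNIV))"
    by (simp add: nn_integral_suminf nn_integral_cmult)
  also have "\<dots> \<le> (\<Sum>l. ennreal (q ^ l * 5))"
  proof (rule suminf_le)
    fix l
    have "bij_betw (\<lambda>n. n + int l) UNIV UNIV"
      by (rule bij_betwI[where g = "\<lambda>n. n - int l"]) auto
    then have "(\<integral>\<^sup>+n. ennreal (\<zeta> (n + int l)) \<partial>count_space UNIV) = (\<integral>\<^sup>+n. ennreal (\<zeta> n) \<partial>count_space UNIV)"
      by (rule nn_integral_bij_count_space)
    then have "ennreal ((2 powr (1/2 - p)) ^ l) * (\<integral>\<^sup>+n. ennreal (\<zeta> (n + int l)) \<partial>count_space UNIV) \<le> ennreal (q ^ l) * ennreal 5"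
      using sum\<zeta> r by (intro mult_mono ennreal_leI power_mono) auto
    then show "ennreal ((2 powr (1/2 - p)) ^ l) * (\<integral>\<^sup>+n. ennreal (\<zeta> (n + int l)) \<partial>count_space UNIV) \<le> ennreal (q ^ l * 5)"
      using q by (simp add: ennreal_mult)
  qed auto
  also have "\<dots> = ennreal (\<Sum>l. q ^ l * 5)"
    by (rule suminf_ennreal2) (use q in \<open>auto intro!: summable_mult2 summable_geometric\<close>)
  also have "(\<Sum>l. q ^ l * 5) = 5 / (1 - q)"
    using q by (simp add: suminf_mult2[symmetric] summable_geometric suminf_geometric)
  finally show ?thesis using Upos U2 U3 unfolding q_def by (intro exI[of _ U]) auto
qed

text \<open>With \<open>m\<close> the largest \<open>x j\<close> the product is at most
  \<open>m powr (sum b J)\<close>; since m \<le> 1 and the total exponent is at least 1, this is at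
  most \<open>m\<close>.\<close>

lemma prod_powr_le_sum:
  fixes x b :: "nat \<Rightarrow> real"
  assumes "finite J" "J \<noteq> {}" "\<And>j. j \<in> J \<Longrightarrow> 0 \<le> x j \<and> x j \<le> 1" "\<And>j. j \<in> J \<Longrightarrow> 0 \<le> b j" "1 \<le> sum b J"
  shows "(\<Prod>j\<in>J. x j powr b j) \<le> sum x J"
proof -
  define m where "m = Max (x ` J)"
  have "m \<in> x ` J" unfolding m_def using assms by (intro Max_in) auto
  then obtain i where i: "i \<in> J" "m = x i" by auto
  have mge: "x j \<le> m" if "j \<in> J" for j unfolding m_def using assms that by (intro Max_ge) auto
  have "(\<Prod>j\<in>J. x j powr b j) \<le> (\<Prod>j\<in>J. m powr b j)"
    by (intro prod_mono conjI powr_mono2) (use assms mge in auto)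
  also have "\<dots> \<le> m"
  proof (cases "m = 0")
    case True
    moreover have "card J \<noteq> 0" using assms by simp
    ultimately show ?thesis by (simp add: power_0_left)
  next
    case False
    then have m: "0 < m" "m \<le> 1" using i assms(3)[of i] by auto
    have "(\<Prod>j\<in>J. m powr b j) = m powr (sum b J)"
      using m by (simp add: powr_sum)
    also have "\<dots> \<le> m powr 1" using m assms(5) by (intro powr_mono') auto
    finally show ?thesis using m by simp
  qed
  also have "m \<le> sum x J" unfolding i(2) by (rule member_le_sum) (use i assms in auto)
  finally show ?thesis .
qed

text \<open>The restricted bound at the optimal vertex \<open>r\<close> of the exponent polytope beats the bound with
  exponents \<open>1 - \<theta> j\<close> by a power of the ratio of the smallest and largest of the \<open>U j\<close>.\<close>

lemma off_diagonal_decay: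
  fixes z U \<theta> :: "nat \<Rightarrow> real" and t w C0 :: real
  assumes k: "1 \<le> k" and U: "\<And>j. j \<le> k \<Longrightarrow> 0 < U j" and z: "\<And>j. j \<le> k \<Longrightarrow> 0 < z j"
    and r: "r \<le> k" "\<And>j. j \<le> k \<Longrightarrow> U r \<le> U j"
    and \<theta>: "\<And>j. j \<le> k \<Longrightarrow> 0 \<le> \<theta> j" "\<And>j. j \<le> k \<Longrightarrow> \<theta> j + w \<le> t" "(\<Sum>j\<le>k. \<theta> j) = k * t" and "0 < w" "t < 1"
    and C0: "1 \<le> C0" "\<And>j. j \<le> k \<Longrightarrow> z j powr (1 / (1 - \<theta> j)) * U j \<le> C0"
  shows "(\<Prod>j\<le>k. z j) * (\<Prod>j\<le>k. U j) * (\<Prod>j\<in>{..k} - {r}. U j powr - t)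
    \<le> C0 ^ (k + 1) * (\<Sum>l\<le>k. (z l powr (1 / (1 - \<theta> l)) * U l) * (\<Prod>j\<in>{..k} - {l}. min_ratio (U j) (U l) powr (w / k)))"
proof -
  \<comment> \<open>The share of level \<open>z j\<close> in the integral of the power 1 / (1 -
    \<theta> j). The bound is rewritten in terms of these shares and of ratios of the
    \<open>U j\<close>.\<close>
  define x where "x j = z j powr (1 / (1 - \<theta> j)) * U j" for j
  have xpos: "0 < x j" if "j \<le> k" for j using U[OF that] z[OF that] by (simp add: x_def)
  have \<theta>1: "0 < 1 - \<theta> j" if "j \<le> k" for j using \<theta>(2)[OF that] \<open>0 < w\<close> \<open>t < 1\<close> by simp
  have zx: "z j * U j = x j powr (1 - \<theta> j) * U j powr \<theta> j" if "j \<le> k" for j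
  proof -
    have "x j powr (1 - \<theta> j) = z j * U j powr (1 - \<theta> j)"
      unfolding x_def using U[OF that] z[OF that] \<theta>1[OF that] by (simp add: powr_mult powr_powr)
    then have "x j powr (1 - \<theta> j) * U j powr \<theta> j = z j * U j powr ((1 - \<theta> j) + \<theta> j)"
      by (simp only: powr_add mult.assoc)
    then show ?thesis using U[OF that] by simp
  qed
  define X where "X = (\<Prod>j\<le>k. x j powr (1 - \<theta> j))"
  have X0: "0 \<le> X" unfolding X_def by (intro prod_nonneg) simp
  \<comment> \<open>(k + 1) t - k t = t: so \<open>U r powr t\<close> can be distributed over all
    indices, which turns the rest into ratios \<open>U r / U j\<close>.\<close>
  have sum_t: "(\<Sum>j\<le>k. t - \<theta> j) = t"
    using \<theta>(3) by (simp add: sum_subtractf algebra_simps)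
  have "(\<Prod>j\<le>k. U j powr \<theta> j) * (\<Prod>j\<in>{..k} - {r}. U j powr - t) = U r powr t * (\<Prod>j\<le>k. U j powr (\<theta> j - t))"
  proof -
    have "(\<Prod>j\<le>k. U j powr (\<theta> j - t)) = (\<Prod>j\<le>k. U j powr \<theta> j) * (\<Prod>j\<le>k. U j powr - t)"
      unfolding prod.distrib[symmetric] by (rule prod.cong) (auto simp flip: powr_add)
    also have "(\<Prod>j\<le>k. U j powr - t) = U r powr - t * (\<Prod>j\<in>{..k} - {r}. U j powr - t)"
      using r by (intro prod.remove) auto
    finally have "U r powr t * (\<Prod>j\<le>k. U j powr (\<theta> j - t))
       = (U r powr t * U r powr - t) * ((\<Prod>j\<le>k. U j powr \<theta> j) * (\<Prod>j\<in>{..k} - {r}. U j powr - t))" by simp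
    moreover have "U r powr t * U r powr - t = 1" using U[OF r(1)] by (simp add: powr_minus)
    ultimately show ?thesis by simp
  qed
  also have "U r powr t = (\<Prod>j\<le>k. U r powr (t - \<theta> j))"
    using U[OF r(1)] sum_t by (simp add: powr_sum[symmetric])
  also have "(\<Prod>j\<le>k. U r powr (t - \<theta> j)) * (\<Prod>j\<le>k. U j powr (\<theta> j - t)) = (\<Prod>j\<le>k. (U r / U j) powr (t - \<theta> j))"
    unfolding prod.distrib[symmetric]
  proof (rule prod.cong)
    fix j assume "j \<in> {..k}"
    then have "(U r / U j) powr (t - \<theta> j) = U r powr (t - \<theta> j) / U j powr (t - \<theta> j)"
      by (intro powr_divide)
    also have "\<dots> = U r powr (t - \<theta> j) * U j powr (- (t - \<theta> j))"
      by (simp add: powr_minus divide_inverse del: minus_diff_eq)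
    finally show "U r powr (t - \<theta> j) * U j powr (\<theta> j - t) = (U r / U j) powr (t - \<theta> j)" by simp
  qed simp
  finally have *: "(\<Prod>j\<le>k. U j powr \<theta> j) * (\<Prod>j\<in>{..k} - {r}. U j powr - t) = (\<Prod>j\<le>k. (U r / U j) powr (t - \<theta> j))" .
  have eq: "(\<Prod>j\<le>k. z j) * (\<Prod>j\<le>k. U j) * (\<Prod>j\<in>{..k} - {r}. U j powr - t) = X * (\<Prod>j\<le>k. (U r / U j) powr (t - \<theta> j))"
  proof -
    have "(\<Prod>j\<le>k. z j) * (\<Prod>j\<le>k. U j) = (\<Prod>j\<le>k. x j powr (1 - \<theta> j) * U j powr \<theta> j)"
      unfolding prod.distrib[symmetric] by (rule prod.cong) (auto simp: zx)
    also have "\<dots> = X * (\<Prod>j\<le>k. U j powr \<theta> j)" by (simp add: X_def prod.distrib)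
    finally show ?thesis using * by (simp add: mult.assoc)
  qed
  define M where "M = Max (U ` {..k})"
  have "M \<in> U ` {..k}" unfolding M_def by (intro Max_in) auto
  then obtain i where i: "i \<le> k" "M = U i" by auto
  have Mge: "U j \<le> M" if "j \<le> k" for j unfolding M_def using that by (intro Max_ge) auto
  have Mpos: "0 < M" using i U by simp
  define \<rho> where "\<rho> = U r / M"
  have \<rho>: "0 < \<rho>" "\<rho> \<le> 1" using U[OF r(1)] Mpos Mge[OF r(1)] by (auto simp: \<rho>_def)
  \<comment> \<open>All factors are at most 1 since \<open>U r\<close> is minimal; only that of the
    largest \<open>U i\<close> is kept, and its exponent is at least \<open>w\<close>.\<close>
  have 1: "(\<Prod>j\<le>k. (U r / U j) powr (t - \<theta> j)) \<le> \<rho> powr w"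
  proof -
    have le1: "(U r / U j) powr (t - \<theta> j) \<le> 1" if "j \<le> k" for j
    proof -
      have "(U r / U j) powr (t - \<theta> j) \<le> 1 powr (t - \<theta> j)"
        using that r(2)[of j] U[of j] U[OF r(1)] \<theta>(2)[OF that] \<open>0 < w\<close> by (intro powr_mono2) auto
      then show ?thesis by simp
    qed
    have "(\<Prod>j\<le>k. (U r / U j) powr (t - \<theta> j)) = (U r / U i) powr (t - \<theta> i) * (\<Prod>j\<in>{..k} - {i}. (U r / U j) powr (t - \<theta> j))"
      using i by (intro prod.remove) auto
    also have "\<dots> \<le> (U r / U i) powr (t - \<theta> i) * 1"
      by (intro mult_left_mono prod_le_1) (use le1 in auto)
    also have "\<dots> \<le> \<rho> powr w"
      using \<rho> \<theta>(2)[OF i(1)] unfolding \<rho>_def i(2) by (simp add: powr_mono')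
    finally show ?thesis .
  qed
  \<comment> \<open>\<open>\<rho>\<close> is a lower bound for all ratios, so
    \<open>\<rho> powr w\<close> splits into \<open>k\<close> kernel factors around any centre
    \<open>l\<close>.\<close>
  have 2: "\<rho> powr w \<le> (\<Prod>j\<in>{..k} - {l}. min_ratio (U j) (U l) powr (w / k))" if "l \<le> k" for l
  proof -
    have "\<rho> powr w = (\<Prod>j\<in>{..k} - {l}. \<rho> powr (w / k))"
      using that k \<rho> by (simp add: powr_power)
    also have "\<dots> \<le> (\<Prod>j\<in>{..k} - {l}. min_ratio (U j) (U l) powr (w / k))"
    proof (intro prod_mono conjI powr_mono2)
      fix j assume j: "j \<in> {..k} - {l}"
      have "\<rho> \<le> U a / U b" if "a \<le> k" "b \<le> k" for a b
        unfolding \<rho>_def using r(2)[OF that(1)] Mge[OF that(2)] U[OF that(2)] U[OF r(1)]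
        by (intro frac_le) auto
      then show "\<rho> \<le> min_ratio (U j) (U l)" using j that by (simp add: min_ratio_def)
    qed (use \<rho> \<open>0 < w\<close> k in auto)
    finally show ?thesis .
  qed
  \<comment> \<open>After division by \<open>C0\<close> the shares are at most 1, and the exponents
    1 - \<theta> j sum to k + 1 - k t \<ge> 1. The product of shares is thus replaced by a sum over
    one distinguished index.\<close>
  have 3: "X \<le> C0 ^ (k + 1) * (\<Sum>l\<le>k. x l)"
  proof -
    have xC: "x j \<le> C0" if "j \<le> k" for j using C0(2)[OF that] by (simp add: x_def)
    have "X = (\<Prod>j\<le>k. C0 powr (1 - \<theta> j) * (x j / C0) powr (1 - \<theta> j))"
      unfolding X_def
    proof (rule prod.cong)
      fix j assume "j \<in> {..k}"
      then have "C0 powr (1 - \<theta> j) * (x j / C0) powr (1 - \<theta> j) = (C0 * (x j / C0)) powr (1 - \<theta> j)"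
        using xpos[of j] C0(1) by (subst powr_mult) auto
      then show "x j powr (1 - \<theta> j) = C0 powr (1 - \<theta> j) * (x j / C0) powr (1 - \<theta> j)" using C0(1) by simp
    qed simp
    also have "\<dots> = (\<Prod>j\<le>k. C0 powr (1 - \<theta> j)) * (\<Prod>j\<le>k. (x j / C0) powr (1 - \<theta> j))"
      by (rule prod.distrib)
    also have "\<dots> \<le> (\<Prod>j\<le>k. C0) * (\<Sum>j\<le>k. x j / C0)"
    proof (rule mult_mono)
      show "(\<Prod>j\<le>k. C0 powr (1 - \<theta> j)) \<le> (\<Prod>j\<le>k. C0)"
      proof (intro prod_mono conjI)
        fix j assume "j \<in> {..k}"
        then have "C0 powr (1 - \<theta> j) \<le> C0 powr 1" using C0(1) \<theta>(1)[of j] by (intro powr_mono) auto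
        then show "C0 powr (1 - \<theta> j) \<le> C0" using C0(1) by simp
      qed simp
      show "(\<Prod>j\<le>k. (x j / C0) powr (1 - \<theta> j)) \<le> (\<Sum>j\<le>k. x j / C0)"
      proof (rule prod_powr_le_sum)
        have "k * t \<le> k" using \<open>t < 1\<close> by (simp add: mult_left_le)
        then show "1 \<le> (\<Sum>j\<le>k. 1 - \<theta> j)" using \<theta>(3) by (simp add: sum_subtractf)
      qed (use xpos xC C0(1) \<theta>1 in \<open>auto simp: less_imp_le\<close>)
    qed (use C0(1) in \<open>auto intro!: prod_nonneg\<close>)
    also have "\<dots> \<le> (\<Prod>j\<le>k. C0) * (\<Sum>j\<le>k. x j)"
      using C0(1) xpos by (intro mult_left_mono sum_mono) (auto simp: field_simps less_imp_le intro: mult_right_mono)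
    finally show ?thesis by simp
  qed
  have "X * (\<Prod>j\<le>k. (U r / U j) powr (t - \<theta> j)) \<le> X * \<rho> powr w"
    by (rule mult_left_mono[OF 1 X0])
  also have "\<dots> \<le> (C0 ^ (k + 1) * (\<Sum>l\<le>k. x l)) * \<rho> powr w"
    by (rule mult_right_mono[OF 3]) simp
  also have "\<dots> = C0 ^ (k + 1) * (\<Sum>l\<le>k. x l * \<rho> powr w)" by (simp add: sum_distrib_right mult.assoc)
  also have "\<dots> \<le> C0 ^ (k + 1) * (\<Sum>l\<le>k. x l * (\<Prod>j\<in>{..k} - {l}. min_ratio (U j) (U l) powr (w / k)))"
    using C0(1) xpos by (intro mult_left_mono sum_mono 2) (auto simp: less_imp_le)
  finally show ?thesis unfolding eq x_def by simp
qed

section \<open>Sums over tuples of levels\<close>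

lemma product_sigma_finite_int: "product_sigma_finite (\<lambda>_::nat. count_space (UNIV :: int set))"
  by (simp add: product_sigma_finite_def sigma_finite_measure_count_space_countable)

lemma measurable_count_space_component:
  fixes g :: "int \<Rightarrow> 'b::topological_space"
  shows "j \<in> I \<Longrightarrow> (\<lambda>n. g (n j)) \<in> borel_measurable (Pi\<^sub>M I (\<lambda>_::nat. count_space (UNIV :: int set)))"
  by (rule measurable_compose[OF measurable_component_singleton]) auto

text \<open>The kernel is a star with centre \<open>l\<close>: for fixed \<open>n l\<close> the
  other \<open>k\<close> sums factor, and each is bounded by \<open>sum_min_ratio_le\<close>
  uniformly in the centre. Sums over integer tuples are written as integrals over a product of
  counting measures, so that Tonelli's theorem can interchange them with the integral over
  configurations.\<close>

lemma kernel_sum_le: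
  fixes U :: "nat \<Rightarrow> int \<Rightarrow> real" and x :: "int \<Rightarrow> real"
  assumes l: "l \<le> k"
    and U: "\<And>j n. j \<le> k \<Longrightarrow> 0 < U j n" "\<And>j n. j \<le> k \<Longrightarrow> U j (n + 1) \<le> q * U j n"
    and q: "0 < q" "q < 1" and "0 < c" and C0: "0 \<le> C0"
    and x: "(\<integral>\<^sup>+n. ennreal (x n) \<partial>count_space UNIV) \<le> ennreal C0"
  shows "(\<integral>\<^sup>+n. ennreal (x (n l)) * (\<Prod>j\<in>{..k} - {l}. ennreal (min_ratio (U j (n j)) (U l (n l)) powr c))
      \<partial>Pi\<^sub>M {..k} (\<lambda>_::nat. count_space (UNIV :: int set))) \<le> ennreal (C0 * (2 / (1 - q powr c)) ^ k)"
proof -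
  interpret P: product_sigma_finite "\<lambda>_::nat. count_space (UNIV :: int set)"
    by (rule product_sigma_finite_int)
  let ?I = "{..k} - {l}"
  have I: "insert l ?I = {..k}" using l by auto
  define S where "S = 2 / (1 - q powr c)"
  have "q powr c < 1" using q \<open>0 < c\<close> powr_less_mono2[of c q 1] by auto
  then have S: "0 \<le> S" by (simp add: S_def)
  define h where "h n = ennreal (x (n l)) * (\<Prod>j\<in>?I. ennreal (min_ratio (U j (n j)) (U l (n l)) powr c))" for n
  have hm: "h \<in> borel_measurable (Pi\<^sub>M {..k} (\<lambda>_::nat. count_space (UNIV :: int set)))"
    unfolding h_def min_ratio_def
    using measurable_count_space_component[of l "{..k}" x] measurable_count_space_component[of _ "{..k}" "U _"] l
    by (intro borel_measurable_times_ennreal borel_measurable_prod_ennreal measurable_compose[OF _ measurable_ennreal]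
        powr_real_measurable borel_measurable_const borel_measurable_min borel_measurable_divide) auto
  have "integral\<^sup>N (Pi\<^sub>M {..k} (\<lambda>_::nat. count_space (UNIV :: int set))) h
      = (\<integral>\<^sup>+m. (\<integral>\<^sup>+n. h (n(l := m)) \<partial>Pi\<^sub>M ?I (\<lambda>_. count_space UNIV)) \<partial>count_space UNIV)"
    using P.product_nn_integral_insert_rev[of ?I l h] hm I by simp
  also have "\<dots> = (\<integral>\<^sup>+m. ennreal (x m) * (\<Prod>j\<in>?I. \<integral>\<^sup>+a. ennreal (min_ratio (U j a) (U l m) powr c) \<partial>count_space UNIV) \<partial>count_space UNIV)"
  proof (rule nn_integral_cong)
    fix m
    have "(\<integral>\<^sup>+n. h (n(l := m)) \<partial>Pi\<^sub>M ?I (\<lambda>_. count_space UNIV))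
       = (\<integral>\<^sup>+n. ennreal (x m) * (\<Prod>j\<in>?I. ennreal (min_ratio (U j (n j)) (U l m) powr c)) \<partial>Pi\<^sub>M ?I (\<lambda>_. count_space UNIV))"
      by (rule nn_integral_cong) (auto simp: h_def intro!: arg_cong2[where f = "(*)"] prod.cong)
    also have "\<dots> = ennreal (x m) * (\<integral>\<^sup>+n. (\<Prod>j\<in>?I. ennreal (min_ratio (U j (n j)) (U l m) powr c)) \<partial>Pi\<^sub>M ?I (\<lambda>_. count_space UNIV))"
      by (rule nn_integral_cmult, rule borel_measurable_prod_ennreal, rule measurable_count_space_component)
    also have "(\<integral>\<^sup>+n. (\<Prod>j\<in>?I. ennreal (min_ratio (U j (n j)) (U l m) powr c)) \<partial>Pi\<^sub>M ?I (\<lambda>_. count_space UNIV))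
       = (\<Prod>j\<in>?I. \<integral>\<^sup>+a. ennreal (min_ratio (U j a) (U l m) powr c) \<partial>count_space UNIV)"
      by (rule P.product_nn_integral_prod) auto
    finally show "(\<integral>\<^sup>+n. h (n(l := m)) \<partial>Pi\<^sub>M ?I (\<lambda>_. count_space UNIV))
       = ennreal (x m) * (\<Prod>j\<in>?I. \<integral>\<^sup>+a. ennreal (min_ratio (U j a) (U l m) powr c) \<partial>count_space UNIV)" .
  qed
  also have "\<dots> \<le> (\<integral>\<^sup>+m. ennreal (x m) * (\<Prod>j\<in>?I. ennreal S) \<partial>count_space UNIV)"
  proof (intro nn_integral_mono mult_left_mono prod_mono_ennreal)
    fix m j assume "j \<in> ?I"
    then show "(\<integral>\<^sup>+a. ennreal (min_ratio (U j a) (U l m) powr c) \<partial>count_space UNIV) \<le> ennreal S"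
      unfolding S_def using U[of j] U(1)[OF l] q \<open>0 < c\<close> by (intro sum_min_ratio_le) auto
  qed auto
  also have "\<dots> = (\<integral>\<^sup>+m. ennreal (x m) \<partial>count_space UNIV) * ennreal (S ^ k)"
    using l S by (simp add: nn_integral_multc ennreal_power)
  also have "\<dots> \<le> ennreal C0 * ennreal (S ^ k)" by (intro mult_right_mono x) simp
  also have "\<dots> = ennreal (C0 * S ^ k)" using C0 S by (simp add: ennreal_mult)
  finally show ?thesis by (simp add: h_def[abs_def] S_def)
qed

lemma dyadic_level:
  fixes t :: real
  assumes "0 < t"
  shows "2 powr real_of_int \<lfloor>log 2 t\<rfloor> \<le> t" "t < 2 powr (real_of_int \<lfloor>log 2 t\<rfloor> + 1)"
proof -
  have "1 < (2::real)" by simp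
  then show "2 powr real_of_int \<lfloor>log 2 t\<rfloor> \<le> t"
    by (rule le_log_iff[THEN iffD1, OF _ assms]) simp
  show "t < 2 powr (real_of_int \<lfloor>log 2 t\<rfloor> + 1)"
    by (rule log_less_iff[THEN iffD1, OF \<open>1 < 2\<close> assms]) linarith
qed

lemma dyadic_level_unique:
  fixes t :: real and n :: int
  assumes "2 powr real_of_int n \<le> t" "t < 2 powr (real_of_int n + 1)"
  shows "n = \<lfloor>log 2 t\<rfloor>"
proof -
  have "0 < t" using assms(1) by (rule less_le_trans[rotated]) simp
  then have "real_of_int n \<le> log 2 t" "log 2 t < real_of_int n + 1"
    using assms by (simp_all add: le_log_iff log_less_iff)
  then show ?thesis by (intro floor_unique[symmetric]) auto
qed

context det_setting
begin

text \<open>On each dyadic level \<open>f j\<close> is within a factor 2 of a constant, and every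
  tuple of levels is bounded by the restricted estimate. \<open>off_diagonal_decay\<close> leaves
  star-shaped kernel sums, which are finite because the normalisation of the \<open>f j\<close>
  makes the shares of their levels summable.\<close>

lemma strong_normalized:
  fixes \<gamma> \<alpha> :: real and \<theta> :: "nat \<Rightarrow> real"
  assumes \<gamma>: "0 < \<gamma>" "\<gamma> < \<alpha>" and cond: "ellipsoid_condition \<mu> k \<alpha>"
    and \<theta>: "\<And>j. j \<le> k \<Longrightarrow> 0 \<le> \<theta> j" "\<And>j. j \<le> k \<Longrightarrow> \<theta> j < \<gamma> / (real k * \<alpha>)" "(\<Sum>j\<le>k. \<theta> j) = \<gamma> / \<alpha>"
  obtains C where "0 < C"
    "\<And>f. (\<And>j. j \<le> k \<Longrightarrow> f j \<in> borel_measurable \<mu>) \<Longrightarrow> (\<And>j x. 0 \<le> f j x) \<Longrightarrow>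
      (\<And>j. j \<le> k \<Longrightarrow> (\<integral>\<^sup>+x. ennreal (f j x powr (1 / (1 - \<theta> j))) \<partial>\<mu>) \<le> 1) \<Longrightarrow>
      (\<integral>\<^sup>+y. (\<Prod>j\<le>k. ennreal (f j (y j))) * ennreal (simplex_det k y powr - \<gamma>) \<partial>N) \<le> ennreal C"
proof -
  define t where "t = \<gamma> / (real k * \<alpha>)"
  have kt: "real k * t = \<gamma> / \<alpha>" using k by (simp add: t_def)
  have t: "0 < t" "t < 1"
  proof -
    show "0 < t" using \<gamma> k by (simp add: t_def)
    have "t \<le> real k * t" using k \<open>0 < t\<close> by simp
    also have "\<dots> < 1" using \<gamma> by (simp add: kt)
    finally show "t < 1" .
  qed
  \<comment> \<open>The least slack in the strict inequalities; it becomes the exponent of the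
    off-diagonal gain.\<close>
  define w where "w = Min ((\<lambda>j. t - \<theta> j) ` {..k})"
  have w: "0 < w" unfolding w_def using \<theta>(2) by (subst Min_gr_iff) (auto simp: t_def)
  have w_le: "\<theta> j + w \<le> t" if "j \<le> k" for j
  proof -
    have "w \<le> t - \<theta> j" unfolding w_def using that by (intro Min_le) auto
    then show ?thesis by simp
  qed
  have \<theta>1: "\<theta> j < 1" if "j \<le> k" for j using w_le[OF that] w t by simp
  define p where "p j = 1 / (1 - \<theta> j)" for j
  have p: "1 \<le> p j" if "j \<le> k" for j using \<theta>(1)[OF that] \<theta>1[OF that] by (simp add: p_def)
  define q where "q = (2::real) powr - (1/2)"
  have q: "0 < q" "q < 1" by (auto simp: q_def powr_less_one)
  define c where "c = w / real k"
  have c: "0 < c" using w k by (simp add: c_def)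
  define C0 where "C0 = 5 / (1 - q)"
  have C0: "1 \<le> C0" using q by (simp add: C0_def)
  define S where "S = 2 / (1 - q powr c)"
  have "q powr c < 1" using q c powr_less_mono2[of c q 1] by auto
  then have S: "0 < S" by (simp add: S_def)
  obtain C1 where C1: "0 < C1" and restr: "\<And>E U r. r \<le> k \<Longrightarrow> (\<And>j. j \<le> k \<Longrightarrow> E j \<in> sets \<mu>) \<Longrightarrow> (\<And>j. j \<le> k \<Longrightarrow> 0 < U j) \<Longrightarrow>
    (\<And>j. j \<le> k \<Longrightarrow> emeasure \<mu> (E j) \<le> ennreal (U j)) \<Longrightarrow>
    (\<integral>\<^sup>+y. (\<Prod>j\<le>k. indicator (E j) (y j)) * ennreal (simplex_det k y powr - \<gamma>) \<partial>N)
    \<le> ennreal (C1 * (\<Prod>j\<le>k. U j) * (\<Prod>j\<in>{..k} - {r}. U j powr - (\<gamma> / (real k * \<alpha>))))"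
    using restricted_bound[OF \<gamma> cond] by blast
  \<comment> \<open>\<open>2 ^ (k + 1)\<close> comes from bounding \<open>f j\<close> by
    \<open>2 powr (n + 1)\<close> on its level, \<open>C0 ^ (k + 1)\<close> from normalising the
    shares.\<close>
  define A where "A = 2 ^ (k + 1) * C1 * C0 ^ (k + 1)"
  have A: "0 < A" using C1 C0 by (simp add: A_def)
  interpret P: product_sigma_finite "\<lambda>_::nat. count_space (UNIV :: int set)"
    by (rule product_sigma_finite_int)
  let ?J = "Pi\<^sub>M {..k} (\<lambda>_::nat. count_space (UNIV :: int set))"
  show ?thesis
  proof (rule that[of "A * (real (k + 1) * (C0 * S ^ k))"])
    show "0 < A * (real (k + 1) * (C0 * S ^ k))" using A C0 S by simp
    fix f :: "nat \<Rightarrow> 'a \<Rightarrow> real"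
    assume fm [measurable]: "\<And>j. j \<le> k \<Longrightarrow> f j \<in> borel_measurable \<mu>" and f0: "\<And>j x. 0 \<le> f j x"
      and f1: "\<And>j. j \<le> k \<Longrightarrow> (\<integral>\<^sup>+x. ennreal (f j x powr (1 / (1 - \<theta> j))) \<partial>\<mu>) \<le> 1"
    define F where "F j n = {x \<in> space \<mu>. 2 powr real_of_int n \<le> f j x \<and> f j x < 2 powr (real_of_int n + 1)}" for j and n :: int
    have F [measurable]: "F j n \<in> sets \<mu>" if "j \<le> k" for j n
      unfolding F_def using fm[OF that] by measurable
    have ind: "indicator (F j n) x = (if 2 powr real_of_int n \<le> f j x \<and> f j x < 2 powr (real_of_int n + 1) then 1 else (0::ennreal))" for j n x
      by (auto simp: F_def indicator_def)
    have sumF: "(\<integral>\<^sup>+n. ennreal (2 powr (n * p j)) * emeasure \<mu> (F j n) \<partial>count_space UNIV) \<le> 1" if j: "j \<le> k" for j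
    proof -
      have "(\<integral>\<^sup>+n. ennreal (2 powr (n * p j)) * emeasure \<mu> (F j n) \<partial>count_space UNIV)
          = (\<integral>\<^sup>+n. (\<integral>\<^sup>+x. ennreal (2 powr (n * p j)) * indicator (F j n) x \<partial>\<mu>) \<partial>count_space UNIV)"
        using F[OF j] by (simp add: nn_integral_cmult)
      also have "\<dots> = (\<integral>\<^sup>+x. (\<integral>\<^sup>+n. ennreal (2 powr (n * p j)) * indicator (F j n) x \<partial>count_space UNIV) \<partial>\<mu>)"
        by (rule nn_integral_count_space_nn_integral[symmetric])
          (use F[OF j] in \<open>auto intro!: borel_measurable_times_ennreal borel_measurable_indicator\<close>)
      also have "\<dots> \<le> (\<integral>\<^sup>+x. ennreal (f j x powr p j) \<partial>\<mu>)"
      proof (rule nn_integral_mono)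
        fix x
        have "(\<integral>\<^sup>+n. ennreal (2 powr (n * p j)) * indicator (F j n) x \<partial>count_space UNIV)
           \<le> (\<integral>\<^sup>+n. ennreal (f j x powr p j) * indicator {\<lfloor>log 2 (f j x)\<rfloor>} n \<partial>count_space UNIV)"
        proof (rule nn_integral_mono)
          fix n :: int
          show "ennreal (2 powr (n * p j)) * indicator (F j n) x \<le> ennreal (f j x powr p j) * indicator {\<lfloor>log 2 (f j x)\<rfloor>} n"
          proof (cases "x \<in> F j n")
            case True
            then have x: "2 powr real_of_int n \<le> f j x" "f j x < 2 powr (real_of_int n + 1)" by (auto simp: F_def)
            have "(2 powr real_of_int n) powr p j \<le> f j x powr p j"
              using x(1) p[OF j] by (intro powr_mono2) auto
            then show ?thesis using True dyadic_level_unique[OF x] by (simp add: powr_powr ennreal_leI)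
          qed simp
        qed
        also have "\<dots> = ennreal (f j x powr p j)" by (simp add: nn_integral_cmult)
        finally show "(\<integral>\<^sup>+n. ennreal (2 powr (n * p j)) * indicator (F j n) x \<partial>count_space UNIV) \<le> ennreal (f j x powr p j)" .
      qed
      also have "\<dots> \<le> 1" using f1[OF j] by (simp add: p_def)
      finally show ?thesis .
    qed
    have finF: "emeasure \<mu> (F j n) = ennreal (measure \<mu> (F j n))" if j: "j \<le> k" for j n
    proof -
      have "ennreal (2 powr (n * p j)) * emeasure \<mu> (F j n) \<le> (\<integral>\<^sup>+n. ennreal (2 powr (n * p j)) * emeasure \<mu> (F j n) \<partial>count_space UNIV)"
        by (rule nn_integral_ge_point) simp
      also have "\<dots> \<le> 1" by (rule sumF[OF j])
      finally have "emeasure \<mu> (F j n) \<noteq> \<infinity>" by (auto simp: ennreal_mult_top top_unique)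
      then show ?thesis by (simp add: emeasure_eq_ennreal_measure)
    qed
    define Q where "Q j V \<longleftrightarrow> (\<forall>n. 0 < V n \<and> V (n + 1) \<le> q * V n \<and>
        2 powr (- real_of_int n * p j) * (2 powr (n * p j) * measure \<mu> (F j n)) \<le> V n) \<and>
        (\<integral>\<^sup>+n. ennreal (2 powr (n * p j) * V n) \<partial>count_space UNIV) \<le> ennreal C0"
      for j and V :: "int \<Rightarrow> real"
    have "\<exists>V. Q j V" if j: "j \<le> k" for j
    proof -
      have "(\<integral>\<^sup>+n. ennreal (2 powr (n * p j) * measure \<mu> (F j n)) \<partial>count_space UNIV) \<le> 1"
        using sumF[OF j] by (simp add: finF[OF j] ennreal_mult)
      then show ?thesis
        unfolding Q_def q_def C0_def
        by (intro ex_regularization[of "\<lambda>n. 2 powr (n * p j) * measure \<mu> (F j n)" "p j"]) (use p[OF j] in auto)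
    qed
    then obtain U where "\<And>j. j \<le> k \<Longrightarrow> Q j (U j)" by metis
    then have U:
      "\<And>j n. j \<le> k \<Longrightarrow> 0 < U j n" "\<And>j n. j \<le> k \<Longrightarrow> U j (n + 1) \<le> q * U j n"
      "\<And>j n. j \<le> k \<Longrightarrow> 2 powr (- real_of_int n * p j) * (2 powr (n * p j) * measure \<mu> (F j n)) \<le> U j n"
      "\<And>j. j \<le> k \<Longrightarrow> (\<integral>\<^sup>+n. ennreal (2 powr (n * p j) * U j n) \<partial>count_space UNIV) \<le> ennreal C0"
      unfolding Q_def by blast+
    have EU: "emeasure \<mu> (F j n) \<le> ennreal (U j n)" if "j \<le> k" for j n
    proof -
      have "2 powr (- real_of_int n * p j) * 2 powr (n * p j) = 1" by (simp flip: powr_add)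
      then have "measure \<mu> (F j n) \<le> U j n" using U(3)[OF that, of n] by (simp only: mult.assoc[symmetric] mult_1_left)
      then show ?thesis by (simp add: finF[OF that] ennreal_leI)
    qed
    define x where "x j n = 2 powr (n * p j) * U j n" for j and n :: int
    have xC0: "x j n \<le> C0" if "j \<le> k" for j n
    proof -
      have "ennreal (x j n) \<le> (\<integral>\<^sup>+n. ennreal (x j n) \<partial>count_space UNIV)" by (rule nn_integral_ge_point) simp
      also have "\<dots> \<le> ennreal C0" using U(4)[OF that] by (simp add: x_def)
      finally show ?thesis using C0 by (subst (asm) ennreal_le_iff) auto
    qed
    define b where "b j n y = ennreal (2 powr (real_of_int n + 1)) * indicator (F j n) y" for j n y
    have fb: "ennreal (f j y) \<le> (\<integral>\<^sup>+n. b j n y \<partial>count_space UNIV)" for j y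
    proof (cases "f j y = 0")
      case False
      then have fp: "0 < f j y" using f0[of j y] by simp
      let ?n = "\<lfloor>log 2 (f j y)\<rfloor>"
      have "ennreal (f j y) \<le> b j ?n y"
        using dyadic_level[OF fp] by (simp add: b_def ind ennreal_leI)
      also have "\<dots> \<le> (\<integral>\<^sup>+n. b j n y \<partial>count_space UNIV)" by (rule nn_integral_ge_point) simp
      finally show ?thesis .
    qed simp
    define D where "D y = ennreal (simplex_det k y powr - \<gamma>)" for y :: "nat \<Rightarrow> 'a"
    have Dm [measurable]: "D \<in> borel_measurable N" unfolding D_def by measurable
    have joint: "(\<lambda>z. (\<Prod>j\<le>k. b j (snd z j) (fst z j)) * D (fst z)) \<in> borel_measurable (N \<Otimes>\<^sub>M ?J)"
    proof -
      have "(\<lambda>z. b j (snd z j) (fst z j)) \<in> borel_measurable (N \<Otimes>\<^sub>M ?J)" if j: "j \<in> {..k}" for j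
      proof -
        have [measurable]: "(\<lambda>z. real_of_int (snd z j)) \<in> borel_measurable (N \<Otimes>\<^sub>M ?J)"
          by (rule measurable_compose[OF measurable_snd measurable_count_space_component[OF j]])
        have [measurable]: "(\<lambda>z. f j (fst z j)) \<in> borel_measurable (N \<Otimes>\<^sub>M ?J)"
          by (rule measurable_compose[OF measurable_fst measurable_compose[OF measurable_component_singleton[OF j] fm]]) (use j in simp)
        show ?thesis unfolding b_def ind by measurable
      qed
      then show ?thesis
        by (intro borel_measurable_times_ennreal borel_measurable_prod_ennreal measurable_compose[OF measurable_fst Dm]) auto
    qed
    have pair: "pair_sigma_finite N ?J"
      by (intro pair_sigma_finite.intro sigma_finite P.sigma_finite) auto
    define R where "R l n = ennreal (x l (n l)) * (\<Prod>j\<in>{..k} - {l}. ennreal (min_ratio (U j (n j)) (U l (n l)) powr c))" for l n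
    have Rm: "R l \<in> borel_measurable ?J" if "l \<le> k" for l
      unfolding R_def min_ratio_def
      using measurable_count_space_component[of l "{..k}" "x l"] measurable_count_space_component[of _ "{..k}" "U _"] that
      by (intro borel_measurable_times_ennreal borel_measurable_prod_ennreal measurable_compose[OF _ measurable_ennreal]
        powr_real_measurable borel_measurable_const borel_measurable_min borel_measurable_divide) auto
    have point: "(\<integral>\<^sup>+y. (\<Prod>j\<le>k. b j (n j) (y j)) * D y \<partial>N) \<le> ennreal A * (\<Sum>l\<le>k. R l n)" for n
    proof -
      \<comment> \<open>The restricted bound equals the product of all \<open>U j\<close> to the
        power 1 - t, times \<open>U r powr t\<close> and a constant, so the smallest majorant is the
        best base vertex.\<close>
      define r where "r = arg_min_on (\<lambda>j. U j (n j)) {..k}"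
      have r: "r \<le> k" "\<And>j. j \<le> k \<Longrightarrow> U r (n r) \<le> U j (n j)"
        using arg_min_if_finite[of "{..k}" "\<lambda>j. U j (n j)"] by (auto simp: r_def not_less)
      let ?U = "\<lambda>j. U j (n j)" and ?z = "\<lambda>j. 2 powr real_of_int (n j)"
      have meas: "(\<lambda>y. (\<Prod>j\<le>k. indicator (F j (n j)) (y j)) * D y) \<in> borel_measurable N"
        using F sets_mu by (intro borel_measurable_times_ennreal borel_measurable_prod_ennreal Dm
            measurable_compose[OF measurable_component_singleton] borel_measurable_indicator) auto
      have "(\<integral>\<^sup>+y. (\<Prod>j\<le>k. b j (n j) (y j)) * D y \<partial>N)
         = (\<integral>\<^sup>+y. (\<Prod>j\<le>k. ennreal (2 powr (real_of_int (n j) + 1))) * ((\<Prod>j\<le>k. indicator (F j (n j)) (y j)) * D y) \<partial>N)"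
        by (simp add: b_def prod.distrib mult.assoc)
      also have "\<dots> = (\<Prod>j\<le>k. ennreal (2 powr (real_of_int (n j) + 1))) * (\<integral>\<^sup>+y. (\<Prod>j\<le>k. indicator (F j (n j)) (y j)) * D y \<partial>N)"
        by (rule nn_integral_cmult[OF meas])
      also have "\<dots> \<le> (\<Prod>j\<le>k. ennreal (2 powr (real_of_int (n j) + 1))) * ennreal (C1 * (\<Prod>j\<le>k. ?U j) * (\<Prod>j\<in>{..k} - {r}. ?U j powr - t))"
        unfolding D_def t_def by (intro mult_left_mono restr r F U EU) auto
      also have "(\<Prod>j\<le>k. ennreal (2 powr (real_of_int (n j) + 1))) = ennreal (2 ^ (k + 1) * (\<Prod>j\<le>k. ?z j))"
        by (simp add: prod_ennreal powr_add prod.distrib mult.commute)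
      also have "ennreal (2 ^ (k + 1) * (\<Prod>j\<le>k. ?z j)) * ennreal (C1 * (\<Prod>j\<le>k. ?U j) * (\<Prod>j\<in>{..k} - {r}. ?U j powr - t))
         = ennreal (2 ^ (k + 1) * C1 * ((\<Prod>j\<le>k. ?z j) * (\<Prod>j\<le>k. ?U j) * (\<Prod>j\<in>{..k} - {r}. ?U j powr - t)))"
        by (subst ennreal_mult[symmetric])
          (use C1 U(1) in \<open>auto intro!: mult_nonneg_nonneg prod_nonneg simp: less_imp_le mult_ac\<close>)
      also have "\<dots> \<le> ennreal (2 ^ (k + 1) * C1 * (C0 ^ (k + 1) * (\<Sum>l\<le>k. x l (n l) * (\<Prod>j\<in>{..k} - {l}. min_ratio (?U j) (?U l) powr c))))"
      proof (intro ennreal_leI mult_left_mono)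
        have xz: "x l (n l) = ?z l powr (1 / (1 - \<theta> l)) * ?U l" for l
          by (simp add: x_def p_def powr_powr)
        have "?z j powr (1 / (1 - \<theta> j)) * ?U j \<le> C0" if "j \<le> k" for j
          using xC0[OF that, of "n j"] by (simp add: xz)
        then show "(\<Prod>j\<le>k. ?z j) * (\<Prod>j\<le>k. ?U j) * (\<Prod>j\<in>{..k} - {r}. ?U j powr - t)
          \<le> C0 ^ (k + 1) * (\<Sum>l\<le>k. x l (n l) * (\<Prod>j\<in>{..k} - {l}. min_ratio (?U j) (?U l) powr c))"
          unfolding xz c_def
          by (intro off_diagonal_decay[OF k]) (use U(1) r \<theta>(1,3) w_le w t C0 kt in auto)
      qed (use C1 in auto)
      also have "\<dots> = ennreal A * (\<Sum>l\<le>k. R l n)"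
      proof -
        have nn: "0 \<le> x l (n l) * (\<Prod>j\<in>{..k} - {l}. min_ratio (?U j) (?U l) powr c)" if "l \<le> k" for l
          using U(1)[OF that] by (auto intro!: mult_nonneg_nonneg prod_nonneg simp: x_def less_imp_le)
        have "R l n = ennreal (x l (n l) * (\<Prod>j\<in>{..k} - {l}. min_ratio (?U j) (?U l) powr c))" if "l \<le> k" for l
          unfolding R_def using U(1)[OF that] by (simp add: prod_ennreal ennreal_mult x_def less_imp_le prod_nonneg)
        then have RS: "(\<Sum>l\<le>k. R l n) = ennreal (\<Sum>l\<le>k. x l (n l) * (\<Prod>j\<in>{..k} - {l}. min_ratio (?U j) (?U l) powr c))"
          using nn by (subst sum_ennreal[symmetric]) auto
        have "2 ^ (k + 1) * C1 * (C0 ^ (k + 1) * s) = A * s" for s :: real by (simp add: A_def)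
        then show ?thesis
          unfolding RS using A by (simp only:) (intro ennreal_mult sum_nonneg nn, auto)
      qed
      finally show ?thesis .
    qed
    have "(\<integral>\<^sup>+y. (\<Prod>j\<le>k. ennreal (f j (y j))) * ennreal (simplex_det k y powr - \<gamma>) \<partial>N)
       \<le> (\<integral>\<^sup>+y. (\<integral>\<^sup>+n. (\<Prod>j\<le>k. b j (n j) (y j)) * D y \<partial>?J) \<partial>N)"
    proof (rule nn_integral_mono)
      fix y
      have "(\<Prod>j\<le>k. ennreal (f j (y j))) \<le> (\<Prod>j\<le>k. \<integral>\<^sup>+n. b j n (y j) \<partial>count_space UNIV)"
        by (rule prod_mono_ennreal) (rule fb)
      also have "\<dots> = (\<integral>\<^sup>+n. (\<Prod>j\<le>k. b j (n j) (y j)) \<partial>?J)"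
        by (rule P.product_nn_integral_prod[symmetric]) auto
      finally have "(\<Prod>j\<le>k. ennreal (f j (y j))) * D y \<le> (\<integral>\<^sup>+n. (\<Prod>j\<le>k. b j (n j) (y j)) \<partial>?J) * D y"
        by (rule mult_right_mono) simp
      also have "\<dots> = (\<integral>\<^sup>+n. (\<Prod>j\<le>k. b j (n j) (y j)) * D y \<partial>?J)"
        by (rule nn_integral_multc[symmetric], rule borel_measurable_prod_ennreal, rule measurable_count_space_component)
      finally show "(\<Prod>j\<le>k. ennreal (f j (y j))) * ennreal (simplex_det k y powr - \<gamma>) \<le> (\<integral>\<^sup>+n. (\<Prod>j\<le>k. b j (n j) (y j)) * D y \<partial>?J)"
        by (simp add: D_def)
    qed
    also have "\<dots> = (\<integral>\<^sup>+n. (\<integral>\<^sup>+y. (\<Prod>j\<le>k. b j (n j) (y j)) * D y \<partial>N) \<partial>?J)"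
      by (rule pair_sigma_finite.Fubini'[OF pair, symmetric]) (use joint in \<open>simp add: split_beta'\<close>)
    also have "\<dots> \<le> (\<integral>\<^sup>+n. ennreal A * (\<Sum>l\<le>k. R l n) \<partial>?J)"
      by (intro nn_integral_mono point)
    also have "\<dots> = ennreal A * (\<Sum>l\<le>k. integral\<^sup>N ?J (R l))"
    proof -
      have "(\<lambda>n. \<Sum>l\<le>k. R l n) \<in> borel_measurable ?J" by (rule borel_measurable_sum) (use Rm in auto)
      moreover have "(\<integral>\<^sup>+n. (\<Sum>l\<le>k. R l n) \<partial>?J) = (\<Sum>l\<le>k. integral\<^sup>N ?J (R l))"
        by (rule nn_integral_sum) (use Rm in auto)
      ultimately show ?thesis by (simp only: nn_integral_cmult)
    qed
    also have "\<dots> \<le> ennreal A * (\<Sum>l\<le>k. ennreal (C0 * S ^ k))"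
    proof (intro mult_left_mono sum_mono)
      fix l assume "l \<in> {..k}"
      then show "integral\<^sup>N ?J (R l) \<le> ennreal (C0 * S ^ k)"
        unfolding R_def[abs_def] S_def using U q c C0
        by (intro kernel_sum_le[where U = U and x = "x l"]) (auto simp: x_def)
    qed simp
    also have "(\<Sum>l\<le>k. ennreal (C0 * S ^ k)) = ennreal (real (k + 1) * (C0 * S ^ k))"
    proof -
      have "(\<Sum>l\<le>k. ennreal (C0 * S ^ k)) = ennreal (\<Sum>l\<le>k. C0 * S ^ k)"
        using C0 S by (intro sum_ennreal) auto
      then show ?thesis by (simp add: add.commute)
    qed
    also have "ennreal A * ennreal (real (k + 1) * (C0 * S ^ k)) = ennreal (A * (real (k + 1) * (C0 * S ^ k)))"
      using A C0 S by (intro ennreal_mult[symmetric]) auto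
    finally show "(\<integral>\<^sup>+y. (\<Prod>j\<le>k. ennreal (f j (y j))) * ennreal (simplex_det k y powr - \<gamma>) \<partial>N)
      \<le> ennreal (A * (real (k + 1) * (C0 * S ^ k)))" .
  qed
qed

end

section \<open>From the restricted inequalities to the ellipsoid condition\<close>

lemma le_powr_of_powr_le:
  fixes m b C \<gamma> \<alpha> :: real
  assumes "0 < m" "0 < b" "0 \<le> C" "0 < \<gamma>" "0 < \<alpha>" "m powr (\<gamma> / \<alpha>) \<le> C * b powr \<gamma>"
  shows "m \<le> C powr (\<alpha> / \<gamma>) * b powr \<alpha>"
proof -
  have "m = (m powr (\<gamma> / \<alpha>)) powr (\<alpha> / \<gamma>)" using assms by (simp add: powr_powr)
  also have "\<dots> \<le> (C * b powr \<gamma>) powr (\<alpha> / \<gamma>)" using assms by (intro powr_mono2) auto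
  also have "\<dots> = C powr (\<alpha> / \<gamma>) * b powr \<alpha>" using assms by (simp add: powr_mult powr_powr)
  finally show ?thesis .
qed

context det_setting
begin

text \<open>Content 0 means fewer than \<open>k\<close> nonzero lengths, so the ellipsoid lies in an
  affine subspace of dimension \<open>k - 1\<close>. This case rests on admissibility, since the
  determinant bound on ellipsoids is stated for positive content.\<close>

lemma ellipsoid_content_0_null:
  assumes W: "orthonormal_basis W" and "ellipsoid_content k W l = 0"
  shows "emeasure \<mu> (ellipsoid x0 W l) = 0"
proof -
  define Z where "Z = {w \<in> W. l w \<noteq> 0}"
  have no: "\<not> (I \<subseteq> Z \<and> finite I \<and> card I = k)" for I
  proof
    assume I: "I \<subseteq> Z \<and> finite I \<and> card I = k"
    have "(\<Prod>w\<in>I. l w) \<le> ellipsoid_content k W l"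
      unfolding ellipsoid_content_def by (rule SUP_upper) (use I in \<open>auto simp: Z_def\<close>)
    moreover have "(\<Prod>w\<in>I. l w) \<noteq> 0" using I by (auto simp: prod_zero_iff Z_def)
    ultimately show False using assms(2) by simp
  qed
  have fZ: "finite Z" using infinite_arbitrarily_large[of Z k] no by blast
  have "\<not> k \<le> card Z" using obtain_subset_with_card_n[of k Z] no by (metis finite_subset fZ)
  then have cZ: "card Z \<le> k - 1" by simp
  have "enat (k - 1) \<le> vdim (UNIV :: 'a set)"
    using dim by (meson diff_le_self enat_ord_simps(1) order_trans)
  then obtain A where A: "affine_subspace (k - 1) A" "(+) x0 ` span Z \<subseteq> A"
    using translate_span_subset_affine_subspace[OF fZ cZ] by metis
  have "ellipsoid x0 W l \<subseteq> A"
  proof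
    fix y assume y: "y \<in> ellipsoid x0 W l"
    have "norm (resid Z (y - x0)) \<le> 0"
      by (rule norm_resid_ellipsoid[OF W _ fZ _ _ y]) (auto simp: Z_def)
    then have "y - x0 = (\<Sum>e\<in>Z. inner (y - x0) e *\<^sub>R e)" by (simp add: resid_def)
    moreover have "(\<Sum>e\<in>Z. inner (y - x0) e *\<^sub>R e) \<in> span Z" by (intro span_sum span_scale span_base)
    ultimately have "x0 + (y - x0) \<in> A" using A(2) by (metis imageI subset_iff)
    then show "y \<in> A" by simp
  qed
  moreover have "A \<in> null_sets \<mu>" using adm A(1) by (simp add: k_admissible_def)
  ultimately have "emeasure \<mu> (ellipsoid x0 W l) \<le> 0"
    using emeasure_mono[of "ellipsoid x0 W l" A \<mu>] by (simp add: null_setsD1 null_setsD2)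
  then show ?thesis by simp
qed

text \<open>Both restricted inequalities will be tested on a set \<open>A\<close> of finite positive
  measure on which the determinant is at most \<open>b\<close>. The ellipsoid itself might have
  infinite measure; sigma-finiteness then supplies a subset of finite measure exceeding the bound, a
  contradiction.\<close>

lemma ellipsoid_conditionI:
  fixes K \<alpha> :: real
  assumes "0 < \<alpha>" "0 \<le> K"
    and bd: "\<And>A m b. A \<in> sets \<mu> \<Longrightarrow> emeasure \<mu> A = ennreal m \<Longrightarrow> 0 < m \<Longrightarrow> 0 < b \<Longrightarrow>
      (\<And>y. (\<And>i. i \<le> k \<Longrightarrow> y i \<in> A) \<Longrightarrow> simplex_det k y \<le> b) \<Longrightarrow> m \<le> K * b powr \<alpha>"
  shows "ellipsoid_condition \<mu> k \<alpha>"
proof -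
  define \<kappa> where "\<kappa> = real (k + 1) ^ k * 4 ^ k"
  \<comment> \<open>The added 1 keeps \<open>C\<close> positive, so that the right-hand side is
    infinite when the content is.\<close>
  define C where "C = K * \<kappa> powr \<alpha> + 1"
  have \<kappa>: "0 < \<kappa>" by (simp add: \<kappa>_def)
  have C: "0 < C" using assms(2) by (simp add: C_def add_nonneg_pos)
  have "emeasure \<mu> (ellipsoid x0 W l) \<le> ennreal C * ennreal_powr (ellipsoid_content k W l) \<alpha>"
    if W: "orthonormal_basis W" for x0 W l
  proof (cases "ellipsoid_content k W l")
    case top
    then show ?thesis using C by (simp add: ennreal_powr_def ennreal_mult_top)
  next
    case (real c)
    show ?thesis
    proof (cases "c = 0")
      case True
      then show ?thesis using ellipsoid_content_0_null[OF W] real by simp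
    next
      case False
      then have c: "0 < c" using real by simp
      let ?B = "ellipsoid x0 W l"
      have B: "?B \<in> sets \<mu>" by (simp add: sets_mu borel_closed closed_ellipsoid)
      have sub: "m \<le> K * (\<kappa> * c) powr \<alpha>" if "A \<in> sets \<mu>" "A \<subseteq> ?B" "emeasure \<mu> A = ennreal m" "0 < m" for A m
      proof (rule bd[OF that(1,3,4)])
        show "0 < \<kappa> * c" using \<kappa> c by simp
        fix y assume "\<And>i. i \<le> k \<Longrightarrow> y i \<in> A"
        then have "simplex_det k y \<le> real (k + 1) ^ k * (4 ^ k * c)"
          by (intro simplex_det_ellipsoid_le[OF W k real(2) c, of y x0]) (use that(2) in auto)
        then show "simplex_det k y \<le> \<kappa> * c" by (simp add: \<kappa>_def mult.assoc)
      qed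
      have b0: "0 \<le> K * (\<kappa> * c) powr \<alpha>" using assms(2) by simp
      have "emeasure \<mu> ?B \<le> ennreal (K * (\<kappa> * c) powr \<alpha>)"
      proof (cases "emeasure \<mu> ?B")
        case (real m)
        then show ?thesis using sub[OF B _ real(2)] b0 by (cases "m = 0") (auto intro: ennreal_leI)
      next
        case top
        obtain Z where Z: "Z \<in> sets \<mu>" "Z \<subseteq> ?B" "emeasure \<mu> Z < \<infinity>" "ennreal (K * (\<kappa> * c) powr \<alpha>) < emeasure \<mu> Z"
          using approx_PInf_emeasure_with_finite[OF B, of "K * (\<kappa> * c) powr \<alpha>"] top by auto
        then obtain m where m: "emeasure \<mu> Z = ennreal m" "0 \<le> m" by (cases "emeasure \<mu> Z") auto
        then have "K * (\<kappa> * c) powr \<alpha> < m" using Z(4) b0 by (simp add: ennreal_less_iff)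
        then show ?thesis using sub[OF Z(1,2) m(1)] b0 by simp
      qed
      also have "\<dots> = ennreal (K * \<kappa> powr \<alpha> * c powr \<alpha>)" using \<kappa> c by (simp add: powr_mult mult.assoc)
      also have "\<dots> \<le> ennreal (C * c powr \<alpha>)" by (intro ennreal_leI mult_right_mono) (auto simp: C_def)
      also have "\<dots> = ennreal C * ennreal_powr (ellipsoid_content k W l) \<alpha>"
        using C c real by (simp add: ennreal_powr_ennreal ennreal_mult)
      finally show ?thesis .
    qed
  qed
  then show ?thesis unfolding ellipsoid_condition_def using C by (intro exI[of _ C]) auto
qed

lemma nn_integral_prod_indicator:
  assumes "A \<in> sets \<mu>" "emeasure \<mu> A = ennreal m" "0 \<le> m"
  shows "(\<integral>\<^sup>+y. (\<Prod>j\<le>k. indicator A (y j)) \<partial>N) = ennreal (m ^ (k + 1))"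
  using assms by (subst product_nn_integral_prod) (auto simp: ennreal_power ennreal_mult)

lemma Lp_norm_indicator:
  fixes P :: real
  assumes A: "A \<in> sets \<mu>" "emeasure \<mu> A = ennreal m" "0 \<le> m" and P: "0 < P"
  shows "Lp_norm \<mu> (ereal P) (indicator A) = ennreal (m powr (1 / P))"
proof -
  have "(\<integral>\<^sup>+x. ennreal (norm (indicator A x :: complex) powr P) \<partial>\<mu>) = (\<integral>\<^sup>+x. indicator A x \<partial>\<mu>)"
    by (rule nn_integral_cong) (auto simp: indicator_def)
  also have "\<dots> = ennreal m" using A by simp
  finally show ?thesis using A(3) by (simp add: Lp_norm_def ennreal_powr_ennreal)
qed

lemma nn_integral_prod_indicator_multc:
  assumes "A \<in> sets \<mu>" "emeasure \<mu> A = ennreal m" "0 \<le> m"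
  shows "(\<integral>\<^sup>+y. (\<Prod>j\<le>k. indicator A (y j)) * c \<partial>N) = ennreal (m ^ (k + 1)) * c"
proof -
  have "(\<lambda>y. indicator A (y j) :: ennreal) \<in> borel_measurable N" if "j \<in> {..k}" for j
    by (rule measurable_compose[OF measurable_component_singleton[OF that] borel_measurable_indicator[OF assms(1)]])
  then have "(\<lambda>y. (\<Prod>j\<le>k. indicator A (y j) :: ennreal)) \<in> borel_measurable N"
    by (rule borel_measurable_prod_ennreal)
  then show ?thesis using nn_integral_prod_indicator[OF assms] by (simp add: nn_integral_multc)
qed

lemma prod_indicator_eq: "(\<Prod>j\<le>k. indicator A (y j)) = (if \<forall>j\<le>k. y j \<in> A then 1 else (0 :: 'c::{comm_semiring_1}))"
proof (cases "\<forall>j\<le>k. y j \<in> A")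
  case False
  then obtain j where "j \<le> k" "y j \<notin> A" by auto
  then have "(\<Prod>j\<le>k. indicator A (y j)) = (0 :: 'c)"
    by (intro prod_zero bexI[of _ j]) (auto simp: indicator_def)
  then show ?thesis using False by auto
qed auto

text \<open>With all sets equal to \<open>A\<close>, the functional is at most
  \<open>m ^ (k + 1) * b powr \<gamma>\<close> while the norms multiply to
  \<open>m powr (k + 1 + \<gamma> / \<alpha>)\<close>. Cancelling \<open>m ^ (k + 1)\<close>
  compares \<open>m powr (\<gamma> / \<alpha>)\<close> with \<open>b powr \<gamma>\<close>.\<close>

lemma lower_restricted_imp_ellipsoid:
  assumes "0 < \<alpha>" "lower_restricted \<mu> k \<alpha>"
  shows "ellipsoid_condition \<mu> k \<alpha>"
proof -
  obtain \<gamma> p c where \<gamma>: "0 < \<gamma>" and p: "\<And>i. i \<le> k \<Longrightarrow> 0 \<le> p i \<and> p i \<le> 1"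
    and sum_p: "(\<Sum>i\<le>k. 1 / p i - 1) = ereal (\<gamma> / \<alpha>)" and "0 < c"
    and low: "\<And>A. (\<And>i. i \<le> k \<Longrightarrow> A i \<in> sets \<mu>) \<Longrightarrow> lower_ineq \<mu> k \<gamma> p c (\<lambda>i. indicator (A i))"
    using assms(2) unfolding lower_restricted_def by blast
  \<comment> \<open>A vanishing exponent would make the sum infinite, contrary to its finite
    value.\<close>
  have pnz: "p i \<noteq> 0" if i: "i \<le> k" for i
  proof
    assume "p i = 0"
    then have "1 / p i - 1 = \<infinity>" by (simp add: divide_ereal_def one_ereal_def)
    moreover have "1 / p j - 1 \<noteq> -\<infinity>" if "j \<le> k" for j
      using p[OF that] by (cases "p j") (auto simp: one_ereal_def zero_ereal_def split: if_splits)
    ultimately have "(\<Sum>i\<le>k. 1 / p i - 1) = \<infinity>"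
      using i by (subst sum_Pinfty) auto
    then show False using sum_p by simp
  qed
  define P where "P i = real_of_ereal (p i)" for i
  have pP: "p i = ereal (P i)" "0 < P i" if "i \<le> k" for i
    using p[OF that] pnz[OF that] by (cases "p i"; simp add: P_def)+
  have sumP: "(\<Sum>i\<le>k. 1 / P i) = real (k + 1) + \<gamma> / \<alpha>"
  proof -
    have "(\<Sum>i\<le>k. 1 / p i - 1) = (\<Sum>i\<le>k. ereal (1 / P i - 1))"
      by (rule sum.cong) (use pP in \<open>auto simp: one_ereal_def less_imp_neq[THEN not_sym]\<close>)
    then have "(\<Sum>i\<le>k. 1 / P i - 1) = \<gamma> / \<alpha>" using sum_p by simp
    then show ?thesis by (simp add: sum_subtractf)
  qed
  show ?thesis
  proof (rule ellipsoid_conditionI[OF assms(1)])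
    show "0 \<le> (1 / c) powr (\<alpha> / \<gamma>)" by simp
    fix A m b assume A: "A \<in> sets \<mu>" "emeasure \<mu> A = ennreal m" and m: "0 < m" and b: "0 < b"
      and Db: "\<And>y. (\<And>i. i \<le> k \<Longrightarrow> y i \<in> A) \<Longrightarrow> simplex_det k y \<le> b"
    have "ennreal c * (\<Prod>i\<le>k. Lp_norm \<mu> (p i) (indicator A))
       \<le> det_functional_nonneg \<mu> k \<gamma> (\<lambda>i x. ennreal (norm (indicator A x :: complex)))"
      using low[of "\<lambda>_. A"] A(1) by (simp add: lower_ineq_def)
    also have "\<dots> \<le> (\<integral>\<^sup>+y. (\<Prod>j\<le>k. indicator A (y j)) * ennreal (b powr \<gamma>) \<partial>N)"
      unfolding det_functional_nonneg_def
    proof (rule nn_integral_mono)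
      fix y :: "nat \<Rightarrow> 'a"
      have "(\<Prod>j\<le>k. ennreal (norm (indicator A (y j) :: complex))) = (\<Prod>j\<le>k. indicator A (y j))"
        by (rule prod.cong) (auto simp: indicator_def)
      then show "(\<Prod>j\<le>k. ennreal (norm (indicator A (y j) :: complex))) * ennreal (simplex_det k y powr \<gamma>)
          \<le> (\<Prod>j\<le>k. indicator A (y j)) * ennreal (b powr \<gamma>)"
        using Db[of y] \<gamma> by (auto simp: prod_indicator_eq simplex_det_nonneg intro!: ennreal_leI powr_mono2)
    qed
    also have "\<dots> = ennreal (m ^ (k + 1)) * ennreal (b powr \<gamma>)"
      using nn_integral_prod_indicator_multc[OF A] m by simp
    also have "(\<Prod>i\<le>k. Lp_norm \<mu> (p i) (indicator A)) = (\<Prod>i\<le>k. ennreal (m powr (1 / P i)))"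
      by (rule prod.cong) (use pP m A in \<open>auto simp: Lp_norm_indicator\<close>)
    also have "\<dots> = ennreal (m powr (\<Sum>i\<le>k. 1 / P i))"
      using m by (simp add: prod_ennreal powr_sum)
    finally have "c * m powr (\<Sum>i\<le>k. 1 / P i) \<le> m ^ (k + 1) * b powr \<gamma>"
      using \<open>0 < c\<close> m by (simp add: ennreal_mult[symmetric] ennreal_le_iff del: power_Suc)
    also have "m powr (\<Sum>i\<le>k. 1 / P i) = m ^ (k + 1) * m powr (\<gamma> / \<alpha>)"
      unfolding sumP powr_add using m by (simp only: powr_realpow)
    finally have "m ^ (k + 1) * (c * m powr (\<gamma> / \<alpha>)) \<le> m ^ (k + 1) * b powr \<gamma>"
      by (simp only: mult_ac)
    then have "c * m powr (\<gamma> / \<alpha>) \<le> b powr \<gamma>" using m by (simp del: power_Suc)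
    then have "m powr (\<gamma> / \<alpha>) \<le> 1 / c * b powr \<gamma>" using \<open>0 < c\<close> by (simp add: field_simps)
    then show "m \<le> (1 / c) powr (\<alpha> / \<gamma>) * b powr \<alpha>"
      using m b \<open>0 < c\<close> \<gamma> assms(1) by (intro le_powr_of_powr_le) auto
  qed
qed

text \<open>On \<open>A\<close> the negative power of the determinant is at least
  \<open>b powr - \<gamma>\<close> off a null set, so the integral is at least
  \<open>m ^ (k + 1) * b powr - \<gamma>\<close>, while the norms multiply to at most
  \<open>m powr (k + 1 - \<gamma> / \<alpha>)\<close>. An infinite \<open>p i\<close> corresponds to
  \<open>\<beta> i = 1\<close>.\<close>

lemma upper_restricted_imp_ellipsoid:
  assumes "0 < \<alpha>" "upper_restricted \<mu> k \<alpha>"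
  shows "ellipsoid_condition \<mu> k \<alpha>"
proof -
  obtain \<gamma> p C where \<gamma>: "0 < \<gamma>" and p: "\<And>i. i \<le> k \<Longrightarrow> 1 \<le> p i"
    and sum_p: "(\<Sum>i\<le>k. 1 - 1 / p i) = ereal (\<gamma> / \<alpha>)" and "0 \<le> C"
    and up: "\<And>A. (\<And>i. i \<le> k \<Longrightarrow> A i \<in> sets \<mu>) \<Longrightarrow> upper_ineq \<mu> k \<gamma> p C (\<lambda>i. indicator (A i))"
    using assms(2) unfolding upper_restricted_def by blast
  define \<beta> where "\<beta> i = (if p i = \<infinity> then 1 else 1 - 1 / real_of_ereal (p i))" for i
  have p\<beta>: "1 - 1 / p i = ereal (\<beta> i)" if "i \<le> k" for i
    using p[OF that] by (cases "p i") (auto simp: \<beta>_def one_ereal_def zero_ereal_def)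
  have sum\<beta>: "(\<Sum>i\<le>k. \<beta> i) = \<gamma> / \<alpha>"
  proof -
    have "(\<Sum>i\<le>k. 1 - 1 / p i) = (\<Sum>i\<le>k. ereal (\<beta> i))" by (rule sum.cong) (use p\<beta> in auto)
    then show ?thesis using sum_p by simp
  qed
  show ?thesis
  proof (rule ellipsoid_conditionI[OF assms(1)])
    show "0 \<le> C powr (\<alpha> / \<gamma>)" by simp
    fix A m b assume A: "A \<in> sets \<mu>" "emeasure \<mu> A = ennreal m" and m: "0 < m" and b: "0 < b"
      and Db: "\<And>y. (\<And>i. i \<le> k \<Longrightarrow> y i \<in> A) \<Longrightarrow> simplex_det k y \<le> b"
    have norm_le: "Lp_norm \<mu> (p i) (indicator A) \<le> ennreal (m powr (1 - \<beta> i))" if i: "i \<le> k" for i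
    proof (cases "p i = \<infinity>")
      case True
      have "esssup \<mu> (\<lambda>x. ennreal (norm (indicator A x :: complex))) \<le> 1"
        by (rule esssup_I) (use A in \<open>auto simp: indicator_def intro!: borel_measurable_indicator\<close>)
      then show ?thesis using True m by (simp add: Lp_norm_def \<beta>_def)
    next
      case False
      then obtain P where P: "p i = ereal P" "1 \<le> P" using p[OF i] by (cases "p i") (auto simp: one_ereal_def)
      then show ?thesis using Lp_norm_indicator[OF A] m by (simp add: \<beta>_def)
    qed
    define g where "g y = (\<Prod>j\<le>k. indicator A (y j)) * simplex_det k y powr - \<gamma>" for y
    have g0: "0 \<le> g y" for y by (simp add: g_def prod_nonneg)
    have int_eq: "det_integrand k (- \<gamma>) (\<lambda>i. indicator A) y = complex_of_real (g y)" for y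
      by (cases "\<forall>j\<le>k. y j \<in> A") (auto simp add: det_integrand_def g_def prod_indicator_eq)
    have "(\<Prod>i\<le>k. Lp_norm \<mu> (p i) (indicator A)) \<le> (\<Prod>i\<le>k. ennreal (m powr (1 - \<beta> i)))"
      by (rule prod_mono_ennreal) (use norm_le in auto)
    also have "\<dots> = ennreal (m powr (\<Sum>i\<le>k. 1 - \<beta> i))"
      using m by (simp add: prod_ennreal powr_sum)
    also have "(\<Sum>i\<le>k. 1 - \<beta> i) = real (k + 1) - \<gamma> / \<alpha>" using sum\<beta> by (simp add: sum_subtractf)
    finally have prod_le: "(\<Prod>i\<le>k. Lp_norm \<mu> (p i) (indicator A)) \<le> ennreal (m powr (real (k + 1) - \<gamma> / \<alpha>))" .
    then have "(\<Prod>i\<le>k. Lp_norm \<mu> (p i) (indicator A)) < \<infinity>" by (rule le_less_trans) simp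
    then have int: "integrable N (\<lambda>y. complex_of_real (g y))"
      and le: "ennreal (norm (det_functional \<mu> k (- \<gamma>) (\<lambda>i. indicator A)))
          \<le> ennreal C * (\<Prod>i\<le>k. Lp_norm \<mu> (p i) (indicator A))"
      using up[of "\<lambda>_. A"] A(1) by (auto simp: upper_ineq_def int_eq[abs_def] cong: prod.cong)
    have intg: "integrable N g" using int by (simp add: complex_of_real_integrable_eq)
    have "det_functional \<mu> k (- \<gamma>) (\<lambda>i. indicator A) = complex_of_real (integral\<^sup>L N g)"
      unfolding det_functional_def int_eq by simp
    then have "ennreal (integral\<^sup>L N g) = ennreal (norm (det_functional \<mu> k (- \<gamma>) (\<lambda>i. indicator A)))"
      using g0 by simp
    also note le
    also have "ennreal C * (\<Prod>i\<le>k. Lp_norm \<mu> (p i) (indicator A)) \<le> ennreal C * ennreal (m powr (real (k + 1) - \<gamma> / \<alpha>))"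
      by (intro mult_left_mono prod_le) simp
    also have "\<dots> = ennreal (C * m powr (real (k + 1) - \<gamma> / \<alpha>))" using \<open>0 \<le> C\<close> by (simp add: ennreal_mult)
    finally have le2: "ennreal (integral\<^sup>L N g) \<le> ennreal (C * m powr (real (k + 1) - \<gamma> / \<alpha>))" .
    have "ennreal (m ^ (k + 1)) * ennreal (b powr - \<gamma>) = (\<integral>\<^sup>+y. (\<Prod>j\<le>k. indicator A (y j)) * ennreal (b powr - \<gamma>) \<partial>N)"
      using nn_integral_prod_indicator_multc[OF A] m by simp
    also have "\<dots> \<le> (\<integral>\<^sup>+y. ennreal (g y) \<partial>N)"
    proof (rule nn_integral_mono_AE)
      \<comment> \<open>The convention \<open>0 powr - \<gamma> = 0\<close> spoils the lower bound
        where the determinant vanishes, hence the restriction to almost every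
        \<open>y\<close>.\<close>
      show "AE y in N. (\<Prod>j\<le>k. indicator A (y j)) * ennreal (b powr - \<gamma>) \<le> ennreal (g y)"
        using AE_simplex_det_nz
      proof eventually_elim
        case (elim y)
        then have "0 < simplex_det k y" using simplex_det_nonneg[of k y] by linarith
        then show ?case
          using Db[of y] \<gamma>
          by (cases "\<forall>j\<le>k. y j \<in> A") (simp_all add: g_def prod_indicator_eq ennreal_leI powr_mono2')
      qed
    qed
    also have "\<dots> = ennreal (integral\<^sup>L N g)" by (rule nn_integral_eq_integral[OF intg]) (simp add: g0)
    also note le2
    finally have "m ^ (k + 1) * b powr - \<gamma> \<le> C * m powr (real (k + 1) - \<gamma> / \<alpha>)"
      using m \<open>0 \<le> C\<close> by (simp add: ennreal_mult[symmetric] ennreal_le_iff del: power_Suc)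
    also have "m powr (real (k + 1) - \<gamma> / \<alpha>) = m ^ (k + 1) / m powr (\<gamma> / \<alpha>)"
      unfolding powr_diff using m by (simp only: powr_realpow)
    finally have "m ^ (k + 1) * b powr - \<gamma> \<le> m ^ (k + 1) * (C / m powr (\<gamma> / \<alpha>))" by (simp add: mult_ac)
    then have "b powr - \<gamma> \<le> C / m powr (\<gamma> / \<alpha>)" by (rule mult_left_le_imp_le) (use m in simp)
    then have "m powr (\<gamma> / \<alpha>) \<le> C * b powr \<gamma>" using m b by (simp add: powr_minus field_simps)
    then show "m \<le> C powr (\<alpha> / \<gamma>) * b powr \<alpha>"
      using m b \<open>0 \<le> C\<close> \<gamma> assms(1) by (intro le_powr_of_powr_le) auto
  qed
qed

section \<open>Exponents that witness the restricted inequalities\<close>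

lemma upper_strong_imp_restricted:
  assumes "0 < \<alpha>" "upper_strong \<mu> k \<alpha>"
  shows "upper_restricted \<mu> k \<alpha>"
proof -
  define \<gamma> where "\<gamma> = \<alpha> / 2"
  \<comment> \<open>Equal shares of \<gamma>/\<alpha> = 1/2 over k + 1 indices; each is below
    1/(2k), as the strict condition demands.\<close>
  define b where "b = 1 / (2 * (real k + 1))"
  have b: "0 < b" "b < 1" by (auto simp: b_def field_simps)
  define p where "p = (\<lambda>i::nat. ereal (1 / (1 - b)))"
  have pb: "1 - 1 / p i = ereal b" for i using b by (simp add: p_def one_ereal_def)
  have 1: "0 < \<gamma>" "\<gamma> < \<alpha>" using assms(1) by (auto simp: \<gamma>_def)
  have 2: "1 \<le> p i" for i using b by (simp add: p_def one_ereal_def)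
  have 3: "1 - 1 / p i < ereal (\<gamma> / (real k * \<alpha>))" for i
    unfolding pb using k assms(1) by (simp add: \<gamma>_def b_def field_simps)
  have 4: "(\<Sum>i\<le>k. 1 - 1 / p i) = ereal (\<gamma> / \<alpha>)"
    unfolding pb using assms(1) by (simp add: \<gamma>_def b_def field_simps)
  obtain C where C: "C \<ge> 0" "\<And>f. (\<forall>i\<le>k. f i \<in> borel_measurable \<mu>) \<Longrightarrow> upper_ineq \<mu> k \<gamma> p C f"
    using assms(2) 1 2 3 4 unfolding upper_strong_def by meson
  have "upper_ineq \<mu> k \<gamma> p C (\<lambda>i. indicator (A i))" if "\<forall>i\<le>k. A i \<in> sets \<mu>" for A
    by (rule C(2)) (use that in auto)
  then show ?thesis unfolding upper_restricted_def using 1 2 4 C(1) by blast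
qed

lemma lower_strong_imp_restricted:
  assumes "0 < \<alpha>" "lower_strong \<mu> k \<alpha>"
  shows "lower_restricted \<mu> k \<alpha>"
proof -
  \<comment> \<open>Here \<gamma> = \<alpha>: equal shares of 1 over k + 1 indices, each below
    1/k.\<close>
  define b where "b = 1 / (real k + 1)"
  have b: "0 < b" by (auto simp: b_def)
  define p where "p = (\<lambda>i::nat. ereal (1 / (1 + b)))"
  have pb: "1 / p i - 1 = ereal b" for i using b by (simp add: p_def one_ereal_def)
  have 2: "0 \<le> p i \<and> p i \<le> 1" for i using b by (simp add: p_def one_ereal_def)
  have 3: "1 / p i - 1 < ereal (\<alpha> / (real k * \<alpha>))" for i
    unfolding pb using k assms(1) by (simp add: b_def field_simps)
  have 4: "(\<Sum>i\<le>k. 1 / p i - 1) = ereal (\<alpha> / \<alpha>)"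
    unfolding pb using assms(1) by (simp add: b_def field_simps)
  obtain c where c: "c > 0" "\<And>f. (\<forall>i\<le>k. f i \<in> borel_measurable \<mu>) \<Longrightarrow> lower_ineq \<mu> k \<alpha> p c f"
    using assms 2 3 4 unfolding lower_strong_def by meson
  have "lower_ineq \<mu> k \<alpha> p c (\<lambda>i. indicator (A i))" if "\<forall>i\<le>k. A i \<in> sets \<mu>" for A
    by (rule c(2)) (use that in auto)
  then show ?thesis unfolding lower_restricted_def using assms(1) 2 4 c(1) by blast
qed

end

section \<open>The strong inequalities\<close>

context det_setting
begin

lemma AE_component:
  assumes "j \<le> k" "AE x in \<mu>. Q x" "{x. \<not> Q x} \<in> sets \<mu>"
  shows "AE y in N. Q (y j)"
proof -
  let ?I = "{..k} - {j}"
  have I: "insert j ?I = {..k}" using assms(1) by auto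
  define h where "h y = (indicator {x. \<not> Q x} (y j) :: ennreal)" for y :: "nat \<Rightarrow> 'a"
  have hm: "h \<in> borel_measurable N"
    unfolding h_def
    using assms(1)
    by (intro measurable_compose[OF measurable_component_singleton[of j "{..k}" "\<lambda>_. \<mu>"] borel_measurable_indicator[OF assms(3)]])
      auto
  have "integral\<^sup>N N h = (\<integral>\<^sup>+u. (\<integral>\<^sup>+x. h (x(j := u)) \<partial>Pi\<^sub>M ?I (\<lambda>_. \<mu>)) \<partial>\<mu>)"
    using product_nn_integral_insert_rev[of ?I j h] hm I by simp
  also have "\<dots> = (\<integral>\<^sup>+u. 0 \<partial>\<mu>)"
    by (rule nn_integral_cong_AE) (use assms(2) in \<open>auto simp: h_def\<close>)
  finally have "AE y in N. h y = 0" using hm by (simp add: nn_integral_0_iff_AE)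
  then show ?thesis by eventually_elim (auto simp: h_def indicator_def split: if_splits)
qed

lemma nn_integral_powr_divide:
  fixes f :: "'a \<Rightarrow> real" and M p :: real
  assumes "f \<in> borel_measurable \<mu>" "\<And>x. 0 \<le> f x" "0 < M"
  shows "(\<integral>\<^sup>+x. ennreal ((f x / M) powr p) \<partial>\<mu>) = (\<integral>\<^sup>+x. ennreal (f x powr p) \<partial>\<mu>) * ennreal (1 / M powr p)"
proof -
  have "ennreal ((f x / M) powr p) = ennreal (f x powr p) * ennreal (1 / M powr p)" for x
    by (simp add: powr_divide ennreal_mult[symmetric])
  then show ?thesis using assms(1) by (simp add: nn_integral_multc)
qed

lemma nn_integral_scale:
  fixes f :: "nat \<Rightarrow> 'a \<Rightarrow> real" and M :: "nat \<Rightarrow> real"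
  assumes fm: "\<And>j. j \<le> k \<Longrightarrow> f j \<in> borel_measurable \<mu>" and f0: "\<And>j x. 0 \<le> f j x" and M: "\<And>j. j \<le> k \<Longrightarrow> 0 < M j"
  shows "(\<integral>\<^sup>+y. (\<Prod>j\<le>k. ennreal (f j (y j))) * ennreal (simplex_det k y powr s) \<partial>N)
    = ennreal (\<Prod>j\<le>k. M j) * (\<integral>\<^sup>+y. (\<Prod>j\<le>k. ennreal (f j (y j) / M j)) * ennreal (simplex_det k y powr s) \<partial>N)"
proof -
  have "(\<lambda>y. f j (y j)) \<in> borel_measurable N" if "j \<in> {..k}" for j
    by (rule measurable_compose[OF measurable_component_singleton[OF that] fm]) (use that in simp)
  then have m: "(\<lambda>y. (\<Prod>j\<le>k. ennreal (f j (y j) / M j)) * ennreal (simplex_det k y powr s)) \<in> borel_measurable N"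
    by (intro borel_measurable_times_ennreal borel_measurable_prod_ennreal measurable_compose[OF _ measurable_ennreal]
        borel_measurable_divide borel_measurable_const powr_real_measurable measurable_simplex_det) auto
  have "(\<Prod>j\<le>k. ennreal (f j (y j))) = ennreal (\<Prod>j\<le>k. M j) * (\<Prod>j\<le>k. ennreal (f j (y j) / M j))" for y
  proof -
    have "(\<Prod>j\<le>k. ennreal (f j (y j))) = (\<Prod>j\<le>k. ennreal (M j) * ennreal (f j (y j) / M j))"
    proof (rule prod.cong)
      fix j assume "j \<in> {..k}"
      then have "0 < M j" using M by simp
      then show "ennreal (f j (y j)) = ennreal (M j) * ennreal (f j (y j) / M j)"
        using f0 by (subst ennreal_mult[symmetric]) auto
    qed simp
    also have "\<dots> = (\<Prod>j\<le>k. ennreal (M j)) * (\<Prod>j\<le>k. ennreal (f j (y j) / M j))" by (rule prod.distrib)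
    also have "(\<Prod>j\<le>k. ennreal (M j)) = ennreal (\<Prod>j\<le>k. M j)"
      using M by (intro prod_ennreal) (auto simp: less_imp_le)
    finally show ?thesis .
  qed
  then have "(\<integral>\<^sup>+y. (\<Prod>j\<le>k. ennreal (f j (y j))) * ennreal (simplex_det k y powr s) \<partial>N)
      = (\<integral>\<^sup>+y. ennreal (\<Prod>j\<le>k. M j) * ((\<Prod>j\<le>k. ennreal (f j (y j) / M j)) * ennreal (simplex_det k y powr s)) \<partial>N)"
    by (simp add: mult.assoc)
  then show ?thesis using nn_integral_cmult[OF m] by simp
qed

text \<open>Both sides are homogeneous in each function, which reduces the claim to
  \<open>strong_normalized\<close>. The strict condition excludes p i = \<infinity>, since
  \<gamma>/(k\<alpha>) < 1.\<close>

lemma ellipsoid_imp_upper_strong: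
  assumes "0 < \<alpha>" and cond: "ellipsoid_condition \<mu> k \<alpha>"
  shows "upper_strong \<mu> k \<alpha>"
  unfolding upper_strong_def
proof (intro allI impI, elim conjE)
  fix \<gamma> :: real and p :: "nat \<Rightarrow> ereal"
  assume \<gamma>: "0 < \<gamma>" "\<gamma> < \<alpha>" and p1: "\<forall>i\<le>k. 1 \<le> p i"
    and p2: "\<forall>i\<le>k. 1 - 1 / p i < ereal (\<gamma> / (real k * \<alpha>))"
    and p3: "(\<Sum>i\<le>k. 1 - 1 / p i) = ereal (\<gamma> / \<alpha>)"
  have lt1: "\<gamma> / (real k * \<alpha>) < 1"
  proof -
    have "\<gamma> < 1 * \<alpha>" using \<gamma> by simp
    also have "\<dots> \<le> real k * \<alpha>" using k assms(1) by (intro mult_right_mono) auto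
    finally show ?thesis using k assms(1) by simp
  qed
  define P where "P i = real_of_ereal (p i)" for i
  have pP: "p i = ereal (P i)" "1 \<le> P i" if "i \<le> k" for i
  proof -
    have "p i \<noteq> \<infinity>" using p2 that lt1 by (auto simp: one_ereal_def zero_ereal_def)
    then show "p i = ereal (P i)" "1 \<le> P i" using p1 that by (cases "p i"; force simp: P_def one_ereal_def)+
  qed
  define \<theta> where "\<theta> i = 1 - 1 / P i" for i
  have p\<theta>: "1 - 1 / p i = ereal (\<theta> i)" if "i \<le> k" for i
    using pP[OF that] by (simp add: \<theta>_def one_ereal_def)
  have P\<theta>: "1 / (1 - \<theta> i) = P i" for i by (simp add: \<theta>_def)
  have \<theta>: "0 \<le> \<theta> i" "\<theta> i < \<gamma> / (real k * \<alpha>)" if "i \<le> k" for i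
    using pP[OF that] p2 p\<theta>[OF that] that by (auto simp: \<theta>_def)
  have sum\<theta>: "(\<Sum>i\<le>k. \<theta> i) = \<gamma> / \<alpha>"
  proof -
    have "(\<Sum>i\<le>k. 1 - 1 / p i) = (\<Sum>i\<le>k. ereal (\<theta> i))" by (rule sum.cong) (use p\<theta> in auto)
    then show ?thesis using p3 by simp
  qed
  obtain C where C: "0 < C" and bound: "\<And>f. (\<And>j. j \<le> k \<Longrightarrow> f j \<in> borel_measurable \<mu>) \<Longrightarrow> (\<And>j x. 0 \<le> f j x) \<Longrightarrow>
      (\<And>j. j \<le> k \<Longrightarrow> (\<integral>\<^sup>+x. ennreal (f j x powr P j) \<partial>\<mu>) \<le> 1) \<Longrightarrow>
      (\<integral>\<^sup>+y. (\<Prod>j\<le>k. ennreal (f j (y j))) * ennreal (simplex_det k y powr - \<gamma>) \<partial>N) \<le> ennreal C"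
    using strong_normalized[of \<gamma> \<alpha> \<theta>] \<gamma> cond \<theta> sum\<theta> unfolding P\<theta> by blast
  have "upper_ineq \<mu> k \<gamma> p C f" if fm: "\<forall>i\<le>k. f i \<in> borel_measurable \<mu>" for f
    unfolding upper_ineq_def
  proof (intro impI)
    assume fin: "(\<Prod>i\<le>k. Lp_norm \<mu> (p i) (f i)) < \<infinity>"
    define I where "I j = (\<integral>\<^sup>+x. ennreal (norm (f j x) powr P j) \<partial>\<mu>)" for j
    have Lp: "Lp_norm \<mu> (p j) (f j) = ennreal_powr (I j) (1 / P j)" if "j \<le> k" for j
      using pP[OF that] by (simp add: Lp_norm_def I_def)
    have fcomp: "(\<lambda>y. f j (y j)) \<in> borel_measurable N" if "j \<in> {..k}" for j
      by (rule measurable_compose[OF measurable_component_singleton[OF that]]) (use that fm in simp)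
    have nm: "ennreal (norm (det_integrand k (- \<gamma>) f y))
        = (\<Prod>j\<le>k. ennreal (norm (f j (y j)))) * ennreal (simplex_det k y powr - \<gamma>)" for y
      by (simp add: det_integrand_def norm_mult prod_norm[symmetric] prod_ennreal ennreal_mult prod_nonneg)
    have T: "(\<integral>\<^sup>+y. ennreal (norm (det_integrand k (- \<gamma>) f y)) \<partial>N) \<le> ennreal C * (\<Prod>i\<le>k. Lp_norm \<mu> (p i) (f i))"
    \<comment> \<open>If one norm vanishes, that factor is 0 almost everywhere and the integral is
      0, even if another norm is infinite.\<close>
    proof (cases "\<exists>j\<le>k. I j = 0")
      case True
      then obtain j where j: "j \<le> k" "I j = 0" by auto
      have fj: "f j \<in> borel_measurable \<mu>" using fm j by simp
      then have "AE x in \<mu>. ennreal (norm (f j x) powr P j) = 0"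
        using j(2) by (simp add: I_def nn_integral_0_iff_AE)
      then have ae: "AE x in \<mu>. f j x = 0"
        by eventually_elim (auto simp: ennreal_eq_0_iff)
      have "{x \<in> space \<mu>. f j x \<noteq> 0} \<in> sets \<mu>" using fj by measurable
      then have "AE y in N. f j (y j) = 0" using AE_component[OF j(1) ae] by simp
      then have "AE y in N. ennreal (norm (det_integrand k (- \<gamma>) f y)) = 0"
      proof eventually_elim
        case (elim y)
        then have "(\<Prod>j\<le>k. f j (y j)) = 0" using j(1) by (intro prod_zero) auto
        then show ?case by (simp add: det_integrand_def)
      qed
      then have "(\<integral>\<^sup>+y. ennreal (norm (det_integrand k (- \<gamma>) f y)) \<partial>N) = (\<integral>\<^sup>+y. 0 \<partial>N)"
        by (rule nn_integral_cong_AE)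
      then show ?thesis by simp
    next
      case False
      have pos: "Lp_norm \<mu> (p j) (f j) \<noteq> 0" if "j \<le> k" for j
      proof (cases "I j")
        case (real r)
        then show ?thesis using False that by (auto simp: Lp ennreal_powr_ennreal ennreal_eq_0_iff)
      next
        case top
        then show ?thesis using that by (simp add: Lp ennreal_powr_def)
      qed
      \<comment> \<open>With all norms nonzero, a finite product leaves no room for an infinite
        factor.\<close>
      have Ifin: "I j \<noteq> \<infinity>" if "j \<le> k" for j
      proof
        assume "I j = \<infinity>"
        then have "Lp_norm \<mu> (p j) (f j) = \<infinity>" using that by (simp add: Lp ennreal_powr_def)
        moreover have "(\<Prod>i\<in>{..k} - {j}. Lp_norm \<mu> (p i) (f i)) \<noteq> 0" using pos by (auto simp: prod_zero_iff)
        moreover have "(\<Prod>i\<le>k. Lp_norm \<mu> (p i) (f i)) = Lp_norm \<mu> (p j) (f j) * (\<Prod>i\<in>{..k} - {j}. Lp_norm \<mu> (p i) (f i))"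
          using that by (intro prod.remove) auto
        ultimately show False using fin by (simp add: ennreal_top_mult)
      qed
      define M where "M j = enn2real (I j) powr (1 / P j)" for j
      have M: "0 < M j" "I j = ennreal (M j powr P j)" "Lp_norm \<mu> (p j) (f j) = ennreal (M j)" if j: "j \<le> k" for j
      proof -
        obtain r where r: "I j = ennreal r" "0 \<le> r" using Ifin[OF j] by (cases "I j") auto
        then have "0 < r" using False j by (cases "r = 0") auto
        then show "0 < M j" "I j = ennreal (M j powr P j)"
          using r pP[OF j] by (simp_all add: M_def powr_powr)
        show "Lp_norm \<mu> (p j) (f j) = ennreal (M j)"
          unfolding Lp[OF j] using r by (simp add: M_def ennreal_powr_ennreal)
      qed
      have "(\<integral>\<^sup>+y. ennreal (norm (det_integrand k (- \<gamma>) f y)) \<partial>N)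
         = ennreal (\<Prod>j\<le>k. M j) * (\<integral>\<^sup>+y. (\<Prod>j\<le>k. ennreal (norm (f j (y j)) / M j)) * ennreal (simplex_det k y powr - \<gamma>) \<partial>N)"
        unfolding nm by (rule nn_integral_scale[of "\<lambda>j x. norm (f j x)"]) (use fm M in auto)
      also have "\<dots> \<le> ennreal (\<Prod>j\<le>k. M j) * ennreal C"
      proof (intro mult_left_mono)
        \<comment> \<open>\<open>bound\<close> asks for nonnegativity at every index, also beyond
          \<open>k\<close>; the maximum with 0 supplies it.\<close>
        have "(\<integral>\<^sup>+y. (\<Prod>j\<le>k. ennreal (norm (f j (y j)) / max (M j) 0)) * ennreal (simplex_det k y powr - \<gamma>) \<partial>N) \<le> ennreal C"
        proof (rule bound)
          fix j assume j: "j \<le> k"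
          have "(\<lambda>x. norm (f j x)) \<in> borel_measurable \<mu>" using fm j by auto
          then have "(\<integral>\<^sup>+x. ennreal ((norm (f j x) / M j) powr P j) \<partial>\<mu>) = ennreal (M j powr P j) * ennreal (1 / M j powr P j)"
            using nn_integral_powr_divide[of "\<lambda>x. norm (f j x)" "M j" "P j"] M(1,2)[OF j] by (simp add: I_def)
          also have "\<dots> = 1" using M(1)[OF j] by (simp add: ennreal_mult[symmetric])
          finally show "(\<integral>\<^sup>+x. ennreal ((norm (f j x) / max (M j) 0) powr P j) \<partial>\<mu>) \<le> 1"
            using M(1)[OF j] by (simp add: max_def)
        qed (use fm in auto)
        moreover have "(\<Prod>j\<le>k. ennreal (norm (f j (y j)) / max (M j) 0)) = (\<Prod>j\<le>k. ennreal (norm (f j (y j)) / M j))" for y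
        proof (rule prod.cong)
          fix j assume "j \<in> {..k}"
          then have "0 < M j" using M(1) by simp
          then show "ennreal (norm (f j (y j)) / max (M j) 0) = ennreal (norm (f j (y j)) / M j)" by simp
        qed simp
        ultimately show "(\<integral>\<^sup>+y. (\<Prod>j\<le>k. ennreal (norm (f j (y j)) / M j)) * ennreal (simplex_det k y powr - \<gamma>) \<partial>N) \<le> ennreal C"
          by simp
      qed simp
      also have "ennreal (\<Prod>j\<le>k. M j) = (\<Prod>j\<le>k. ennreal (M j))"
        by (rule prod_ennreal[symmetric]) (use M(1) less_imp_le in auto)
      also have "\<dots> = (\<Prod>i\<le>k. Lp_norm \<mu> (p i) (f i))"
        by (rule prod.cong) (simp_all add: M(3))
      finally show ?thesis by (simp add: mult.commute)
    qed
    have "det_integrand k (- \<gamma>) f \<in> borel_measurable N"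
    proof -
      have "(\<lambda>y. complex_of_real (simplex_det k y powr - \<gamma>)) \<in> borel_measurable N"
        by measurable
      then show ?thesis
        unfolding det_integrand_def[abs_def] by (intro borel_measurable_times borel_measurable_prod fcomp)
    qed
    moreover have "(\<integral>\<^sup>+y. ennreal (norm (det_integrand k (- \<gamma>) f y)) \<partial>N) < \<infinity>"
      using T by (rule le_less_trans) (use fin in \<open>simp add: ennreal_mult_less_top\<close>)
    ultimately have int: "integrable N (det_integrand k (- \<gamma>) f)" by (rule integrableI_bounded)
    moreover have "ennreal (norm (det_functional \<mu> k (- \<gamma>) f)) \<le> ennreal C * (\<Prod>i\<le>k. Lp_norm \<mu> (p i) (f i))"
      unfolding det_functional_def using integral_norm_bound_ennreal[OF int] T by (rule order_trans)
    ultimately show "integrable N (det_integrand k (- \<gamma>) f) \<and>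
        ennreal (norm (det_functional \<mu> k (- \<gamma>) f)) \<le> ennreal C * (\<Prod>i\<le>k. Lp_norm \<mu> (p i) (f i))" by blast
  qed
  then show "\<exists>C\<ge>0. \<forall>f. (\<forall>i\<le>k. f i \<in> borel_measurable \<mu>) \<longrightarrow> upper_ineq \<mu> k \<gamma> p C f"
    using C less_imp_le by blast
qed

text \<open>Hoelder's inequality in reverse: \<open>f\<^bsup>P\<^esup>\<close> is split as \<open>f\<^bsup>a\<^esup> g\<^bsup>1 - a\<^esup>\<close> with \<open>g = f\<^bsup>P (1 - \<theta>)\<^esup>\<close>, where \<open>f\<close> carries
  the weight \<open>det\<^bsup>\<gamma>\<^esup>\<close> and \<open>g\<close> a small negative power of the determinant for which the upper bound holds.\<close>

lemma lower_normalized: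
  fixes \<gamma> \<alpha> :: real and \<phi> :: "nat \<Rightarrow> real"
  assumes \<gamma>: "0 < \<gamma>" and \<alpha>: "0 < \<alpha>" and cond: "ellipsoid_condition \<mu> k \<alpha>"
    and \<phi>: "\<And>j. j \<le> k \<Longrightarrow> 0 \<le> \<phi> j" "\<And>j. j \<le> k \<Longrightarrow> \<phi> j < \<gamma> / (real k * \<alpha>)" "(\<Sum>j\<le>k. \<phi> j) = \<gamma> / \<alpha>"
  obtains c where "0 < c"
    "\<And>f. (\<And>j. j \<le> k \<Longrightarrow> f j \<in> borel_measurable \<mu>) \<Longrightarrow> (\<And>j x. 0 \<le> f j x) \<Longrightarrow>
      (\<And>j. j \<le> k \<Longrightarrow> (\<integral>\<^sup>+x. ennreal (f j x powr (1 / (1 + \<phi> j))) \<partial>\<mu>) = 1) \<Longrightarrow>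
      ennreal c \<le> (\<integral>\<^sup>+y. (\<Prod>j\<le>k. ennreal (f j (y j))) * ennreal (simplex_det k y powr \<gamma>) \<partial>N)"
proof -
  \<comment> \<open>The condition on \<open>a\<close> is a \<gamma> < (1 - a) \<alpha>; this choice
    gives the negative exponent \<gamma>' = \<alpha> \<gamma> / (\<alpha> + 2 \<gamma>), which is
    below \<alpha>.\<close>
  define a where "a = \<alpha> / (2 * (\<alpha> + \<gamma>))"
  have a: "0 < a" "a < 1" using \<alpha> \<gamma> by (auto simp: a_def field_simps)
  define s where "s = a / (1 - a)"
  have s: "0 < s" "(1 - a) * s = a" using a by (auto simp: s_def)
  have s_eq: "s = \<alpha> / (\<alpha> + 2 * \<gamma>)" using \<alpha> \<gamma> by (simp add: s_def a_def divide_simps)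
  define \<gamma>' where "\<gamma>' = s * \<gamma>"
  have \<gamma>': "0 < \<gamma>'" "\<gamma>' < \<alpha>"
  proof -
    show "0 < \<gamma>'" using s \<gamma> by (simp add: \<gamma>'_def)
    show "\<gamma>' < \<alpha>" unfolding \<gamma>'_def s_eq using \<alpha> \<gamma> by (simp add: field_simps add_pos_pos)
  qed
  define \<theta> where "\<theta> j = s * \<phi> j" for j
  have \<theta>: "0 \<le> \<theta> j" "\<theta> j < \<gamma>' / (real k * \<alpha>)" if "j \<le> k" for j
    using \<phi>(1,2)[OF that] s mult_strict_left_mono[OF \<phi>(2)[OF that] s(1)] by (auto simp: \<theta>_def \<gamma>'_def)
  have sum\<theta>: "(\<Sum>j\<le>k. \<theta> j) = \<gamma>' / \<alpha>"
    using \<phi>(3) by (simp add: \<theta>_def \<gamma>'_def sum_distrib_left[symmetric])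
  have \<theta>1: "\<theta> j < 1" if "j \<le> k" for j
  proof -
    have "\<gamma>' < 1 * \<alpha>" using \<gamma>' by simp
    also have "\<dots> \<le> real k * \<alpha>" using k \<alpha> by (intro mult_right_mono) auto
    finally have "\<gamma>' / (real k * \<alpha>) < 1" using k \<alpha> by simp
    then show ?thesis using \<theta>(2)[OF that] by simp
  qed
  obtain C where C: "0 < C" and bound: "\<And>f. (\<And>j. j \<le> k \<Longrightarrow> f j \<in> borel_measurable \<mu>) \<Longrightarrow> (\<And>j x. 0 \<le> f j x) \<Longrightarrow>
      (\<And>j. j \<le> k \<Longrightarrow> (\<integral>\<^sup>+x. ennreal (f j x powr (1 / (1 - \<theta> j))) \<partial>\<mu>) \<le> 1) \<Longrightarrow>
      (\<integral>\<^sup>+y. (\<Prod>j\<le>k. ennreal (f j (y j))) * ennreal (simplex_det k y powr - \<gamma>') \<partial>N) \<le> ennreal C"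
    using strong_normalized[of \<gamma>' \<alpha> \<theta>] \<gamma>' cond \<theta> sum\<theta> by blast
  \<comment> \<open>Parameter for Young's inequality, solved from
    \<open>(1 - a) * t powr (- (a / (1 - a))) * C = 1 / 2\<close>: the term estimated by the upper
    bound then contributes at most 1/2 and can be absorbed into the left-hand side 1.\<close>
  define t where "t = (2 * (1 - a) * C) powr ((1 - a) / a)"
  have t: "0 < t" using a C by (simp add: t_def)
  have ta: "t powr (- (a / (1 - a))) = 1 / (2 * (1 - a) * C)"
  proof -
    have "(1 - a) / a * - (a / (1 - a)) = -1" using a by simp
    then have "t powr (- (a / (1 - a))) = (2 * (1 - a) * C) powr (-1)" by (simp only: t_def powr_powr)
    then show ?thesis using a C by (simp add: powr_minus_divide)
  qed
  define P where "P j = 1 / (1 + \<phi> j)" for j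
  show ?thesis
  proof (rule that[of "1 / (2 * a * t)"])
    show "0 < 1 / (2 * a * t)" using a t by simp
    fix f :: "nat \<Rightarrow> 'a \<Rightarrow> real"
    assume fm: "\<And>j. j \<le> k \<Longrightarrow> f j \<in> borel_measurable \<mu>" and f0: "\<And>j x. 0 \<le> f j x"
      and f1: "\<And>j. j \<le> k \<Longrightarrow> (\<integral>\<^sup>+x. ennreal (f j x powr (1 / (1 + \<phi> j))) \<partial>\<mu>) = 1"
    define g where "g j x = f j x powr (P j * (1 - \<theta> j))" for j x
    have fcomp [measurable]: "(\<lambda>y. f j (y j)) \<in> borel_measurable N" if "j \<in> {..k}" for j
      by (rule measurable_compose[OF measurable_component_singleton[OF that] fm]) (use that in simp)
    define F where "F y = (\<Prod>j\<le>k. ennreal (f j (y j))) * ennreal (simplex_det k y powr \<gamma>)" for y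
    define G where "G y = (\<Prod>j\<le>k. ennreal (g j (y j))) * ennreal (simplex_det k y powr - \<gamma>')" for y
    have Fm: "F \<in> borel_measurable N"
      unfolding F_def
      by (intro borel_measurable_times_ennreal borel_measurable_prod_ennreal measurable_compose[OF _ measurable_ennreal]
          powr_real_measurable measurable_simplex_det fcomp) auto
    have Gm: "G \<in> borel_measurable N"
      unfolding G_def g_def
      by (intro borel_measurable_times_ennreal borel_measurable_prod_ennreal measurable_compose[OF _ measurable_ennreal]
          powr_real_measurable measurable_simplex_det fcomp) auto
    have GC: "integral\<^sup>N N G \<le> ennreal C"
      unfolding G_def
    proof (rule bound)
      fix j assume j: "j \<le> k"
      have "g j x powr (1 / (1 - \<theta> j)) = f j x powr P j" for x
        using \<theta>1[OF j] by (simp add: g_def powr_powr)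
      then show "(\<integral>\<^sup>+x. ennreal (g j x powr (1 / (1 - \<theta> j))) \<partial>\<mu>) \<le> 1" using f1[OF j] by (simp add: P_def)
      show "g j \<in> borel_measurable \<mu>" unfolding g_def using fm[OF j] by measurable
    qed (simp add: g_def)
    have "1 = (\<Prod>j\<le>k. \<integral>\<^sup>+x. ennreal (f j x powr P j) \<partial>\<mu>)" using f1 by (simp add: P_def)
    also have "\<dots> = (\<integral>\<^sup>+y. (\<Prod>j\<le>k. ennreal (f j (y j) powr P j)) \<partial>N)"
      by (rule product_nn_integral_prod[symmetric]) (use fm in auto)
    also have "\<dots> \<le> (\<integral>\<^sup>+y. ennreal (a * t) * F y + ennreal (1 / (2 * C)) * G y \<partial>N)"
    proof (rule nn_integral_mono_AE)
      show "AE y in N. (\<Prod>j\<le>k. ennreal (f j (y j) powr P j)) \<le> ennreal (a * t) * F y + ennreal (1 / (2 * C)) * G y"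
        using AE_simplex_det_nz
      proof eventually_elim
        case (elim y)
        then have D: "0 < simplex_det k y" using simplex_det_nonneg[of k y] by linarith
        show ?case
        proof (cases "\<exists>j\<le>k. f j (y j) = 0")
          case True
          then have "(\<Prod>j\<le>k. ennreal (f j (y j) powr P j)) = 0" by (intro prod_zero) auto
          then show ?thesis by (simp only: zero_le)
        next
          case False
          then have fp: "0 < f j (y j)" if "j \<le> k" for j using f0[of j "y j"] that by (auto simp: less_le)
          define X where "X = (\<Prod>j\<le>k. f j (y j))"
          define Y where "Y = (\<Prod>j\<le>k. g j (y j))"
          define d where "d = simplex_det k y"
          have X: "0 < X" unfolding X_def by (rule prod_pos) (use fp in auto)
          have Y: "0 < Y" unfolding Y_def by (rule prod_pos) (use fp in \<open>auto simp: g_def less_imp_neq[THEN not_sym]\<close>)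
          have d: "0 < d" using D by (simp add: d_def)
          have "(\<Prod>j\<le>k. f j (y j) powr P j) = X powr a * Y powr (1 - a)"
          proof -
            have "X powr a * Y powr (1 - a) = (\<Prod>j\<le>k. f j (y j) powr a * g j (y j) powr (1 - a))"
              unfolding X_def Y_def by (simp add: prod_powr_distrib prod.distrib)
            also have "\<dots> = (\<Prod>j\<le>k. f j (y j) powr P j)"
            proof (rule prod.cong)
              fix j assume "j \<in> {..k}"
              then have "0 < 1 + \<phi> j" using \<phi>(1)[of j] by simp
              \<comment> \<open>The exponents match because \<open>\<theta> j = s * \<phi> j\<close>
                with \<open>(1 - a) * s = a\<close>, and
                \<open>1 / P j = 1 + \<phi> j\<close>.\<close>
              have "(1 - a) * (1 - s * \<phi> j) = 1 - a - ((1 - a) * s) * \<phi> j" by (simp add: algebra_simps)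
              also have "\<dots> = 1 - a * (1 + \<phi> j)" unfolding s(2) by (simp add: algebra_simps)
              finally have "(1 - a) * (1 - s * \<phi> j) = 1 - a * (1 + \<phi> j)" .
              then have "a + P j * (1 - \<theta> j) * (1 - a) = P j"
                using \<open>0 < 1 + \<phi> j\<close> by (simp add: P_def \<theta>_def field_simps)
              then show "f j (y j) powr a * g j (y j) powr (1 - a) = f j (y j) powr P j"
                by (simp add: g_def powr_powr flip: powr_add)
            qed simp
            finally show ?thesis ..
          qed
          \<comment> \<open>The powers of \<open>t\<close> cancel, and so do those of the
            determinant \<open>d\<close>, by
            \<open>\<gamma> * a = \<gamma>' * (1 - a)\<close>.\<close>
          also have "\<dots> = (t * (X * d powr \<gamma>)) powr a * (t powr (- (a / (1 - a))) * (Y * d powr - \<gamma>')) powr (1 - a)"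
          proof -
            have "- (a / (1 - a)) * (1 - a) = - a" "\<gamma> * a = \<gamma>' * (1 - a)"
              using a s by (simp_all add: \<gamma>'_def mult.commute)
            then have "t powr a * (t powr (- (a / (1 - a)))) powr (1 - a) = 1"
              "(d powr \<gamma>) powr a * (d powr - \<gamma>') powr (1 - a) = 1"
              using t d by (simp_all only: powr_powr flip: powr_add) simp_all
            moreover have "(t * (X * d powr \<gamma>)) powr a * (t powr (- (a / (1 - a))) * (Y * d powr - \<gamma>')) powr (1 - a)
                = (t powr a * (t powr (- (a / (1 - a)))) powr (1 - a)) * ((d powr \<gamma>) powr a * (d powr - \<gamma>') powr (1 - a)) * (X powr a * Y powr (1 - a))"
              using t X Y d by (simp only: powr_mult mult_ac)
            ultimately show ?thesis by simp
          qed
          also have "\<dots> \<le> a * (t * (X * d powr \<gamma>)) + (1 - a) * (t powr (- (a / (1 - a))) * (Y * d powr - \<gamma>'))"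
            by (rule Youngs_inequality_0) (use a t X Y d in auto)
          also have "\<dots> = a * t * (X * d powr \<gamma>) + 1 / (2 * C) * (Y * d powr - \<gamma>')"
          proof -
            have "q * (1 / (2 * q * C) * Z) = 1 / (2 * C) * Z" if "q \<noteq> 0" for q Z :: real using that by simp
            then show ?thesis unfolding ta using a by (simp only:)
          qed
          finally have "ennreal (\<Prod>j\<le>k. f j (y j) powr P j) \<le> ennreal (a * t * (X * d powr \<gamma>) + 1 / (2 * C) * (Y * d powr - \<gamma>'))"
            by (rule ennreal_leI)
          also have "\<dots> = ennreal (a * t) * F y + ennreal (1 / (2 * C)) * G y"
          proof -
            have "F y = ennreal (X * d powr \<gamma>)" "G y = ennreal (Y * d powr - \<gamma>')"
              using f0 X Y by (simp_all add: F_def G_def X_def Y_def d_def prod_ennreal ennreal_mult g_def)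
            then show ?thesis using a t C X Y by (simp add: ennreal_mult[symmetric] ennreal_plus[symmetric] del: ennreal_plus)
          qed
          finally show ?thesis by (simp add: prod_ennreal)
        qed
      qed
    qed
    also have "\<dots> = ennreal (a * t) * integral\<^sup>N N F + ennreal (1 / (2 * C)) * integral\<^sup>N N G"
      using Fm Gm by (simp add: nn_integral_add nn_integral_cmult)
    also have "\<dots> \<le> ennreal (a * t) * integral\<^sup>N N F + ennreal (1 / (2 * C)) * ennreal C"
      by (intro add_left_mono mult_left_mono GC) simp
    also have "ennreal (1 / (2 * C)) * ennreal C = ennreal (1 / 2)"
      using C by (simp add: ennreal_mult[symmetric])
    finally have le: "1 \<le> ennreal (a * t) * integral\<^sup>N N F + ennreal (1 / 2)" .
    have "ennreal (1 / (2 * a * t)) \<le> integral\<^sup>N N F"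
    proof (cases "integral\<^sup>N N F")
      case (real r)
      have "0 \<le> a * t" using a t by simp
      then have eq: "ennreal (a * t) * ennreal r + ennreal (1 / 2) = ennreal (a * t * r + 1 / 2)"
        using real(1) by (simp only: ennreal_mult[symmetric]) (intro ennreal_plus[symmetric], auto)
      have "ennreal 1 \<le> ennreal (a * t * r + 1 / 2)" using le unfolding real(2) eq by (simp only: ennreal_1)
      then have "1 \<le> a * t * r + 1 / 2" using a t real(1) by (subst (asm) ennreal_le_iff) auto
      then have "1 / (2 * a * t) \<le> r" using a t by (simp add: field_simps)
      then show ?thesis using real by (simp add: ennreal_leI)
    qed simp
    then show "ennreal (1 / (2 * a * t)) \<le> (\<integral>\<^sup>+y. (\<Prod>j\<le>k. ennreal (f j (y j))) * ennreal (simplex_det k y powr \<gamma>) \<partial>N)"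
      by (simp add: F_def[abs_def])
  qed
qed

text \<open>Cutting off \<open>f\<close> in height and in space, along an exhaustion by sets of
  finite measure, makes the integral finite; monotone convergence makes it as large as
  desired.\<close>

lemma ex_truncation:
  fixes f :: "'a \<Rightarrow> real" and p K :: real
  assumes [measurable]: "f \<in> borel_measurable \<mu>" and f0: "\<And>x. 0 \<le> f x" and "0 < p"
    and inf: "(\<integral>\<^sup>+x. ennreal (f x powr p) \<partial>\<mu>) = \<infinity>"
  shows "\<exists>g. g \<in> borel_measurable \<mu> \<and> (\<forall>x. 0 \<le> g x \<and> g x \<le> f x) \<and>
    ennreal K < (\<integral>\<^sup>+x. ennreal (g x powr p) \<partial>\<mu>) \<and> (\<integral>\<^sup>+x. ennreal (g x powr p) \<partial>\<mu>) < \<infinity>"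
proof -
  obtain A :: "nat \<Rightarrow> 'a set" where A: "range A \<subseteq> sets \<mu>" "(\<Union>i. A i) = space \<mu>" "\<And>i. emeasure \<mu> (A i) \<noteq> \<infinity>" "incseq A"
    using sigma_finite_incseq by blast
  have [measurable]: "A n \<in> sets \<mu>" for n using A(1) by auto
  define g where "g n x = min (f x) (real n) * indicator (A n) x" for n x
  have gm [measurable]: "g n \<in> borel_measurable \<mu>" for n
    unfolding g_def by measurable
  have g0: "0 \<le> g n x" "g n x \<le> f x" for n x using f0 by (auto simp: g_def indicator_def)
  have mono: "g n x \<le> g m x" if "n \<le> m" for n m x
    using that A(4) f0[of x] by (auto simp: g_def indicator_def incseq_def min_def)
  have sup: "(SUP n. ennreal (g n x powr p)) = ennreal (f x powr p)" for x
  proof (rule antisym)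
    show "(SUP n. ennreal (g n x powr p)) \<le> ennreal (f x powr p)"
      by (rule SUP_least) (use g0 \<open>0 < p\<close> in \<open>auto intro!: ennreal_leI powr_mono2\<close>)
    obtain n1 where n1: "x \<in> A n1" using A(2) by auto
    obtain n2 where n2: "f x \<le> real n2" using real_arch_simple by blast
    have "g (max n1 n2) x = f x"
    proof -
      have "x \<in> A (max n1 n2)" using n1 incseqD[OF A(4), of n1 "max n1 n2"] by auto
      moreover have "f x \<le> real (max n1 n2)" using n2 by linarith
      ultimately show ?thesis by (simp add: g_def min_def)
    qed
    then show "ennreal (f x powr p) \<le> (SUP n. ennreal (g n x powr p))"
      by (intro SUP_upper2[of "max n1 n2"]) auto
  qed
  have eq: "(SUP n. \<integral>\<^sup>+x. ennreal (g n x powr p) \<partial>\<mu>) = (\<integral>\<^sup>+x. (SUP n. ennreal (g n x powr p)) \<partial>\<mu>)"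
    by (rule nn_integral_monotone_convergence_SUP[symmetric])
      (use g0 mono \<open>0 < p\<close> in \<open>auto simp: incseq_def le_fun_def intro!: ennreal_leI powr_mono2\<close>)
  have "ennreal K < (SUP n. \<integral>\<^sup>+x. ennreal (g n x powr p) \<partial>\<mu>)" unfolding eq sup inf by simp
  then obtain n where n: "ennreal K < (\<integral>\<^sup>+x. ennreal (g n x powr p) \<partial>\<mu>)" unfolding less_SUP_iff by auto
  have "(\<integral>\<^sup>+x. ennreal (g n x powr p) \<partial>\<mu>) \<le> (\<integral>\<^sup>+x. ennreal (real n powr p) * indicator (A n) x \<partial>\<mu>)"
  proof (rule nn_integral_mono)
    fix x show "ennreal (g n x powr p) \<le> ennreal (real n powr p) * indicator (A n) x"
      using f0[of x] \<open>0 < p\<close> by (auto simp: g_def indicator_def intro!: ennreal_leI powr_mono2)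
  qed
  also have "\<dots> < \<infinity>" using A(3)[of n] by (simp add: nn_integral_cmult ennreal_mult_less_top less_top)
  finally show ?thesis using n gm g0 by blast
qed

text \<open>\<open>lower_normalized\<close> fixes all integrals to be 1, and homogeneity covers
  finite positive norms. A zero norm makes the right-hand side 0, by
  \<open>0 * \<infinity> = 0\<close>. If all norms are nonzero and one is infinite, truncation shows
  that the functional is infinite.\<close>

lemma ellipsoid_imp_lower_strong:
  assumes \<alpha>: "0 < \<alpha>" and cond: "ellipsoid_condition \<mu> k \<alpha>"
  shows "lower_strong \<mu> k \<alpha>"
  unfolding lower_strong_def
proof (intro allI impI, elim conjE)
  fix \<gamma> :: real and p :: "nat \<Rightarrow> ereal"
  assume \<gamma>: "0 < \<gamma>" and p1: "\<forall>i\<le>k. 0 \<le> p i \<and> p i \<le> 1"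
    and p2: "\<forall>i\<le>k. 1 / p i - 1 < ereal (\<gamma> / (real k * \<alpha>))"
    and p3: "(\<Sum>i\<le>k. 1 / p i - 1) = ereal (\<gamma> / \<alpha>)"
  define P where "P i = real_of_ereal (p i)" for i
  have pP: "p i = ereal (P i)" "0 < P i" "P i \<le> 1" if "i \<le> k" for i
  proof -
    have "p i \<noteq> 0" using p2 that by (auto simp: divide_ereal_def one_ereal_def)
    then show "p i = ereal (P i)" "0 < P i" "P i \<le> 1" using p1 that
      by (cases "p i"; force simp: P_def one_ereal_def zero_ereal_def)+
  qed
  define \<phi> where "\<phi> i = 1 / P i - 1" for i
  have p\<phi>: "1 / p i - 1 = ereal (\<phi> i)" if "i \<le> k" for i
    using pP[OF that] by (simp add: \<phi>_def one_ereal_def)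
  have P\<phi>: "1 / (1 + \<phi> i) = P i" for i by (simp add: \<phi>_def)
  have \<phi>: "0 \<le> \<phi> i" "\<phi> i < \<gamma> / (real k * \<alpha>)" if "i \<le> k" for i
    using pP[OF that] p2 p\<phi>[OF that] that by (auto simp: \<phi>_def)
  have sum\<phi>: "(\<Sum>i\<le>k. \<phi> i) = \<gamma> / \<alpha>"
  proof -
    have "(\<Sum>i\<le>k. 1 / p i - 1) = (\<Sum>i\<le>k. ereal (\<phi> i))" by (rule sum.cong) (use p\<phi> in auto)
    then show ?thesis using p3 by simp
  qed
  obtain c where c: "0 < c" and bound: "\<And>f. (\<And>j. j \<le> k \<Longrightarrow> f j \<in> borel_measurable \<mu>) \<Longrightarrow> (\<And>j x. 0 \<le> f j x) \<Longrightarrow>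
      (\<And>j. j \<le> k \<Longrightarrow> (\<integral>\<^sup>+x. ennreal (f j x powr P j) \<partial>\<mu>) = 1) \<Longrightarrow>
      ennreal c \<le> (\<integral>\<^sup>+y. (\<Prod>j\<le>k. ennreal (f j (y j))) * ennreal (simplex_det k y powr \<gamma>) \<partial>N)"
    using lower_normalized[of \<gamma> \<alpha> \<phi>] \<gamma> \<alpha> cond \<phi> sum\<phi> unfolding P\<phi> by blast
  have scaled: "ennreal (c * (\<Prod>j\<le>k. M j)) \<le> (\<integral>\<^sup>+y. (\<Prod>j\<le>k. ennreal (f j (y j))) * ennreal (simplex_det k y powr \<gamma>) \<partial>N)"
    if fm: "\<And>j. j \<le> k \<Longrightarrow> f j \<in> borel_measurable \<mu>" and f0: "\<And>j x. 0 \<le> f j x" and M: "\<And>j. 0 < M j"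
      and fM: "\<And>j. j \<le> k \<Longrightarrow> (\<integral>\<^sup>+x. ennreal (f j x powr P j) \<partial>\<mu>) = ennreal (M j powr P j)"
    for f :: "nat \<Rightarrow> 'a \<Rightarrow> real" and M
  proof -
    have "ennreal (c * (\<Prod>j\<le>k. M j)) = ennreal (\<Prod>j\<le>k. M j) * ennreal c"
      using c M by (simp add: ennreal_mult[symmetric] less_imp_le prod_nonneg mult.commute)
    also have "\<dots> \<le> ennreal (\<Prod>j\<le>k. M j) * (\<integral>\<^sup>+y. (\<Prod>j\<le>k. ennreal (f j (y j) / M j)) * ennreal (simplex_det k y powr \<gamma>) \<partial>N)"
    proof (intro mult_left_mono bound)
      fix j assume j: "j \<le> k"
      have "(\<integral>\<^sup>+x. ennreal ((f j x / M j) powr P j) \<partial>\<mu>) = ennreal (M j powr P j) * ennreal (1 / M j powr P j)"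
        using nn_integral_powr_divide[of "f j" "M j" "P j"] fm[OF j] f0 M fM[OF j] by simp
      also have "\<dots> = 1" using M[of j] by (simp add: ennreal_mult[symmetric])
      finally show "(\<integral>\<^sup>+x. ennreal ((f j x / M j) powr P j) \<partial>\<mu>) = 1" .
    qed (use fm f0 M in \<open>auto simp: less_imp_le\<close>)
    also have "\<dots> = (\<integral>\<^sup>+y. (\<Prod>j\<le>k. ennreal (f j (y j))) * ennreal (simplex_det k y powr \<gamma>) \<partial>N)"
      by (rule nn_integral_scale[symmetric]) (use fm f0 M in auto)
    finally show ?thesis .
  qed
  have "lower_ineq \<mu> k \<gamma> p c f" if fm: "\<forall>i\<le>k. f i \<in> borel_measurable \<mu>" for f
    unfolding lower_ineq_def
  proof -
    define T where "T = det_functional_nonneg \<mu> k \<gamma> (\<lambda>i x. ennreal (norm (f i x)))"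
    define I where "I j = (\<integral>\<^sup>+x. ennreal (norm (f j x) powr P j) \<partial>\<mu>)" for j
    have Lp: "Lp_norm \<mu> (p j) (f j) = ennreal_powr (I j) (1 / P j)" if "j \<le> k" for j
      using pP[OF that] by (simp add: Lp_norm_def I_def)
    \<comment> \<open>\<open>M j\<close> is the norm of \<open>f j\<close>, or an arbitrary
      \<open>K\<close> standing in for an infinite norm; in that case a truncation of norm at least
      \<open>K\<close> replaces \<open>norm (f j)\<close>.\<close>
    have T_ge: "ennreal (c * (\<Prod>j\<le>k. M j)) \<le> T"
      if M: "\<And>j. 0 < M j" and MI: "\<And>j. j \<le> k \<Longrightarrow> I j = ennreal (M j powr P j) \<or> (I j = \<infinity> \<and> M j = K)" and "0 < K" for M K
    proof -
      define Q where "Q j h m \<longleftrightarrow> h \<in> borel_measurable \<mu> \<and> (\<forall>x. 0 \<le> h x \<and> h x \<le> norm (f j x)) \<and> M j \<le> m \<and>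
          (\<integral>\<^sup>+x. ennreal (h x powr P j) \<partial>\<mu>) = ennreal (m powr P j)" for j h m
      have "\<exists>h m. Q j h m" if j: "j \<le> k" for j
      proof (cases "I j = \<infinity>")
        case False
        then have "I j = ennreal (M j powr P j)" using MI[OF j] by auto
        then show ?thesis using fm j by (intro exI[of _ "\<lambda>x. norm (f j x)"] exI[of _ "M j"]) (auto simp: I_def Q_def)
      next
        case True
        then have MK: "M j = K" using MI[OF j] by auto
        have "(\<lambda>x. norm (f j x)) \<in> borel_measurable \<mu>" using fm j by auto
        moreover have "(\<integral>\<^sup>+x. ennreal (norm (f j x) powr P j) \<partial>\<mu>) = \<infinity>" using True by (simp add: I_def)
        ultimately obtain h where h: "h \<in> borel_measurable \<mu>" "\<And>x. 0 \<le> h x \<and> h x \<le> norm (f j x)"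
          "ennreal (K powr P j) < (\<integral>\<^sup>+x. ennreal (h x powr P j) \<partial>\<mu>)" "(\<integral>\<^sup>+x. ennreal (h x powr P j) \<partial>\<mu>) < \<infinity>"
          using ex_truncation[of "\<lambda>x. norm (f j x)" "P j" "K powr P j"] pP(2)[OF j] by (meson norm_ge_zero)
        obtain r where r: "(\<integral>\<^sup>+x. ennreal (h x powr P j) \<partial>\<mu>) = ennreal r" "0 \<le> r"
          using h(4) by (cases "\<integral>\<^sup>+x. ennreal (h x powr P j) \<partial>\<mu>") auto
        have Kr: "K powr P j < r" using h(3) r by (simp add: ennreal_less_iff)
        have "K = (K powr P j) powr (1 / P j)" using \<open>0 < K\<close> pP[OF j] by (simp add: powr_powr)
        also have "\<dots> \<le> r powr (1 / P j)" using Kr pP[OF j] by (intro powr_mono2) auto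
        finally have "M j \<le> r powr (1 / P j)" using MK by simp
        moreover have "(r powr (1 / P j)) powr P j = r" using r(2) pP[OF j] by (simp add: powr_powr)
        ultimately show ?thesis using h(1,2) r(1) by (intro exI[of _ h] exI[of _ "r powr (1 / P j)"]) (auto simp: Q_def)
      qed
      then obtain h m where Qhm: "\<And>j. j \<le> k \<Longrightarrow> Q j (h j) (m j)" by metis
      have hm: "h j \<in> borel_measurable \<mu> \<and> (\<forall>x. 0 \<le> h j x \<and> h j x \<le> norm (f j x)) \<and> M j \<le> m j \<and>
          (\<integral>\<^sup>+x. ennreal (h j x powr P j) \<partial>\<mu>) = ennreal (m j powr P j)" if "j \<le> k" for j
        using Qhm[OF that] unfolding Q_def .
      define h' where "h' j = (if j \<le> k then h j else (\<lambda>_. 0))" for j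
      define m' where "m' j = (if j \<le> k then m j else 1)" for j
      have "c * (\<Prod>j\<le>k. M j) \<le> c * (\<Prod>j\<le>k. m' j)"
        using c M hm by (intro mult_left_mono prod_mono) (auto simp: m'_def less_imp_le)
      then have "ennreal (c * (\<Prod>j\<le>k. M j)) \<le> ennreal (c * (\<Prod>j\<le>k. m' j))" by (rule ennreal_leI)
      also have "\<dots> \<le> (\<integral>\<^sup>+y. (\<Prod>j\<le>k. ennreal (h' j (y j))) * ennreal (simplex_det k y powr \<gamma>) \<partial>N)"
      proof (rule scaled)
        show "0 < m' j" for j using M[of j] hm[of j] by (auto simp: m'_def)
      qed (use hm in \<open>auto simp: h'_def m'_def\<close>)
      also have "\<dots> \<le> T"
        unfolding T_def det_functional_nonneg_def
        by (intro nn_integral_mono mult_right_mono prod_mono_ennreal ennreal_leI) (use hm in \<open>auto simp: h'_def\<close>)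
      finally show ?thesis .
    qed
    have "ennreal c * (\<Prod>i\<le>k. Lp_norm \<mu> (p i) (f i)) \<le> T"
    proof (cases "\<exists>j\<le>k. I j = 0")
      case True
      then obtain j where j: "j \<le> k" "I j = 0" by auto
      have "Lp_norm \<mu> (p j) (f j) = 0" using Lp[OF j(1)] j(2) by (simp add: ennreal_powr_def)
      then have "(\<Prod>i\<le>k. Lp_norm \<mu> (p i) (f i)) = 0" using j(1) by (intro prod_zero) auto
      then show ?thesis by (simp only: mult_zero_right zero_le)
    next
      case False
      define M where "M K j = (if j \<le> k \<and> I j \<noteq> \<infinity> then enn2real (I j) powr (1 / P j) else K)" for K j
      have M: "0 < M K j" "j \<le> k \<Longrightarrow> I j = ennreal (M K j powr P j) \<or> (I j = \<infinity> \<and> M K j = K)" if "0 < K" for K j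
      proof -
        have *: "0 < r" if "I j = ennreal r" "j \<le> k" for r
          using False that by (cases "r > 0") (auto simp: ennreal_neg)
        show "0 < M K j" using \<open>0 < K\<close> * by (cases "I j") (auto simp: M_def)
        show "I j = ennreal (M K j powr P j) \<or> (I j = \<infinity> \<and> M K j = K)" if "j \<le> k"
          using pP[OF that] * that by (cases "I j") (auto simp: M_def powr_powr)
      qed
      show ?thesis
      proof (cases "\<exists>j\<le>k. I j = \<infinity>")
        case nf: False
        have "Lp_norm \<mu> (p j) (f j) = ennreal (M 1 j)" if "j \<le> k" for j
          using nf that by (simp add: Lp M_def ennreal_powr_def)
        then have "(\<Prod>i\<le>k. Lp_norm \<mu> (p i) (f i)) = (\<Prod>i\<le>k. ennreal (M 1 i))" by (intro prod.cong) auto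
        also have "\<dots> = ennreal (\<Prod>i\<le>k. M 1 i)" using M(1)[of 1] by (intro prod_ennreal) (simp add: less_imp_le)
        finally have "ennreal c * (\<Prod>i\<le>k. Lp_norm \<mu> (p i) (f i)) = ennreal (c * (\<Prod>i\<le>k. M 1 i))"
          using c M(1)[of 1] by (simp add: ennreal_mult[symmetric] prod_nonneg less_imp_le)
        then show ?thesis using T_ge[of "M 1" 1] M[of 1] by simp
      next
        case True
        then obtain i where i: "i \<le> k" "I i = \<infinity>" by auto
        \<comment> \<open>The factors other than \<open>i\<close>, with infinite norms replaced by
          1; they bound the product from below while \<open>K\<close> grows at index
          \<open>i\<close>.\<close>
        define B where "B = c * (\<Prod>j\<in>{..k} - {i}. M 1 j)"
        have B: "0 < B" unfolding B_def using c M(1)[of 1] by (intro mult_pos_pos prod_pos) auto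
        have big: "ennreal r \<le> T" for r
        proof -
          define K where "K = max 1 (r / B)"
          have K: "1 \<le> K" "r / B \<le> K" by (auto simp: K_def)
          have "r \<le> B * K" using K(2) B by (simp add: field_simps)
          also have "\<dots> \<le> c * (\<Prod>j\<le>k. M K j)"
          proof -
            have "(\<Prod>j\<in>{..k} - {i}. M 1 j) \<le> (\<Prod>j\<in>{..k} - {i}. M K j)"
              using K(1) M(1)[of 1] by (intro prod_mono) (auto simp: M_def less_imp_le)
            moreover have "(\<Prod>j\<le>k. M K j) = K * (\<Prod>j\<in>{..k} - {i}. M K j)"
              using i by (subst prod.remove[of _ i]) (auto simp: M_def)
            ultimately show ?thesis using c K(1) by (simp add: B_def mult_ac)
          qed
          finally have "ennreal r \<le> ennreal (c * (\<Prod>j\<le>k. M K j))" by (rule ennreal_leI)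
          also have "\<dots> \<le> T" using K(1) M[of K] by (intro T_ge[of "M K" K]) auto
          finally show ?thesis .
        qed
        have "T = \<infinity>"
        proof (rule ccontr)
          assume "T \<noteq> \<infinity>"
          then obtain r where r: "T = ennreal r" "0 \<le> r" by (cases T) auto
          have "r + 1 \<le> r" using big[of "r + 1"] unfolding r(1) ennreal_le_iff[OF r(2)] .
          then show False by simp
        qed
        then show ?thesis by simp
      qed
    qed
    then show "ennreal c * (\<Prod>i\<le>k. Lp_norm \<mu> (p i) (f i)) \<le> det_functional_nonneg \<mu> k \<gamma> (\<lambda>i x. ennreal (norm (f i x)))"
      by (simp add: T_def)
  qed
  then show "\<exists>c>0. \<forall>f. (\<forall>i\<le>k. f i \<in> borel_measurable \<mu>) \<longrightarrow> lower_ineq \<mu> k \<gamma> p c f"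
    using c by blast
qed

end

theorem theorem1:
  fixes \<mu> :: "'a::{real_inner, polish_space} measure" and k :: nat and \<alpha> :: real
  assumes "1 \<le> k" and "enat k \<le> vdim (UNIV :: 'a set)"
    and "0 < \<alpha>"
    and "k_admissible k \<mu>"
  shows "(ellipsoid_condition \<mu> k \<alpha> \<longleftrightarrow> upper_strong \<mu> k \<alpha>) \<and>
         (ellipsoid_condition \<mu> k \<alpha> \<longleftrightarrow> upper_restricted \<mu> k \<alpha>) \<and>
         (ellipsoid_condition \<mu> k \<alpha> \<longleftrightarrow> lower_strong \<mu> k \<alpha>) \<and>
         (ellipsoid_condition \<mu> k \<alpha> \<longleftrightarrow> lower_restricted \<mu> k \<alpha>)"
proof -
  interpret det_setting \<mu> k
    using assms by unfold_locales
  \<comment> \<open>Two cycles through \<open>ellipsoid_condition\<close>: one along the upper and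
    one along the lower inequalities.\<close>
  show ?thesis
    using ellipsoid_imp_upper_strong[OF assms(3)] upper_strong_imp_restricted[OF assms(3)]
      upper_restricted_imp_ellipsoid[OF assms(3)] ellipsoid_imp_lower_strong[OF assms(3)]
      lower_strong_imp_restricted[OF assms(3)] lower_restricted_imp_ellipsoid[OF assms(3)]
    by blast
qed

end
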